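(* Let $\widehat H\in(0,1)$ and let $\xi_n\sim N(0,T_n(f_{\widehat H}))$, $n\ge1$, be random vectors on a common probability space. Let $I=(\widehat H-\tfrac12,1)\cap(0,1)$. Put $\rho_n(u)=n^{-1}\langle\xi_n,T_n(f_u)^{-1}\xi_n\rangle$ and $\rho_\infty(u)=F(u,\widehat H):=\frac1{2\pi}\int_{-\pi}^{\pi}\frac{f_{\widehat H}(t)}{f_u(t)}\,dt$ for $u\in I$. Then \[ \mathbb P\big(\rho_n\to\rho_\infty\ \text{uniformly on every compact subset of } I\big)=1 . \]
   Context: For $H\in(0,1)$ let $f_H(\lambda)=C_H|e^{i\lambda}-1|^2\sum_{k\in\mathbb Z}|\lambda-2\pi k|^{-(2H+1)}$, $\lambda\in[-\pi,\pi)$, with $C_H>0$ the normalizing constant making $f_H$ the spectral density of fractional Gaussian noise (unit-spaced increments of fractional Brownian motion $Z$ with $\mathrm{Var}\,Z_t=|t|^{2H}$). For integrable $g$ on $[-\pi,\pi)$, $\hat g(m)=\frac1{2\pi}\int_{-\pi}^{\pi}e^{-imt}g(t)\,dt$ and $T_n(g)=(\hat g(j-k))_{j,k=1}^n$. *)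

theory Defs
  imports "HOL-Probability.Probability" "Jordan_Normal_Form.Gauss_Jordan_Elimination"
begin

definition fgn_shape :: "real \<Rightarrow> real \<Rightarrow> real" where
  "fgn_shape H x = (cmod (exp (\<i> * complex_of_real x) - 1))\<^sup>2 *
     (\<Sum>\<^sub>\<infinity>k::int. \<bar>x - 2 * pi * real_of_int k\<bar> powr (-(2 * H + 1)))"

text \<open>Normalising constant C_H: chosen so that the variance of the increment Z_1 - Z_0,
  i.e. the 0-th Fourier coefficient of f_H, equals 1 (Var Z_t = |t|^(2H)).\<close>
definition fgn_const :: "real \<Rightarrow> real" where
  "fgn_const H = 1 / ((LBINT t=-pi..pi. fgn_shape H t) / (2 * pi))"

definition fgn_sd :: "real \<Rightarrow> real \<Rightarrow> real" where
  "fgn_sd H x = fgn_const H * fgn_shape H x"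

definition fourier_coeff :: "(real \<Rightarrow> real) \<Rightarrow> int \<Rightarrow> complex" where
  "fourier_coeff g m = (CLBINT t=-pi..pi. exp (- \<i> * of_int m * of_real t) * of_real (g t)) / (2 * pi)"

definition toeplitz :: "nat \<Rightarrow> (real \<Rightarrow> real) \<Rightarrow> complex mat" where
  "toeplitz n g = mat n n (\<lambda>(j, k). fourier_coeff g (int j - int k))"

definition centred_gaussian_vector :: "'a measure \<Rightarrow> nat \<Rightarrow> ('a \<Rightarrow> nat \<Rightarrow> real) \<Rightarrow> bool" where
  "centred_gaussian_vector M n X \<longleftrightarrow>
     (\<forall>i<n. (\<lambda>\<omega>. X \<omega> i) \<in> borel_measurable M) \<and>
     (\<forall>c :: nat \<Rightarrow> real. \<exists>\<sigma>\<ge>0.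
        (\<sigma> = 0 \<longrightarrow> (AE \<omega> in M. (\<Sum>i<n. c i * X \<omega> i) = 0)) \<and>
        (\<sigma> > 0 \<longrightarrow> distributed M lborel (\<lambda>\<omega>. \<Sum>i<n. c i * X \<omega> i) (normal_density 0 \<sigma>)))"

definition normal_vector :: "'a measure \<Rightarrow> nat \<Rightarrow> complex mat \<Rightarrow> ('a \<Rightarrow> nat \<Rightarrow> real) \<Rightarrow> bool" where
  "normal_vector M n \<Sigma> X \<longleftrightarrow> centred_gaussian_vector M n X \<and>
     (\<forall>i<n. \<forall>j<n. complex_of_real (integral\<^sup>L M (\<lambda>\<omega>. X \<omega> i * X \<omega> j)) = \<Sigma> $$ (i, j))"

definition rho_n :: "nat \<Rightarrow> (nat \<Rightarrow> real) \<Rightarrow> real \<Rightarrow> complex" where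
  "rho_n n x u = (let v = vec n (\<lambda>i. complex_of_real (x i)) in
     (v \<bullet> (the (mat_inverse (toeplitz n (fgn_sd u))) *\<^sub>v v)) / of_nat n)"

definition F_lim :: "real \<Rightarrow> real \<Rightarrow> real" where
  "F_lim u H = (LBINT t=-pi..pi. fgn_sd H t / fgn_sd u t) / (2 * pi)"

end

theory Submission
  imports Defs "Jordan_Normal_Form.Determinant" "HOL-Real_Asymp.Real_Asymp"
begin

text \<open>
  Write \<open>f\<close> for the spectral density with parameter \<open>Hh\<close> and \<open>g\<close> for the one with parameter \<open>u\<close>.
  Factor \<open>T_n(g)\<inverse> = W W\<^sup>T\<close>, where the columns of \<open>W\<close> are orthonormal for \<open>T_n(g)\<close>; the corresponding
  trigonometric polynomials \<open>p_i\<close> are orthonormal in \<open>L\<^sup>2(g)\<close> and \<open>K_n = \<Sum> |p_i|\<^sup>2\<close> is a Christoffel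
  function.  Then \<open>E \<rho>_n(u)\<close> is the mean of \<open>f K_n / n\<close> over the circle.  With the Fejer kernel \<open>F_n\<close>,
  the extremal properties of \<open>K_n\<close> give \<open>1 / (F_n * g) \<le> K_n / n \<le> F_n * (1 / g)\<close>, so
  \<open>K_n / n \<rightarrow> 1 / g\<close> off the origin, and the upper bound is dominated by the same power of \<open>|t|\<close> as
  \<open>1 / g\<close>.  Since \<open>u > Hh - 1/2\<close>, dominated convergence yields \<open>E \<rho>_n(u) \<rightarrow> F(u, Hh)\<close>.

  The same domination bounds the covariance matrix of \<open>W\<^sup>T \<xi>_n\<close> by \<open>O(n\<^sup>\<gamma>)\<close> with \<open>\<gamma> < 1\<close> in operator
  norm.  Exponential moments of \<open>|W\<^sup>T \<xi>_n|\<^sup>2\<close> are computed by linearising one square at a time with an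
  auxiliary standard Gaussian variable, so neither a diagonalisation nor independence is used.  The
  resulting tail bound \<open>exp (- c n\<^bsup>1 - \<gamma>\<^esup>)\<close> is summable, and Borel-Cantelli gives almost sure
  convergence for each fixed \<open>u\<close>.

  For uniformity, \<open>f_u \<le> (1 + \<epsilon>) f_v\<close> for \<open>u \<le> v\<close> close together, hence \<open>\<rho>_n(v) \<le> (1 + \<epsilon>) \<rho>_n(u)\<close>;
  an almost decreasing sequence converging at rational points to a continuous limit converges locally
  uniformly.
\<close>

subsection \<open>Trigonometric polynomials and Toeplitz forms\<close>

text \<open>The obstacle is the origin: f and 1/g may both be unbounded there, so f/g need not be
  bounded, and the covariance of \<open>W\<^sup>T \<xi>_n\<close> may have a norm that grows with n.
  The hypothesis on u enters only through two exponents: f is O(|t|^-a) with a = max 0 (2 Hh - 1),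
  and 1/g is O(|t|^-b) with b = max 0 (1 - 2 u). If both are positive, a + b = 2 (Hh - u) < 1;
  otherwise a + b < 1 follows from Hh < 1 and u > 0. This sum is the \<gamma> of the overview. A
  deviation of size \<epsilon> n is tested against a norm of order n^\<gamma>, which leaves the
  exponent n^(1 - \<gamma>).

  Nothing relates the vectors \<xi>_n for different n, so almost sure convergence has to come from
  tails that are summable by themselves. Both tails are needed: the upper one uses moment generating
  functions, the lower one characteristic functions.

  The comparison of densities in u is one-sided because f_v / f_u is unbounded near 0 for u < v.
  This is why uniformity rests on almost monotonicity and not on equicontinuity.\<close>

definition circ_measure :: "real measure" where
  "circ_measure = density lborel (\<lambda>t. ennreal (indicator {-pi<..<pi} t / (2 * pi)))"

lemma space_circ [simp]: "space circ_measure = UNIV" and sets_circ [simp, measurable_cong]: "sets circ_measure = sets borel"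
  by (simp_all add: circ_measure_def)

text \<open>The origin is a null set, so pointwise bounds and limits are only ever required where
  the spectral density is regular.\<close>

lemma AE_circI:
  assumes "\<And>t. -pi < t \<Longrightarrow> t < pi \<Longrightarrow> t \<noteq> 0 \<Longrightarrow> P t"
  shows "AE t in circ_measure. P t"
proof -
  have "AE t in lborel. t \<noteq> (0::real)" by (rule AE_lborel_singleton)
  then show ?thesis unfolding circ_measure_def
    by (subst AE_density) (auto simp: indicator_def elim!: eventually_mono intro!: assms)
qed

text \<open>Only values inside the interval matter: \<open>f\<close> may be replaced by any function
  \<open>h\<close> that is known to be Borel on the whole line. This moves the integrals of the
  statement to a probability measure.\<close>

lemma circ_integral:
  fixes f h :: "real \<Rightarrow> 'b::{banach, second_countable_topology}"
  assumes [measurable]: "h \<in> borel_measurable borel" and eq: "\<And>t. -pi < t \<Longrightarrow> t < pi \<Longrightarrow> f t = h t"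
  shows "(LBINT t=-pi..pi. f t) = (2 * pi) *\<^sub>R integral\<^sup>L circ_measure h"
proof -
  have "integral\<^sup>L circ_measure h = (LINT t|lborel. (indicator {-pi<..<pi} t / (2 * pi)) *\<^sub>R h t)"
    unfolding circ_measure_def by (rule integral_density) auto
  also have "\<dots> = (LINT t|lborel. (1 / (2 * pi)) *\<^sub>R (indicator {-pi<..<pi} t *\<^sub>R f t))"
    by (intro Bochner_Integration.integral_cong) (auto simp: indicator_def eq)
  also have "\<dots> = (1 / (2 * pi)) *\<^sub>R (LINT t|lborel. indicator {-pi<..<pi} t *\<^sub>R f t)"
    by (rule integral_scaleR_right)
  finally show ?thesis
    unfolding interval_lebesgue_integral_def set_lebesgue_integral_def einterval_def
    by (simp add: greaterThanLessThan_def greaterThan_def lessThan_def Int_def conj_commute)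
qed

lemma circ_integral_uminus:
  fixes h :: "real \<Rightarrow> 'b::{banach, second_countable_topology}"
  assumes [measurable]: "h \<in> borel_measurable borel"
  shows "(LINT t|circ_measure. h (- t)) = integral\<^sup>L circ_measure h"
proof -
  have "(LINT t|circ_measure. h (-t)) = (LINT t|lborel. (indicator {-pi<..<pi} t / (2 * pi)) *\<^sub>R h (-t))"
    unfolding circ_measure_def by (rule integral_density) auto
  also have "\<dots> = (LINT t|lborel. (indicator {-pi<..<pi} (-t) / (2 * pi)) *\<^sub>R h t)"
    by (subst lborel_integral_real_affine[where c="-1" and t=0]) auto
  also have "\<dots> = (LINT t|lborel. (indicator {-pi<..<pi} t / (2 * pi)) *\<^sub>R h t)"
    by (intro Bochner_Integration.integral_cong) (auto simp: indicator_def)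
  also have "\<dots> = integral\<^sup>L circ_measure h"
    unfolding circ_measure_def by (rule integral_density[symmetric]) auto
  finally show ?thesis .
qed

lemma prob_space_circ: "prob_space circ_measure"
proof
  have "emeasure circ_measure (space circ_measure) = (\<integral>\<^sup>+ t. ennreal (1/(2*pi)) * indicator {-pi<..<pi} t \<partial>lborel)"
    unfolding circ_measure_def by (subst emeasure_density) (auto intro!: nn_integral_cong simp: indicator_def)
  also have "\<dots> = 1"
    by (subst nn_integral_cmult_indicator) (auto simp: ennreal_mult[symmetric])
  finally show "emeasure circ_measure (space circ_measure) = 1" .
qed

lemma circ_integral_cis: "(LINT t|circ_measure. cis (of_int m * t)) = (if m = 0 then 1 else 0)"
proof (cases "m = 0")
  case True
  interpret prob_space circ_measure by (rule prob_space_circ)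
  show ?thesis using True by (simp add: cis_conv_exp prob_space[simplified])
next
  case False
  let ?F = "\<lambda>t. cis (of_int m * t) / (\<i> * of_int m)"
  have "(LBINT t=-pi..pi. cis (of_int m * t)) = ?F pi - ?F (-pi)"
  proof (rule interval_integral_FTC_finite)
    show "continuous_on {min (-pi) pi..max (-pi) pi} (\<lambda>t. cis (of_int m * t))"
      by (auto simp: cis_conv_exp intro!: continuous_intros)
    show "(?F has_vector_derivative cis (of_int m * t)) (at t within {min (-pi) pi..max (-pi) pi})" for t
      using False unfolding cis_conv_exp
      by (auto intro!: derivative_eq_intros has_vector_derivative_real_field simp: field_simps)
  qed
  also have "\<dots> = 0"
  proof -
    have "cis (of_int m * pi) = cis (of_int m * (-pi))"
      using sin_npi_int[of m] by (simp add: complex_eq_iff mult.commute)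
    then show ?thesis by simp
  qed
  finally show ?thesis
    using False circ_integral[of "\<lambda>t. cis (of_int m * t)" "\<lambda>t. cis (of_int m * t)"] by (simp add: cis_conv_exp)
qed

text \<open>For an even symbol this is the Fourier coefficient itself. The Toeplitz forms can thus
  be treated over the reals although \<open>toeplitz\<close> is a complex matrix.\<close>

definition cos_coeff :: "(real \<Rightarrow> real) \<Rightarrow> int \<Rightarrow> real" where
  "cos_coeff g m = (LINT t|circ_measure. g t * cos (of_int m * t))"

lemma integrable_bdd_mult:
  fixes g :: "real \<Rightarrow> real" and h :: "real \<Rightarrow> 'b::{real_normed_algebra_1, banach, second_countable_topology}"
  assumes "integrable circ_measure g" and [measurable]: "h \<in> borel_measurable borel" and "\<And>t. norm (h t) \<le> B"
  shows "integrable circ_measure (\<lambda>t. of_real (g t) * h t)"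
proof (rule Bochner_Integration.integrable_bound)
  have [measurable]: "g \<in> borel_measurable borel" using assms(1) by (auto dest: borel_measurable_integrable)
  show "integrable circ_measure (\<lambda>t. \<bar>g t\<bar> * B)" using assms(1) by auto
  show "(\<lambda>t. of_real (g t) * h t) \<in> borel_measurable circ_measure" by measurable
  show "AE t in circ_measure. norm (of_real (g t) * h t) \<le> norm (\<bar>g t\<bar> * B)"
  proof (rule AE_I2)
    fix t have "norm (of_real (g t) * h t) \<le> \<bar>g t\<bar> * norm (h t)"
      using norm_mult_ineq[of "of_real (g t) :: 'b" "h t"] by simp
    also have "\<dots> \<le> \<bar>g t\<bar> * B" using assms(3) by (simp add: mult_left_mono)
    finally show "norm (of_real (g t) * h t) \<le> norm (\<bar>g t\<bar> * B)" by (simp add: order_trans[OF _ abs_ge_self])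
  qed
qed

lemma cis_measurable[measurable]: "cis \<in> borel_measurable borel"
  by (simp add: cis_conv_exp[abs_def])

lemma integral_cis_mult_even:
  assumes g: "integrable circ_measure g" and ev: "\<And>t. g (-t) = g t"
  shows "(LINT t|circ_measure. of_real (g t) * cis (of_int m * t)) = of_real (cos_coeff g m)"
proof -
  have [measurable]: "g \<in> borel_measurable borel" using g by (auto dest: borel_measurable_integrable)
  have int: "integrable circ_measure (\<lambda>t. of_real (g t) * cis (of_int m * t))"
    by (rule integrable_bdd_mult[OF g, of _ 1]) auto
  have "(LINT t|circ_measure. g t * sin (of_int m * t)) = (LINT t|circ_measure. g (-t) * sin (of_int m * (-t)))"
    by (rule circ_integral_uminus[symmetric]) measurable
  also have "\<dots> = - (LINT t|circ_measure. g t * sin (of_int m * t))" using ev by simp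
  finally have "(LINT t|circ_measure. g t * sin (of_int m * t)) = 0" by simp
  then show ?thesis
    using integral_Re[OF int] integral_Im[OF int] by (intro complex_eqI) (simp_all add: cos_coeff_def)
qed

lemma fourier_coeff_eq_cos_coeff:
  assumes g: "integrable circ_measure g" and ev: "\<And>t. g (-t) = g t" and eq: "\<And>t. -pi < t \<Longrightarrow> t < pi \<Longrightarrow> f t = g t"
  shows "fourier_coeff f m = of_real (cos_coeff g m)"
proof -
  have [measurable]: "g \<in> borel_measurable borel" using g by (auto dest: borel_measurable_integrable)
  have "(CLBINT t=-pi..pi. exp (- \<i> * of_int m * of_real t) * of_real (f t)) =
    (2 * pi) *\<^sub>R (LINT t|circ_measure. of_real (g t) * cis (of_int (-m) * t))"
    by (rule circ_integral) (auto simp: cis_conv_exp eq mult_ac)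
  also have "\<dots> = (2 * pi) *\<^sub>R of_real (cos_coeff g (-m))"
    by (subst integral_cis_mult_even[OF g ev]) auto
  finally show ?thesis by (simp add: fourier_coeff_def scaleR_conv_of_real cos_coeff_def)
qed

definition trig :: "nat \<Rightarrow> (nat \<Rightarrow> complex) \<Rightarrow> real \<Rightarrow> complex" where
  "trig n x t = (\<Sum>j<n. x j * cis (real j * t))"

lemma trig_measurable[measurable]: "trig n x \<in> borel_measurable borel"
  unfolding trig_def[abs_def] by measurable

lemma cnj_measurable[measurable]: "f \<in> borel_measurable M \<Longrightarrow> (\<lambda>x. cnj (f x)) \<in> borel_measurable M"
  by (rule borel_measurable_continuous_on[OF continuous_on_cnj[OF continuous_on_id]])

lemma trig_bound: "norm (trig n x t) \<le> (\<Sum>j<n. norm (x j))"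
  unfolding trig_def by (rule order_trans[OF norm_sum]) (simp add: norm_mult)

lemma integrable_trig_mult:
  assumes g: "integrable circ_measure g"
  shows "integrable circ_measure (\<lambda>t. of_real (g t) * (trig n x t * cnj (trig n y t)))"
proof (rule integrable_bdd_mult[OF g])
  show "norm (trig n x t * cnj (trig n y t)) \<le> (\<Sum>j<n. norm (x j)) * (\<Sum>j<n. norm (y j))" for t
    by (auto simp: norm_mult intro!: mult_mono trig_bound sum_nonneg)
qed measurable

lemma cis_mult_cnj_cis: "cis a * cnj (cis b) = cis (a - b)"
  by (simp add: cis_cnj cis_mult)

lemma integral_trig_mult:
  assumes g: "integrable circ_measure g" and ev: "\<And>t. g (-t) = g t"
  shows "(LINT t|circ_measure. of_real (g t) * (trig n x t * cnj (trig n y t))) =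
    (\<Sum>j<n. \<Sum>k<n. x j * cnj (y k) * of_real (cos_coeff g (int j - int k)))"
proof -
  have "trig n x t * cnj (trig n y t) = (\<Sum>j<n. \<Sum>k<n. x j * cnj (y k) * cis (of_int (int j - int k) * t))" for t
    unfolding trig_def cnj_sum sum_product
    by (intro sum.cong refl) (simp add: cis_mult_cnj_cis[symmetric] left_diff_distrib)
  then have *: "of_real (g t) * (trig n x t * cnj (trig n y t)) =
     (\<Sum>j<n. \<Sum>k<n. x j * cnj (y k) * (of_real (g t) * cis (of_int (int j - int k) * t)))" for t
    by (simp add: sum_distrib_left mult_ac)
  have int: "integrable circ_measure (\<lambda>t. of_real (g t) * cis (of_int m * t))" for m
    by (rule integrable_bdd_mult[OF g, of _ 1]) auto
  have "(LINT t|circ_measure. of_real (g t) * (trig n x t * cnj (trig n y t))) =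
     (\<Sum>j<n. LINT t|circ_measure. (\<Sum>k<n. x j * cnj (y k) * (of_real (g t) * cis (of_int (int j - int k) * t))))"
    unfolding * by (intro Bochner_Integration.integral_sum Bochner_Integration.integrable_sum integrable_mult_right int)
  also have "\<dots> = (\<Sum>j<n. \<Sum>k<n. LINT t|circ_measure. x j * cnj (y k) * (of_real (g t) * cis (of_int (int j - int k) * t)))"
    by (intro sum.cong refl Bochner_Integration.integral_sum integrable_mult_right int)
  also have "\<dots> = (\<Sum>j<n. \<Sum>k<n. x j * cnj (y k) * of_real (cos_coeff g (int j - int k)))"
    by (intro sum.cong refl) (simp only: integral_mult_right_zero integral_cis_mult_even[OF g ev])
  finally show ?thesis .
qed

lemma cos_coeff_1: "cos_coeff (\<lambda>_. 1) m = (if m = 0 then 1 else 0)"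
proof -
  have "of_real (cos_coeff (\<lambda>_. 1) m) = (LINT t|circ_measure. cis (of_int m * t))"
    using finite_measure.integrable_const[OF prob_space.finite_measure[OF prob_space_circ], of "1::real"]
    by (subst integral_cis_mult_even[symmetric]) auto
  then show ?thesis by (simp only: circ_integral_cis) (auto split: if_splits)
qed

lemma cos_coeff_minus: "cos_coeff g (-m) = cos_coeff g m"
  by (simp add: cos_coeff_def)

text \<open>The bilinear form of the Toeplitz matrix. Vectors are functions on all naturals of which
  only the entries below \<open>n\<close> count, so linear combinations need no carrier
  sets.\<close>

definition tform :: "(real \<Rightarrow> real) \<Rightarrow> nat \<Rightarrow> (nat \<Rightarrow> real) \<Rightarrow> (nat \<Rightarrow> real) \<Rightarrow> real" where
  "tform g n x y = (\<Sum>j<n. \<Sum>k<n. x j * y k * cos_coeff g (int j - int k))"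

lemma tform_commute: "tform g n x y = tform g n y x"
proof -
  have "cos_coeff g (int j - int k) = cos_coeff g (int k - int j)" for j k
    using cos_coeff_minus[of g "int k - int j"] by simp
  then show ?thesis unfolding tform_def by (subst sum.swap) (simp add: mult.commute)
qed

abbreviation ctrig where "ctrig n x \<equiv> trig n (\<lambda>j. complex_of_real (x j))"

lemma integral_ctrig_mult:
  assumes g: "integrable circ_measure g" and ev: "\<And>t. g (-t) = g t"
  shows "(LINT t|circ_measure. of_real (g t) * (ctrig n x t * cnj (ctrig n y t))) = of_real (tform g n x y)"
  by (subst integral_trig_mult[OF g ev]) (simp add: tform_def)

lemma integrable_norm_trig:
  assumes g: "integrable circ_measure g"
  shows "integrable circ_measure (\<lambda>t. g t * (norm (trig n x t))\<^sup>2)"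
  using integrable_bdd_mult[OF g, of "\<lambda>t. (norm (trig n x t))\<^sup>2" "(\<Sum>j<n. norm (x j))\<^sup>2"]
  by (simp add: trig_bound power_mono)

lemma tform_eq_integral:
  assumes g: "integrable circ_measure g" and ev: "\<And>t. g (-t) = g t"
  shows "tform g n x x = (LINT t|circ_measure. g t * (norm (ctrig n x t))\<^sup>2)"
proof -
  have "complex_of_real (tform g n x x) = (LINT t|circ_measure. of_real (g t) * (ctrig n x t * cnj (ctrig n x t)))"
    by (rule integral_ctrig_mult[OF g ev, symmetric])
  also have "\<dots> = (LINT t|circ_measure. complex_of_real (g t * (norm (ctrig n x t))\<^sup>2))"
    by (simp only: of_real_mult complex_norm_square)
  finally show ?thesis by (simp only: integral_complex_of_real of_real_eq_iff)
qed

lemma tform_one: "tform (\<lambda>_. 1) n x x = (\<Sum>j<n. (x j)\<^sup>2)"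
  unfolding tform_def cos_coeff_1 by (auto simp: power2_eq_square if_distrib sum.delta cong: if_cong intro!: sum.cong)

text \<open>If the form vanished, the polynomial would be zero almost everywhere, since
  \<open>g\<close> is positive there; Parseval, which is the same integral formula for the symbol 1,
  would then kill every coefficient.\<close>

lemma tform_pos:
  assumes g: "integrable circ_measure g" and ev: "\<And>t. g (-t) = g t"
    and pos: "\<And>t. -pi < t \<Longrightarrow> t < pi \<Longrightarrow> t \<noteq> 0 \<Longrightarrow> g t > 0" and "j < n" "x j \<noteq> 0"
  shows "tform g n x x > 0"
proof -
  interpret prob_space circ_measure by (rule prob_space_circ)
  have nn: "AE t in circ_measure. 0 \<le> g t * (norm (ctrig n x t))\<^sup>2"
    by (rule AE_circI) (simp add: pos less_imp_le)
  have "tform g n x x \<noteq> 0"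
  proof
    assume "tform g n x x = 0"
    then have "AE t in circ_measure. g t * (norm (ctrig n x t))\<^sup>2 = 0"
      using integral_nonneg_eq_0_iff_AE[OF integrable_norm_trig[OF g] nn] by (simp add: tform_eq_integral[OF g ev])
    moreover have "AE t in circ_measure. g t > 0" by (rule AE_circI) (simp add: pos)
    ultimately have "AE t in circ_measure. 1 * (norm (ctrig n x t))\<^sup>2 = 0" by eventually_elim auto
    then have "(LINT t|circ_measure. 1 * (norm (ctrig n x t))\<^sup>2) = 0"
      by (subst integral_cong_AE[where g="\<lambda>_. 0"]) auto
    then have "tform (\<lambda>_. 1) n x x = 0" by (subst tform_eq_integral) auto
    then have "\<forall>j\<in>{..<n}. (x j)\<^sup>2 = 0" unfolding tform_one by (subst (asm) sum_nonneg_eq_0_iff) auto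
    with assms(4,5) show False by auto
  qed
  moreover have "tform g n x x \<ge> 0" unfolding tform_eq_integral[OF g ev] by (rule integral_nonneg_AE[OF nn])
  ultimately show ?thesis by simp
qed

subsection \<open>Christoffel functions\<close>

lemma tform_add_left: "tform g n (\<lambda>j. x j + y j) z = tform g n x z + tform g n y z"
  by (simp add: tform_def distrib_right sum.distrib)

lemma tform_scale_left: "tform g n (\<lambda>j. c * x j) z = c * tform g n x z"
  by (simp add: tform_def sum_distrib_left mult_ac)

lemma tform_sum_left: "tform g n (\<lambda>j. \<Sum>i\<in>I. c i * x i j) z = (\<Sum>i\<in>I. c i * tform g n (x i) z)"
proof (induction I rule: infinite_finite_induct)
  case (insert a F)
  then show ?case by (simp add: tform_add_left tform_scale_left)
qed (simp_all add: tform_def)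

lemma tform_diff_left: "tform g n (\<lambda>j. x j - y j) z = tform g n x z - tform g n y z"
  by (simp add: tform_def left_diff_distrib sum_subtractf)

definition tform_orthonormal :: "(real \<Rightarrow> real) \<Rightarrow> nat \<Rightarrow> (nat \<Rightarrow> nat \<Rightarrow> real) \<Rightarrow> bool" where
  "tform_orthonormal g n w \<longleftrightarrow> (\<forall>i<n. \<forall>j<n. tform g n (w i) (w j) = (if i = j then 1 else 0))"

text \<open>Gram-Schmidt for the form, applied to the standard basis.\<close>

lemma tform_orthonormal_ex:
  assumes pos: "\<And>x j. j < n \<Longrightarrow> x j \<noteq> 0 \<Longrightarrow> tform g n x x > 0"
  shows "\<exists>w. tform_orthonormal g n w"
proof -
  \<comment> \<open>Triangularity is carried through the induction because it forces
    \<open>v k = 1\<close> for the next vector, which is therefore nonzero and can be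
    normalised.\<close>
  have "\<exists>w. (\<forall>i<k. \<forall>j<k. tform g n (w i) (w j) = (if i = j then 1 else 0)) \<and> (\<forall>i<k. \<forall>j>i. w i j = 0)"
    if "k \<le> n" for k
    using that
  proof (induction k)
    case 0 then show ?case by auto
  next
    case (Suc k)
    then obtain w where w: "\<And>i j. i < k \<Longrightarrow> j < k \<Longrightarrow> tform g n (w i) (w j) = (if i = j then 1 else 0)"
      and tri: "\<And>i j. i < k \<Longrightarrow> i < j \<Longrightarrow> w i j = 0" by fastforce
    define e where "e = (\<lambda>j. if j = k then 1 else (0::real))"
    define v where "v = (\<lambda>j. e j - (\<Sum>i<k. tform g n e (w i) * w i j))"
    have vw: "tform g n v (w i) = 0" if "i < k" for i
    proof -
      have "tform g n v (w i) = tform g n e (w i) - (\<Sum>l<k. tform g n e (w l) * tform g n (w l) (w i))"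
        unfolding v_def tform_diff_left tform_sum_left ..
      also have "(\<Sum>l<k. tform g n e (w l) * tform g n (w l) (w i)) = (\<Sum>l<k. if l = i then tform g n e (w l) else 0)"
        by (intro sum.cong) (auto simp: w that)
      finally show ?thesis using that by simp
    qed
    have "v k = 1" by (simp add: v_def e_def tri)
    then have p: "tform g n v v > 0" using pos[of k v] Suc.prems by auto
    define c where "c = 1 / sqrt (tform g n v v)"
    have cc: "c * c * tform g n v v = 1" using p by (simp add: c_def)
    define w' where "w' = w(k := \<lambda>j. c * v j)"
    have sc: "tform g n (\<lambda>j. c * v j) (w i) = 0" "tform g n (w i) (\<lambda>j. c * v j) = 0" if "i < k" for i
      using vw[OF that] tform_commute[of g n "w i" "\<lambda>j. c * v j"] by (simp_all add: tform_scale_left)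
    have "tform g n (\<lambda>j. c * v j) (\<lambda>j. c * v j) = 1"
      using cc tform_commute[of g n v "\<lambda>j. c * v j"] by (simp add: tform_scale_left)
    then have "tform g n (w' i) (w' j) = (if i = j then 1 else 0)" if "i < Suc k" "j < Suc k" for i j
      using that w sc by (auto simp: w'_def less_Suc_eq)
    moreover have "w' i j = 0" if "i < Suc k" "i < j" for i j
      using that tri by (auto simp: w'_def less_Suc_eq v_def e_def)
    ultimately show ?case by blast
  qed
  from this[of n] show ?thesis unfolding tform_orthonormal_def by blast
qed

text \<open>With the vectors as columns of W and T the Toeplitz matrix, orthonormality reads (W^T T)
  W = 1. A one-sided inverse of a square matrix is two-sided, so W (W^T T) = 1, which is the claim
  entry by entry.\<close>

lemma orthonormal_dual:
  assumes w: "tform_orthonormal g n w" and "j < n" "k < n"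
  shows "(\<Sum>i<n. w i j * (\<Sum>l<n. w i l * cos_coeff g (int l - int k))) = (if j = k then 1 else 0)"
proof -
  define W where "W = mat n n (\<lambda>(j, i). w i j)"
  define A where "A = mat n n (\<lambda>(i, k). \<Sum>l<n. w i l * cos_coeff g (int l - int k))"
  have c: "W \<in> carrier_mat n n" "A \<in> carrier_mat n n" by (auto simp: W_def A_def)
  have "A * W = 1\<^sub>m n"
  proof (rule eq_matI)
    fix i k assume "i < dim_row (1\<^sub>m n :: real mat)" "k < dim_col (1\<^sub>m n :: real mat)"
    then have ik: "i < n" "k < n" by auto
    have "(A * W) $$ (i, k) = (\<Sum>m<n. (\<Sum>l<n. w i l * cos_coeff g (int l - int m)) * w k m)"
      using ik by (simp add: A_def W_def scalar_prod_def lessThan_atLeast0)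
    also have "\<dots> = tform g n (w i) (w k)"
      unfolding tform_def sum_distrib_right by (subst sum.swap) (simp add: mult_ac)
    finally show "(A * W) $$ (i, k) = 1\<^sub>m n $$ (i, k)" using w ik by (simp add: tform_orthonormal_def)
  qed (auto simp: A_def W_def)
  then have "W * A = 1\<^sub>m n" by (rule mat_mult_left_right_inverse[OF c(2,1)])
  then have "(W * A) $$ (j, k) = 1\<^sub>m n $$ (j, k)" by simp
  then show ?thesis
    using assms(2,3) by (simp add: A_def W_def scalar_prod_def lessThan_atLeast0)
qed

text \<open>W W^T is the inverse Toeplitz matrix, so the quadratic form becomes a sum of
  \<open>n\<close> squares of linear forms in the data. The probabilistic part works with this sum
  alone.\<close>

lemma rho_n_orthonormal:
  assumes g: "integrable circ_measure g" and ev: "\<And>t. g (-t) = g t"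
    and eq: "\<And>t. -pi < t \<Longrightarrow> t < pi \<Longrightarrow> fgn_sd u t = g t"
    and w: "tform_orthonormal g n w"
  shows "rho_n n x u = of_real ((\<Sum>i<n. (\<Sum>j<n. w i j * x j)\<^sup>2) / real n)"
proof -
  define T where "T = toeplitz n (fgn_sd u)"
  define V :: "complex mat" where "V = mat n n (\<lambda>(j, k). of_real (\<Sum>i<n. w i j * w i k))"
  have T: "T = mat n n (\<lambda>(j, k). of_real (cos_coeff g (int j - int k)))"
    unfolding T_def toeplitz_def by (intro cong_mat) (auto simp: fourier_coeff_eq_cos_coeff[OF g ev eq])
  have c: "T \<in> carrier_mat n n" "V \<in> carrier_mat n n" by (auto simp: T V_def)
  have VT: "V * T = 1\<^sub>m n"
  proof (rule eq_matI)
    fix j k assume "j < dim_row (1\<^sub>m n :: complex mat)" "k < dim_col (1\<^sub>m n :: complex mat)"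
    then have jk: "j < n" "k < n" by auto
    have "(V * T) $$ (j, k) = of_real (\<Sum>l<n. (\<Sum>i<n. w i j * w i l) * cos_coeff g (int l - int k))"
      using jk by (simp add: V_def T scalar_prod_def lessThan_atLeast0)
    also have "(\<Sum>l<n. (\<Sum>i<n. w i j * w i l) * cos_coeff g (int l - int k)) =
       (\<Sum>i<n. w i j * (\<Sum>l<n. w i l * cos_coeff g (int l - int k)))"
      unfolding sum_distrib_right sum_distrib_left by (subst sum.swap) (simp add: mult_ac)
    finally show "(V * T) $$ (j, k) = 1\<^sub>m n $$ (j, k)" using orthonormal_dual[OF w jk] jk by simp
  qed (auto simp: T V_def)
  have TV: "T * V = 1\<^sub>m n" by (rule mat_mult_left_right_inverse[OF c(2,1) VT])
  \<comment> \<open>\<open>rho_n\<close> applies \<open>the\<close> to an optional inverse, so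
    existence must be secured before uniqueness identifies it with \<open>V\<close>.\<close>
  obtain B where B: "mat_inverse T = Some B"
    using mat_inverse(1)[OF c(1), of "()"] c VT TV by (cases "mat_inverse T") (auto simp: Units_def ring_mat_def)
  have "B * T = 1\<^sub>m n" "B \<in> carrier_mat n n" using mat_inverse(2)[OF c(1) B] by auto
  then have "B = B * (T * V)" using TV by simp
  also have "\<dots> = V" using assoc_mult_mat[OF \<open>B \<in> carrier_mat n n\<close> c] \<open>B * T = 1\<^sub>m n\<close> c by simp
  finally have B: "the (mat_inverse T) = V" using B by simp
  have "(\<Sum>j<n. x j * (\<Sum>k<n. (\<Sum>i<n. w i j * w i k) * x k)) = (\<Sum>j<n. \<Sum>k<n. \<Sum>i<n. (w i j * x j) * (w i k * x k))"
    by (simp add: sum_distrib_left sum_distrib_right mult_ac)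
  also have "\<dots> = (\<Sum>j<n. \<Sum>i<n. \<Sum>k<n. (w i j * x j) * (w i k * x k))"
    by (rule sum.cong[OF refl], rule sum.swap)
  also have "\<dots> = (\<Sum>i<n. (\<Sum>j<n. w i j * x j)\<^sup>2)"
    unfolding power2_eq_square sum_product by (rule sum.swap)
  finally have "complex_of_real (\<Sum>j<n. x j * (\<Sum>k<n. (\<Sum>i<n. w i j * w i k) * x k)) = of_real (\<Sum>i<n. (\<Sum>j<n. w i j * x j)\<^sup>2)"
    by simp
  then show ?thesis
    unfolding rho_n_def Let_def T_def[symmetric] B
    by (simp add: V_def scalar_prod_def lessThan_atLeast0)
qed

text \<open>The diagonal of the reproducing kernel, in L^2(g), of the polynomials of degree below
  \<open>n\<close>.\<close>

definition christoffel :: "nat \<Rightarrow> (nat \<Rightarrow> nat \<Rightarrow> real) \<Rightarrow> real \<Rightarrow> real" where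
  "christoffel n w t = (\<Sum>i<n. (norm (ctrig n (w i) t))\<^sup>2)"

lemma christoffel_measurable[measurable]: "christoffel n w \<in> borel_measurable borel"
  unfolding christoffel_def[abs_def] by measurable

lemma christoffel_nonneg: "christoffel n w t \<ge> 0"
  by (simp add: christoffel_def sum_nonneg)

lemma trig_sum: "trig n (\<lambda>j. \<Sum>i<m. c i * x i j) t = (\<Sum>i<m. c i * trig n (x i) t)"
  unfolding trig_def sum_distrib_right sum_distrib_left by (subst sum.swap) (simp add: mult_ac)

text \<open>Parseval in L^2(g). The family \<open>w\<close> is real, but the coefficients must be
  complex: those of the reproducing kernel at a point are values of trigonometric
  polynomials.\<close>

lemma integral_orthonormal_comb:
  assumes g: "integrable circ_measure g" and ev: "\<And>t. g (-t) = g t" and w: "tform_orthonormal g n w"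
  shows "(LINT t|circ_measure. g t * (norm (trig n (\<lambda>j. \<Sum>i<n. c i * of_real (w i j)) t))\<^sup>2) = (\<Sum>i<n. (norm (c i))\<^sup>2)"
proof -
  let ?P = "trig n (\<lambda>j. \<Sum>i<n. c i * of_real (w i j))"
  have *: "of_real (g t) * (?P t * cnj (?P t)) = (\<Sum>i<n. \<Sum>k<n. (c i * cnj (c k)) *
     (of_real (g t) * (ctrig n (w i) t * cnj (ctrig n (w k) t))))" for t
    unfolding trig_sum cnj_sum sum_product by (simp add: sum_distrib_left mult_ac)
  note int = integrable_trig_mult[OF g]
  have "complex_of_real (LINT t|circ_measure. g t * (norm (?P t))\<^sup>2) = (LINT t|circ_measure. of_real (g t) * (?P t * cnj (?P t)))"
    by (simp only: integral_complex_of_real[symmetric] of_real_mult complex_norm_square)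
  also have "\<dots> = (\<Sum>i<n. LINT t|circ_measure. (\<Sum>k<n. (c i * cnj (c k)) *
     (of_real (g t) * (ctrig n (w i) t * cnj (ctrig n (w k) t)))))"
    unfolding * by (intro Bochner_Integration.integral_sum Bochner_Integration.integrable_sum integrable_mult_right int)
  also have "\<dots> = (\<Sum>i<n. \<Sum>k<n. LINT t|circ_measure. (c i * cnj (c k)) *
     (of_real (g t) * (ctrig n (w i) t * cnj (ctrig n (w k) t))))"
    by (intro sum.cong refl Bochner_Integration.integral_sum integrable_mult_right int)
  also have "\<dots> = (\<Sum>i<n. \<Sum>k<n. if k = i then c i * cnj (c k) else 0)"
    using w unfolding integral_mult_right_zero integral_ctrig_mult[OF g ev] tform_orthonormal_def
    by (intro sum.cong refl) auto
  also have "\<dots> = of_real (\<Sum>i<n. (norm (c i))\<^sup>2)"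
    by (simp add: complex_norm_square[symmetric] del: of_real_power)
  finally show ?thesis by (simp only: of_real_eq_iff)
qed

text \<open>The one-sided Dirichlet kernel: pairing with its translate to \<open>t\<close> evaluates
  a polynomial of degree below \<open>n\<close> at \<open>t\<close>, and its squared modulus divided
  by \<open>n\<close> is the Fejer kernel.\<close>

definition dirichlet :: "nat \<Rightarrow> real \<Rightarrow> complex" where
  "dirichlet n s = (\<Sum>j<n. cis (real j * s))"

lemma dirichlet_measurable[measurable]: "dirichlet n \<in> borel_measurable borel"
  unfolding dirichlet_def[abs_def] by measurable

lemma dirichlet_eq_trig: "dirichlet n (s - t) = trig n (\<lambda>k. cis (- (real k * t))) s"
  by (simp add: dirichlet_def trig_def cis_mult right_diff_distrib)

text \<open>Let P be the reproducing kernel of L^2(g) at \<open>t\<close>. Then P(t) and the squared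
  g-norm of P both equal the Christoffel function K. Writing P(t) as a pairing with the Dirichlet
  kernel and splitting |P| |D| by a weighted Young inequality gives K \<le> (K + I) / 2, where I is
  the right-hand side.\<close>

lemma christoffel_upper:
  assumes g: "integrable circ_measure g" and ev: "\<And>t. g (-t) = g t" and w: "tform_orthonormal g n w"
    and pos: "\<And>t. -pi < t \<Longrightarrow> t < pi \<Longrightarrow> t \<noteq> 0 \<Longrightarrow> g t > 0"
    and ig: "integrable circ_measure (\<lambda>t. 1 / g t)"
  shows "christoffel n w t \<le> (LINT s|circ_measure. (1 / g s) * (norm (dirichlet n (s - t)))\<^sup>2)"
proof -
  let ?c = "\<lambda>i. cnj (ctrig n (w i) t)"
  let ?x = "\<lambda>j. \<Sum>i<n. ?c i * of_real (w i j)"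
  let ?P = "trig n ?x"
  have one: "integrable circ_measure (\<lambda>_. 1::real)"
    using finite_measure.integrable_const[OF prob_space.finite_measure[OF prob_space_circ], of "1::real"] .
  have K: "(LINT s|circ_measure. g s * (norm (?P s))\<^sup>2) = christoffel n w t"
    by (subst integral_orthonormal_comb[OF g ev w]) (simp add: christoffel_def)
  have Pt: "?P t = of_real (christoffel n w t)"
    unfolding trig_sum christoffel_def of_real_sum by (intro sum.cong refl) (simp only: complex_norm_square mult.commute)
  have "(LINT s|circ_measure. ?P s * cnj (dirichlet n (s - t))) = (\<Sum>j<n. \<Sum>k<n. ?x j * cnj (cis (- (real k * t))) * of_real (cos_coeff (\<lambda>_. 1) (int j - int k)))"
    using integral_trig_mult[OF one, of n ?x "\<lambda>k. cis (- (real k * t))"] unfolding dirichlet_eq_trig by simp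
  also have "\<dots> = (\<Sum>j<n. \<Sum>k<n. if k = j then ?x j * cis (real k * t) else 0)"
    by (intro sum.cong refl) (auto simp: cos_coeff_1 cis_cnj)
  also have "\<dots> = ?P t" by (simp add: trig_def)
  finally have rep: "(LINT s|circ_measure. ?P s * cnj (dirichlet n (s - t))) = of_real (christoffel n w t)" unfolding Pt .
  have intPD: "integrable circ_measure (\<lambda>s. ?P s * cnj (dirichlet n (s - t)))"
    using integrable_trig_mult[OF one, of n ?x "\<lambda>k. cis (- (real k * t))"] unfolding dirichlet_eq_trig by simp
  have i1: "integrable circ_measure (\<lambda>s. g s * (norm (?P s))\<^sup>2)" by (rule integrable_norm_trig[OF g])
  have i2: "integrable circ_measure (\<lambda>s. (1 / g s) * (norm (dirichlet n (s - t)))\<^sup>2)"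
    unfolding dirichlet_eq_trig by (rule integrable_norm_trig[OF ig])
  have "christoffel n w t = (LINT s|circ_measure. Re (?P s * cnj (dirichlet n (s - t))))"
    using integral_Re[OF intPD] rep by simp
  also have "\<dots> \<le> (LINT s|circ_measure. (g s * (norm (?P s))\<^sup>2 + (1 / g s) * (norm (dirichlet n (s - t)))\<^sup>2) / 2)"
  proof (rule integral_mono_AE)
    show "integrable circ_measure (\<lambda>s. Re (?P s * cnj (dirichlet n (s - t))))" using intPD by (rule integrable_Re)
    show "AE s in circ_measure. Re (?P s * cnj (dirichlet n (s - t))) \<le> (g s * (norm (?P s))\<^sup>2 + (1 / g s) * (norm (dirichlet n (s - t)))\<^sup>2) / 2"
    proof (rule AE_circI)
      fix s assume s: "-pi < s" "s < pi" "s \<noteq> 0"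
      define a b where "a = norm (?P s)" and "b = norm (dirichlet n (s - t))"
      have "g s > 0" using pos[OF s] .
      have "Re (?P s * cnj (dirichlet n (s - t))) \<le> a * b"
        unfolding a_def b_def by (rule order_trans[OF complex_Re_le_cmod]) (simp add: norm_mult)
      \<comment> \<open>The square expands to g a^2 - 2 a b + b^2 / g, so \<open>g s\<close> serves
        as the weight in Young's inequality.\<close>
      also have "0 \<le> (a * g s - b)\<^sup>2 / g s" using \<open>g s > 0\<close> by simp
      then have "a * b \<le> (g s * a\<^sup>2 + (1 / g s) * b\<^sup>2) / 2"
        using \<open>g s > 0\<close> by (simp add: power2_eq_square field_simps)
      finally show "Re (?P s * cnj (dirichlet n (s - t))) \<le> (g s * (norm (?P s))\<^sup>2 + (1 / g s) * (norm (dirichlet n (s - t)))\<^sup>2) / 2"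
        unfolding a_def b_def .
    qed
  qed (use i1 i2 in auto)
  also have "\<dots> = (christoffel n w t + (LINT s|circ_measure. (1 / g s) * (norm (dirichlet n (s - t)))\<^sup>2)) / 2"
    using i1 i2 K by simp
  finally show ?thesis by simp
qed

lemma orthonormal_expansion:
  fixes x :: "nat \<Rightarrow> complex"
  assumes w: "tform_orthonormal g n w" and "j < n"
  shows "x j = (\<Sum>i<n. (\<Sum>k<n. (\<Sum>l<n. w i l * cos_coeff g (int l - int k)) * x k) * of_real (w i j))"
proof -
  have *: "(\<Sum>i<n. (\<Sum>k<n. complex_of_real (a i k) * x k) * of_real (w i j)) =
    (\<Sum>k<n. of_real (\<Sum>i<n. w i j * a i k) * x k)" for a
    unfolding of_real_sum sum_distrib_right by (subst sum.swap) (simp add: mult_ac)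
  have "(\<Sum>i<n. (\<Sum>k<n. of_real (\<Sum>l<n. w i l * cos_coeff g (int l - int k)) * x k) * of_real (w i j)) =
    (\<Sum>k<n. of_real (\<Sum>i<n. w i j * (\<Sum>l<n. w i l * cos_coeff g (int l - int k))) * x k)"
    by (rule *)
  also have "\<dots> = (\<Sum>k<n. if k = j then x k else 0)"
    by (intro sum.cong refl) (auto simp: orthonormal_dual[OF w \<open>j < n\<close>])
  finally show ?thesis using \<open>j < n\<close> by simp
qed

lemma norm_sum_mult_le:
  fixes a b :: "'i \<Rightarrow> complex"
  shows "(norm (\<Sum>i\<in>I. a i * b i))\<^sup>2 \<le> (\<Sum>i\<in>I. (norm (a i))\<^sup>2) * (\<Sum>i\<in>I. (norm (b i))\<^sup>2)"
proof -
  have "norm (\<Sum>i\<in>I. a i * b i) \<le> (\<Sum>i\<in>I. norm (a i) * norm (b i))"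
    by (rule order_trans[OF norm_sum]) (simp add: norm_mult)
  then have "(norm (\<Sum>i\<in>I. a i * b i))\<^sup>2 \<le> (\<Sum>i\<in>I. norm (a i) * norm (b i))\<^sup>2"
    by (intro power_mono) auto
  also have "\<dots> \<le> (\<Sum>i\<in>I. (norm (a i))\<^sup>2) * (\<Sum>i\<in>I. (norm (b i))\<^sup>2)"
    by (rule Cauchy_Schwarz_ineq_sum)
  finally show ?thesis .
qed

text \<open>Expand the translated Dirichlet kernel in the orthonormal polynomials. Its value at
  \<open>t\<close> is \<open>n\<close>, so Cauchy-Schwarz bounds n^2 by the squared coefficients,
  which sum to the squared g-norm, times the Christoffel function.\<close>

lemma christoffel_lower:
  assumes g: "integrable circ_measure g" and ev: "\<And>t. g (-t) = g t" and w: "tform_orthonormal g n w"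
  shows "(real n)\<^sup>2 \<le> christoffel n w t * (LINT s|circ_measure. g s * (norm (dirichlet n (s - t)))\<^sup>2)"
proof -
  define x where "x = (\<lambda>k. cis (- (real k * t)))"
  define b where "b = (\<lambda>i. \<Sum>k<n. complex_of_real (\<Sum>l<n. w i l * cos_coeff g (int l - int k)) * x k)"
  have D: "dirichlet n (s - t) = trig n (\<lambda>j. \<Sum>i<n. b i * of_real (w i j)) s" for s
    unfolding dirichlet_eq_trig trig_def x_def[symmetric] b_def
    by (intro sum.cong refl arg_cong2[where f="(*)"]) (use orthonormal_expansion[OF w] in auto)
  have "(LINT s|circ_measure. g s * (norm (dirichlet n (s - t)))\<^sup>2) = (\<Sum>i<n. (norm (b i))\<^sup>2)"
    unfolding D by (rule integral_orthonormal_comb[OF g ev w])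
  moreover have "of_nat n = (\<Sum>i<n. b i * ctrig n (w i) t)"
    using D[of t] unfolding trig_sum by (simp add: dirichlet_def)
  then have "real n = norm (\<Sum>i<n. b i * ctrig n (w i) t)" by (metis norm_of_nat)
  ultimately show ?thesis
    using norm_sum_mult_le[of b "\<lambda>i. ctrig n (w i) t" "{..<n}"] by (simp add: christoffel_def mult.commute)
qed

subsection \<open>Fejer kernels and the trace limit\<close>

text \<open>The range is dictated by \<open>fejer_powr_bound\<close>, where |s| \<le> |t|/2 and |t|
  < pi give |s - t| \<le> 3 pi / 2; the sine is taken at half of that. The slope 1/4 is generous: up
  to pi/3 the derivative of the difference is at least 1/4, and beyond it the sine stays above
  7/10.\<close>

lemma sin_ge_quarter:
  fixes z :: real
  assumes "0 \<le> z" "z \<le> 3 * pi / 4"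
  shows "z / 4 \<le> sin z"
proof (cases "z \<le> pi / 3")
  case True
  have "sin 0 - 0 / 4 \<le> sin z - z / 4"
  proof (rule DERIV_nonneg_imp_nondecreasing[OF assms(1)])
    fix x assume x: "0 \<le> x" "x \<le> z"
    have "cos (pi / 3) \<le> cos x" using x True by (intro cos_monotone_0_pi_le) auto
    then have "cos x - 1/4 \<ge> 0" by (simp add: cos_60)
    moreover have "((\<lambda>x. sin x - x / 4) has_real_derivative cos x - 1 / 4) (at x)"
      by (auto intro!: derivative_eq_intros)
    ultimately show "\<exists>y. ((\<lambda>x. sin x - x / 4) has_real_derivative y) (at x) \<and> 0 \<le> y" by blast
  qed
  then show ?thesis by simp
next
  case False
  have "7/5 \<le> sqrt 2" by (rule real_le_rsqrt) (simp add: power2_eq_square)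
  then have s2: "sin (pi / 4) \<ge> 7/10" by (simp add: sin_45)
  have "sin z \<ge> sin (pi / 4)"
  proof (cases "z \<le> pi / 2")
    case True then show ?thesis using False by (intro sin_monotone_2pi_le) auto
  next
    case F: False
    have "sin (pi / 4) \<le> sin (pi - z)" using F assms by (intro sin_monotone_2pi_le) auto
    then show ?thesis by simp
  qed
  moreover have "z / 4 \<le> 7/10" using assms pi_less_4 pi_approx by simp
  ultimately show ?thesis using s2 by simp
qed

lemma norm_one_minus_cis: "norm (1 - cis x) = 2 * \<bar>sin (x / 2)\<bar>"
proof -
  have "(norm (1 - cis x))\<^sup>2 = (1 - cos x)\<^sup>2 + (sin x)\<^sup>2" by (simp add: cmod_power2)
  also have "\<dots> = 2 - 2 * cos x" using sin_cos_squared_add[of x] by (simp add: power2_eq_square algebra_simps)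
  also have "\<dots> = (2 * \<bar>sin (x / 2)\<bar>)\<^sup>2" using cos_double_sin[of "x/2"] by (simp add: power_mult_distrib)
  finally show ?thesis by (subst (asm) power2_eq_iff_nonneg) auto
qed

lemma norm_one_minus_cis_ge: "\<bar>x\<bar> \<le> 3 * pi / 2 \<Longrightarrow> \<bar>x\<bar> / 4 \<le> norm (1 - cis x)"
  using sin_ge_quarter[of "\<bar>x\<bar> / 2"] unfolding norm_one_minus_cis by (cases "x \<ge> 0") auto

section \<open>Dirichlet and Fejer kernels: size, total mass and approximation of point
  values\<close>

lemma norm_dirichlet_le: "norm (dirichlet n s) \<le> real n"
  unfolding dirichlet_def by (rule order_trans[OF norm_sum]) simp

lemma norm_dirichlet_mult_le: "norm (dirichlet n s) * norm (1 - cis s) \<le> 2"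
proof -
  have "(1 - cis s) * dirichlet n s = 1 - cis s ^ n"
    unfolding one_diff_power_eq dirichlet_def by (intro arg_cong2[where f="(*)"] sum.cong refl) (rule Complex.DeMoivre[symmetric])
  then have "norm (dirichlet n s) * norm (1 - cis s) = norm (1 - cis s ^ n)"
    by (metis norm_mult mult.commute)
  also have "\<dots> \<le> 1 + 1" by (rule order_trans[OF norm_triangle_ineq4]) (simp add: norm_power)
  finally show ?thesis by simp
qed

definition fejer :: "nat \<Rightarrow> real \<Rightarrow> real" where
  "fejer n s = (norm (dirichlet n s))\<^sup>2 / real n"

lemma fejer_measurable[measurable]: "fejer n \<in> borel_measurable borel"
  unfolding fejer_def[abs_def] by measurable

lemma fejer_nonneg: "fejer n s \<ge> 0"
  by (simp add: fejer_def)

lemma integrable_fejer_mult: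
  assumes "integrable circ_measure h"
  shows "integrable circ_measure (\<lambda>s. fejer n (s - t) * h s)"
  using integrable_mult_right[OF integrable_norm_trig[OF assms, of n "\<lambda>k. cis (- (real k * t))"], of "1 / real n"]
  by (simp add: fejer_def dirichlet_eq_trig mult.commute)

lemma integrable_circ_const: "integrable circ_measure (\<lambda>_. c :: real)"
  using finite_measure.integrable_const[OF prob_space.finite_measure[OF prob_space_circ]] .

lemma integrable_fejer: "integrable circ_measure (\<lambda>s. fejer n (s - t))"
  using integrable_fejer_mult[OF integrable_circ_const[of 1]] by simp

lemma integral_fejer:
  assumes "n \<ge> 1"
  shows "(LINT s|circ_measure. fejer n (s - t)) = 1"
proof -
  define x where "x = (\<lambda>k. cis (- (real k * t)))"
  have "complex_of_real (LINT s|circ_measure. (norm (trig n x s))\<^sup>2) = (LINT s|circ_measure. of_real 1 * (trig n x s * cnj (trig n x s)))"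
    by (simp only: integral_complex_of_real[symmetric] complex_norm_square of_real_1 mult_1)
  also have "\<dots> = (\<Sum>j<n. \<Sum>k<n. x j * cnj (x k) * of_real (cos_coeff (\<lambda>_. 1) (int j - int k)))"
    by (rule integral_trig_mult[OF integrable_circ_const]) simp
  also have "\<dots> = (\<Sum>j<n. \<Sum>k<n. if k = j then 1 else 0)"
    by (intro sum.cong refl) (auto simp: cos_coeff_1 x_def cis_cnj cis_mult)
  also have "\<dots> = of_real (real n)" by simp
  finally have "(LINT s|circ_measure. (norm (trig n x s))\<^sup>2) = real n" by (simp only: of_real_eq_iff)
  then show ?thesis using assms by (simp add: fejer_def dirichlet_eq_trig x_def)
qed

text \<open>\<open>h\<close> is only integrable away from \<open>t\<close>, possibly unbounded at
  the origin. Off a neighbourhood of \<open>t\<close> the kernel is therefore bounded uniformly by a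
  multiple of 1/n and tested against the L^1 norm of \<open>h - h t\<close>.\<close>

lemma fejer_tendsto:
  assumes h: "integrable circ_measure h" and cont: "isCont h t" and t: "-pi < t" "t < pi"
  shows "(\<lambda>n. LINT s|circ_measure. fejer n (s - t) * h s) \<longlonglongrightarrow> h t"
proof (rule LIMSEQ_I)
  fix e :: real assume "e > 0"
  have [measurable]: "h \<in> borel_measurable borel" using h by (auto dest: borel_measurable_integrable)
  obtain d where d: "d > 0" "\<And>s. dist s t < d \<Longrightarrow> dist (h s) (h t) < e / 2"
    using cont \<open>e > 0\<close> unfolding continuous_at_eps_delta by (metis half_gt_zero)
  \<comment> \<open>The endpoints are included for compactness. Since \<open>t\<close> is interior,
    |s - t| < 2 pi on \<open>S\<close>, so 1 - cis (s - t) has no zero there and its modulus has a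
    positive minimum.\<close>
  define S where "S = {-pi..pi} - ball t d"
  obtain c where c: "c > 0" "\<And>s. s \<in> S \<Longrightarrow> c \<le> norm (1 - cis (s - t))"
  proof (cases "S = {}")
    case True then show ?thesis using that[of 1] by auto
  next
    case False
    have "compact S" unfolding S_def by (intro compact_diff) auto
    moreover have "continuous_on S (\<lambda>s. norm (1 - cis (s - t)))"
      unfolding cis_conv_exp by (intro continuous_intros)
    ultimately obtain s0 where s0: "s0 \<in> S" "\<And>s. s \<in> S \<Longrightarrow> norm (1 - cis (s0 - t)) \<le> norm (1 - cis (s - t))"
      using continuous_attains_inf[OF _ False] by blast
    have "sin (\<bar>s0 - t\<bar> / 2) > 0"
      using s0(1) t d(1) by (intro sin_gt_zero) (auto simp: S_def dist_real_def)
    moreover have "sin ((t - s0) / 2) = - sin ((s0 - t) / 2)"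
      by (metis minus_diff_eq minus_divide_left sin_minus)
    ultimately have "norm (1 - cis (s0 - t)) > 0"
      using \<open>sin ((t - s0) / 2) = - sin ((s0 - t) / 2)\<close> unfolding norm_one_minus_cis by (cases "s0 \<ge> t") auto
    with s0 that show ?thesis by blast
  qed
  define Q where "Q = (LINT s|circ_measure. \<bar>h s - h t\<bar>)"
  have ih: "integrable circ_measure (\<lambda>s. \<bar>h s - h t\<bar>)" "integrable circ_measure (\<lambda>s. h s - h t)" using h integrable_circ_const by auto
  have key: "\<bar>(LINT s|circ_measure. fejer n (s - t) * h s) - h t\<bar> \<le> e / 2 + 4 / c\<^sup>2 * Q / real n" if n: "n \<ge> 1" for n
  proof -
    have "(LINT s|circ_measure. fejer n (s - t) * h s) - h t = (LINT s|circ_measure. fejer n (s - t) * h s) - (LINT s|circ_measure. fejer n (s - t) * h t)"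
      using integral_fejer[OF n, of t] by simp
    also have "\<dots> = (LINT s|circ_measure. fejer n (s - t) * (h s - h t))"
      using integrable_fejer_mult[OF h, of n t] integrable_fejer[of n t]
      by (subst Bochner_Integration.integral_diff[symmetric]) (auto simp: right_diff_distrib)
    finally have "\<bar>(LINT s|circ_measure. fejer n (s - t) * h s) - h t\<bar> = norm (LINT s|circ_measure. fejer n (s - t) * (h s - h t))" by simp
    also have "\<dots> \<le> (LINT s|circ_measure. (e/2) * fejer n (s - t) + (4 / c\<^sup>2 / real n) * \<bar>h s - h t\<bar>)"
    proof (rule order_trans[OF integral_norm_bound], rule integral_mono_AE)
      show "integrable circ_measure (\<lambda>s. norm (fejer n (s - t) * (h s - h t)))"
        by (intro integrable_norm integrable_fejer_mult ih)
      show "integrable circ_measure (\<lambda>s. (e/2) * fejer n (s - t) + (4 / c\<^sup>2 / real n) * \<bar>h s - h t\<bar>)"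
        by (intro Bochner_Integration.integrable_add integrable_mult_right ih integrable_fejer)
      show "AE s in circ_measure. norm (fejer n (s - t) * (h s - h t)) \<le> (e/2) * fejer n (s - t) + (4 / c\<^sup>2 / real n) * \<bar>h s - h t\<bar>"
      proof (rule AE_circI)
        fix s assume s: "-pi < s" "s < pi"
        show "norm (fejer n (s - t) * (h s - h t)) \<le> (e/2) * fejer n (s - t) + (4 / c\<^sup>2 / real n) * \<bar>h s - h t\<bar>"
        proof (cases "dist s t < d")
          case True
          then have "\<bar>h s - h t\<bar> \<le> e/2" using d(2)[of s] by (simp add: dist_real_def)
          then have "fejer n (s - t) * \<bar>h s - h t\<bar> \<le> fejer n (s - t) * (e/2)" by (intro mult_left_mono fejer_nonneg)
          moreover have "(4 / c\<^sup>2 / real n) * \<bar>h s - h t\<bar> \<ge> 0" by simp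
          moreover have "norm (fejer n (s - t) * (h s - h t)) = fejer n (s - t) * \<bar>h s - h t\<bar>"
            by (simp add: abs_mult fejer_nonneg)
          ultimately show ?thesis unfolding mult.commute[of "e/2"] by linarith
        next
          case False
          then have "s \<in> S" using s by (auto simp: S_def dist_commute)
          have "norm (dirichlet n (s - t)) * c \<le> 2"
            using norm_dirichlet_mult_le[of n "s - t"] mult_left_mono[OF c(2)[OF \<open>s \<in> S\<close>], of "norm (dirichlet n (s - t))"] by simp
          then have "(norm (dirichlet n (s - t)) * c)\<^sup>2 \<le> 2\<^sup>2" using c(1) by (intro power_mono) auto
          then have "fejer n (s - t) \<le> 4 / c\<^sup>2 / real n"
            using c(1) n by (simp add: fejer_def field_simps power_mult_distrib)
          then have "fejer n (s - t) * \<bar>h s - h t\<bar> \<le> (4 / c\<^sup>2 / real n) * \<bar>h s - h t\<bar>" by (intro mult_right_mono) auto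
          moreover have "(e/2) * fejer n (s - t) \<ge> 0" using \<open>e > 0\<close> by (simp add: fejer_nonneg)
          ultimately show ?thesis by (simp add: abs_mult fejer_nonneg)
        qed
      qed
    qed
    also have "\<dots> = e / 2 + 4 / c\<^sup>2 * Q / real n"
      using ih integrable_fejer[of n t] integral_fejer[OF n, of t] by (simp add: Q_def)
    finally show ?thesis .
  qed
  have "(\<lambda>n. 4 / c\<^sup>2 * Q / real n) \<longlonglongrightarrow> 0" by (rule lim_const_over_n)
  then have "\<forall>\<^sub>F n in sequentially. 4 / c\<^sup>2 * Q / real n < e / 2" using \<open>e > 0\<close> by (intro order_tendstoD) auto
  then have "\<forall>\<^sub>F n in sequentially. norm ((LINT s|circ_measure. fejer n (s - t) * h s) - h t) < e"
    using eventually_ge_at_top[of 1]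
  proof eventually_elim
    case (elim n) then show ?case using key[of n] by simp
  qed
  then show "\<exists>no. \<forall>n\<ge>no. norm ((LINT s|circ_measure. fejer n (s - t) * h s) - h t) < e"
    by (simp add: eventually_sequentially)
qed

text \<open>The explicit bound measures the mass of a power singularity near the origin; it is used
  with d = |t|/2 for the Fejer means and with d = 1/n for the norm bound.\<close>

lemma powr_near_0:
  assumes "0 \<le> b" "b < 1" "d > 0"
  shows "integrable circ_measure (\<lambda>s. if \<bar>s\<bar> \<le> d then \<bar>s\<bar> powr (-b) else 0)" (is "integrable _ ?h")
    and "(LINT s|circ_measure. (if \<bar>s\<bar> \<le> d then \<bar>s\<bar> powr (-b) else 0)) \<le> d powr (1 - b) / (1 - b)"
proof -
  define k :: "real \<Rightarrow> ennreal" where "k = (\<lambda>s. indicator {0..d} s * ennreal (s powr (-b)))"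
  have [measurable]: "k \<in> borel_measurable borel" by (simp add: k_def)
  have "((\<lambda>x. x powr (-b)) has_integral (d powr (-b+1) / (-b+1))) {0..d}"
    using assms by (intro has_integral_powr_from_0) auto
  then have "((\<lambda>s. indicator {0..d} s * s powr (-b)) has_integral (d powr (1-b) / (1-b))) UNIV"
    unfolding has_integral_restrict_UNIV[of "{0..d}", symmetric]
    by (rule has_integral_eq_rhs[OF has_integral_spike_eq[of "{}", THEN iffD1, rotated 2]]) (auto simp: indicator_def)
  then have "(\<integral>\<^sup>+s. ennreal (indicator {0..d} s * s powr (-b)) \<partial>lborel) = ennreal (d powr (1-b) / (1-b))"
    by (intro nn_integral_has_integral_lborel) auto
  moreover have "k s = ennreal (indicator {0..d} s * s powr (-b))" for s
    by (simp add: k_def indicator_def)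
  ultimately have k: "(\<integral>\<^sup>+s. k s \<partial>lborel) = ennreal (d powr (1-b) / (1-b))" by simp
  have k': "(\<integral>\<^sup>+s. k (-s) \<partial>lborel) = ennreal (d powr (1-b) / (1-b))"
    using nn_integral_real_affine[of k "-1" 0] k by simp
  have "(\<integral>\<^sup>+s. ennreal (?h s) \<partial>circ_measure) = (\<integral>\<^sup>+s. ennreal (indicator {-pi<..<pi} s / (2*pi)) * ennreal (?h s) \<partial>lborel)"
    unfolding circ_measure_def by (rule nn_integral_density) auto
  also have "\<dots> \<le> (\<integral>\<^sup>+s. ennreal (1 / 2) * (k s + k (-s)) \<partial>lborel)"
  proof (rule nn_integral_mono)
    fix s :: real
    \<comment> \<open>The normalisation 1 / (2 pi) is weakened to 1/2, which cancels against the two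
      half-lines.\<close>
    have "indicator {-pi<..<pi} s / (2*pi) \<le> 1 / 2" using pi_gt3 by (auto simp: indicator_def field_simps)
    moreover have "ennreal (?h s) \<le> k s + k (-s)"
      by (auto simp: k_def indicator_def abs_if)
    ultimately show "ennreal (indicator {-pi<..<pi} s / (2*pi)) * ennreal (?h s) \<le> ennreal (1/2) * (k s + k (-s))"
      by (intro mult_mono ennreal_leI) auto
  qed
  also have "\<dots> = ennreal (1/2) * (ennreal (d powr (1-b) / (1-b)) + ennreal (d powr (1-b) / (1-b)))"
    by (subst nn_integral_cmult) (auto simp: nn_integral_add k k')
  also have "\<dots> = ennreal (d powr (1-b) / (1-b))"
  proof -
    have x: "d powr (1-b) / (1-b) \<ge> 0" using assms by simp
    show ?thesis
      unfolding ennreal_plus[OF x x, symmetric] by (subst ennreal_mult[symmetric]) (use x in auto)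
  qed
  finally have le: "(\<integral>\<^sup>+s. ennreal (?h s) \<partial>circ_measure) \<le> ennreal (d powr (1-b) / (1-b))" .
  show int: "integrable circ_measure ?h"
    using le by (intro integrableI_nonneg) (auto intro: order_le_less_trans)
  have "ennreal (integral\<^sup>L circ_measure ?h) \<le> ennreal (d powr (1-b) / (1-b))"
    using le by (subst nn_integral_eq_integral[symmetric]) (auto intro: int)
  then show "integral\<^sup>L circ_measure ?h \<le> d powr (1 - b) / (1 - b)" using assms by simp
qed

lemma integrable_powr_circ:
  assumes "0 \<le> b" "b < 1"
  shows "integrable circ_measure (\<lambda>s. \<bar>s\<bar> powr (-b))"
proof (rule Bochner_Integration.integrable_bound[OF powr_near_0(1)[OF assms pi_gt_zero]])
  show "AE s in circ_measure. norm (\<bar>s\<bar> powr (-b)) \<le> norm (if \<bar>s\<bar> \<le> pi then \<bar>s\<bar> powr (-b) else 0)"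
    by (rule AE_circI) auto
qed measurable

lemma integrable_circ_powr_bound:
  assumes [measurable]: "h \<in> borel_measurable borel" and "0 \<le> b" "b < 1"
    and "\<And>t. -pi < t \<Longrightarrow> t < pi \<Longrightarrow> t \<noteq> 0 \<Longrightarrow> \<bar>h t\<bar> \<le> C * \<bar>t\<bar> powr (-b)"
  shows "integrable circ_measure (h :: real \<Rightarrow> real)"
proof (rule Bochner_Integration.integrable_bound[OF integrable_mult_right[OF integrable_powr_circ[OF assms(2,3)], of C]])
  show "AE s in circ_measure. norm (h s) \<le> norm (C * \<bar>s\<bar> powr (-b))"
    by (rule AE_circI) (use assms(4) in \<open>fastforce intro: order_trans[OF _ abs_ge_self]\<close>)
qed measurable

text \<open>Fejer means keep the power of the singularity, uniformly in \<open>n\<close>. Where |s|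
  > |t|/2, the power at \<open>s\<close> is at most twice that at \<open>t\<close> and the kernel
  has mass 1. Where |s| \<le> |t|/2, the kernel is at most 16/|t|, and the power is integrated by
  \<open>powr_near_0\<close>.\<close>

lemma fejer_powr_bound:
  assumes h: "integrable circ_measure h" and b: "0 \<le> b" "b < 1" and "C \<ge> 0"
    and hb: "\<And>t. -pi < t \<Longrightarrow> t < pi \<Longrightarrow> t \<noteq> 0 \<Longrightarrow> h t \<le> C * \<bar>t\<bar> powr (-b)"
    and n: "n \<ge> 1" and t: "-pi < t" "t < pi" "t \<noteq> 0"
  shows "(LINT s|circ_measure. fejer n (s - t) * h s) \<le> C * (2 + 16 / (1 - b)) * \<bar>t\<bar> powr (-b)"
proof -
  let ?q = "\<lambda>s. if \<bar>s\<bar> \<le> \<bar>t\<bar>/2 then \<bar>s\<bar> powr (-b) else 0"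
  have t2: "\<bar>t\<bar>/2 > 0" using t by simp
  note q = powr_near_0[OF b t2]
  have "(LINT s|circ_measure. fejer n (s - t) * h s) \<le> (LINT s|circ_measure. (C * 2 * \<bar>t\<bar> powr (-b)) * fejer n (s - t) + (16 * C / \<bar>t\<bar>) * ?q s)"
  proof (rule integral_mono_AE)
    show "integrable circ_measure (\<lambda>s. fejer n (s - t) * h s)" by (rule integrable_fejer_mult[OF h])
    show "integrable circ_measure (\<lambda>s. (C * 2 * \<bar>t\<bar> powr (-b)) * fejer n (s - t) + (16 * C / \<bar>t\<bar>) * ?q s)"
      by (intro Bochner_Integration.integrable_add integrable_mult_right q integrable_fejer)
    show "AE s in circ_measure. fejer n (s - t) * h s \<le> (C * 2 * \<bar>t\<bar> powr (-b)) * fejer n (s - t) + (16 * C / \<bar>t\<bar>) * ?q s"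
    proof (rule AE_circI)
      fix s assume s: "-pi < s" "s < pi" "s \<noteq> 0"
      have le: "fejer n (s - t) * h s \<le> fejer n (s - t) * (C * \<bar>s\<bar> powr (-b))"
        by (intro mult_left_mono hb s fejer_nonneg)
      show "fejer n (s - t) * h s \<le> (C * 2 * \<bar>t\<bar> powr (-b)) * fejer n (s - t) + (16 * C / \<bar>t\<bar>) * ?q s"
      proof (cases "\<bar>s\<bar> \<le> \<bar>t\<bar>/2")
        case True
        then have d: "\<bar>t\<bar>/2 \<le> \<bar>s - t\<bar>" "\<bar>s - t\<bar> \<le> 3 * pi / 2" using t by linarith+
        have "\<bar>t\<bar>/8 \<le> norm (1 - cis (s - t))" using norm_one_minus_cis_ge[OF d(2)] d(1) by simp
        then have "norm (dirichlet n (s - t)) * (\<bar>t\<bar>/8) \<le> 2"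
          using norm_dirichlet_mult_le[of n "s - t"] mult_left_mono[of "\<bar>t\<bar>/8" "norm (1 - cis (s - t))" "norm (dirichlet n (s - t))"] by simp
        then have D: "norm (dirichlet n (s - t)) \<le> 16 / \<bar>t\<bar>" using t by (simp add: field_simps)
        \<comment> \<open>Only one factor is bounded by 2 / |1 - cis (s - t)|; the other is bounded
          by \<open>n\<close> and cancels the denominator, so the bound on the Fejer kernel does not
          depend on \<open>n\<close>.\<close>
        have "(norm (dirichlet n (s - t)))\<^sup>2 \<le> norm (dirichlet n (s - t)) * real n"
          unfolding power2_eq_square by (intro mult_left_mono norm_dirichlet_le) auto
        then have "fejer n (s - t) \<le> norm (dirichlet n (s - t))" using n by (simp add: fejer_def field_simps)
        with D have "fejer n (s - t) \<le> 16 / \<bar>t\<bar>" by simp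
        then have "fejer n (s - t) * (C * \<bar>s\<bar> powr (-b)) \<le> (16 / \<bar>t\<bar>) * (C * \<bar>s\<bar> powr (-b))"
          using \<open>C \<ge> 0\<close> by (intro mult_right_mono) auto
        moreover have "(C * 2 * \<bar>t\<bar> powr (-b)) * fejer n (s - t) \<ge> 0" using \<open>C \<ge> 0\<close> by (simp add: fejer_nonneg)
        ultimately show ?thesis using le True by (simp add: mult_ac)
      next
        case False
        then have "\<bar>s\<bar> powr (-b) \<le> (\<bar>t\<bar>/2) powr (-b)" using t b by (intro powr_mono2') auto
        also have "\<dots> = 2 powr b * \<bar>t\<bar> powr (-b)" using t by (simp add: powr_divide powr_minus field_simps)
        also have "2 powr b \<le> 2 powr 1" using b by (intro powr_mono) auto
        then have "2 powr b * \<bar>t\<bar> powr (-b) \<le> 2 * \<bar>t\<bar> powr (-b)" by (intro mult_right_mono) auto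
        finally have "fejer n (s - t) * (C * \<bar>s\<bar> powr (-b)) \<le> fejer n (s - t) * (C * (2 * \<bar>t\<bar> powr (-b)))"
          using \<open>C \<ge> 0\<close> by (intro mult_left_mono fejer_nonneg) auto
        with le False show ?thesis by (simp add: mult_ac)
      qed
    qed
  qed
  also have "\<dots> = C * 2 * \<bar>t\<bar> powr (-b) + (16 * C / \<bar>t\<bar>) * integral\<^sup>L circ_measure ?q"
    using q(1) integrable_fejer[of n t] integral_fejer[OF n, of t] by simp
  also have "\<dots> \<le> C * 2 * \<bar>t\<bar> powr (-b) + (16 * C / \<bar>t\<bar>) * ((\<bar>t\<bar>/2) powr (1 - b) / (1 - b))"
    using \<open>C \<ge> 0\<close> by (intro add_left_mono mult_left_mono q) auto
  also have "\<dots> \<le> C * 2 * \<bar>t\<bar> powr (-b) + (16 * C / \<bar>t\<bar>) * (\<bar>t\<bar> powr (1 - b) / (1 - b))"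
    using \<open>C \<ge> 0\<close> b by (intro add_left_mono mult_left_mono divide_right_mono powr_mono2) auto
  also have "\<bar>t\<bar> powr (1 - b) = \<bar>t\<bar> * \<bar>t\<bar> powr (-b)" using t by (simp add: powr_add[symmetric] powr_mult_base)
  finally show ?thesis using t by (simp add: algebra_simps)
qed

text \<open>Here \<open>f\<close> generates the data and \<open>g\<close> is the symbol that is
  inverted. Exponent 0 covers the absence of a singularity, and \<open>a + b < 1\<close> makes f/g
  integrable. Regularity of \<open>g\<close> is asked for off the origin only, so \<open>g\<close>
  may vanish or blow up there.\<close>

locale symbol_pair =
  fixes f g :: "real \<Rightarrow> real" and a b A B :: real
  assumes f_meas [measurable]: "f \<in> borel_measurable borel" and g_int: "integrable circ_measure g"
    and f_nonneg: "\<And>t. f t \<ge> 0" and f_even: "\<And>t. f (-t) = f t" and g_even: "\<And>t. g (-t) = g t"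
    and g_pos: "\<And>t. -pi < t \<Longrightarrow> t < pi \<Longrightarrow> t \<noteq> 0 \<Longrightarrow> g t > 0"
    and g_cont: "\<And>t. -pi < t \<Longrightarrow> t < pi \<Longrightarrow> t \<noteq> 0 \<Longrightarrow> isCont g t"
    and f_le: "\<And>t. -pi < t \<Longrightarrow> t < pi \<Longrightarrow> t \<noteq> 0 \<Longrightarrow> f t \<le> A * \<bar>t\<bar> powr (-a)"
    and inv_g_le: "\<And>t. -pi < t \<Longrightarrow> t < pi \<Longrightarrow> t \<noteq> 0 \<Longrightarrow> 1 / g t \<le> B * \<bar>t\<bar> powr (-b)"
    and ab: "0 \<le> a" "0 \<le> b" "a + b < 1" and AB: "0 \<le> A" "0 \<le> B"
begin

lemma g_meas [measurable]: "g \<in> borel_measurable borel"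
  using g_int by (auto dest: borel_measurable_integrable)

lemma f_int: "integrable circ_measure f"
  using ab f_le f_nonneg by (intro integrable_circ_powr_bound[of f a A]) auto

lemma inv_g_int: "integrable circ_measure (\<lambda>t. 1 / g t)"
  using ab inv_g_le g_pos by (intro integrable_circ_powr_bound[of _ b B]) (auto simp: less_imp_le)

definition "christoffel_const = B * (2 + 16 / (1 - b))"

lemma christoffel_const_nonneg: "christoffel_const \<ge> 0" using AB ab by (simp add: christoffel_const_def)

lemma christoffel_le:
  assumes w: "tform_orthonormal g n w" and n: "n \<ge> 1" and t: "-pi < t" "t < pi" "t \<noteq> 0"
  shows "christoffel n w t / n \<le> (LINT s|circ_measure. fejer n (s - t) * (1 / g s))"
    and "christoffel n w t / n \<le> christoffel_const * \<bar>t\<bar> powr (-b)"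
proof -
  have "christoffel n w t / n \<le> (LINT s|circ_measure. (1 / g s) * (norm (dirichlet n (s - t)))\<^sup>2) / n"
    by (intro divide_right_mono christoffel_upper[OF g_int g_even w g_pos inv_g_int]) auto
  also have "\<dots> = (LINT s|circ_measure. fejer n (s - t) * (1 / g s))"
    by (subst integral_divide_zero[symmetric]) (simp add: fejer_def mult.commute)
  finally show 1: "christoffel n w t / n \<le> (LINT s|circ_measure. fejer n (s - t) * (1 / g s))" .
  have "\<dots> \<le> christoffel_const * \<bar>t\<bar> powr (-b)" unfolding christoffel_const_def
    using ab by (intro fejer_powr_bound inv_g_int inv_g_le AB n t) auto
  with 1 show "christoffel n w t / n \<le> christoffel_const * \<bar>t\<bar> powr (-b)" by simp
qed

lemma christoffel_ge:
  assumes w: "tform_orthonormal g n w" and n: "n \<ge> 1"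
  shows "1 / (LINT s|circ_measure. fejer n (s - t) * g s) \<le> christoffel n w t / n"
proof -
  define I where "I = (LINT s|circ_measure. fejer n (s - t) * g s)"
  have nI: "(LINT s|circ_measure. g s * (norm (dirichlet n (s - t)))\<^sup>2) = n * I"
    unfolding I_def using n by (subst integral_mult_right_zero[symmetric]) (simp add: fejer_def mult.commute)
  have "I \<ge> 0" unfolding I_def
    by (rule integral_nonneg_AE, rule AE_circI) (simp add: fejer_nonneg g_pos less_imp_le)
  have "(real n)\<^sup>2 \<le> christoffel n w t * (n * I)"
    using christoffel_lower[OF g_int g_even w, of t] unfolding nI .
  then have le: "real n \<le> christoffel n w t * I" using n by (simp add: power2_eq_square)
  then have "I \<noteq> 0" using n by auto
  with \<open>I \<ge> 0\<close> have "I > 0" by simp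
  with le show ?thesis unfolding I_def[symmetric] using n by (simp add: field_simps)
qed

lemma christoffel_tendsto:
  assumes w: "\<And>n. tform_orthonormal g n (w n)" and t: "-pi < t" "t < pi" "t \<noteq> 0"
  shows "(\<lambda>n. christoffel n (w n) t / n) \<longlonglongrightarrow> 1 / g t"
proof (rule tendsto_sandwich)
  show "\<forall>\<^sub>F n in sequentially. 1 / (LINT s|circ_measure. fejer n (s - t) * g s) \<le> christoffel n (w n) t / n"
    using eventually_ge_at_top[of 1] by eventually_elim (rule christoffel_ge[OF w])
  show "\<forall>\<^sub>F n in sequentially. christoffel n (w n) t / n \<le> (LINT s|circ_measure. fejer n (s - t) * (1 / g s))"
    using eventually_ge_at_top[of 1] by eventually_elim (rule christoffel_le[OF w _ t])
  show "(\<lambda>n. 1 / (LINT s|circ_measure. fejer n (s - t) * g s)) \<longlonglongrightarrow> 1 / g t"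
    using g_pos[OF t] by (intro tendsto_divide tendsto_const fejer_tendsto g_int g_cont t) auto
  show "(\<lambda>n. LINT s|circ_measure. fejer n (s - t) * (1 / g s)) \<longlonglongrightarrow> 1 / g t"
    using g_pos[OF t] by (intro fejer_tendsto inv_g_int continuous_intros g_cont t) auto
qed

lemma f_powr_bound:
  assumes t: "-pi < t" "t < pi" "t \<noteq> 0" and "y \<le> D * \<bar>t\<bar> powr (-b)" "y \<ge> 0" "D \<ge> 0"
  shows "f t * y \<le> A * D * \<bar>t\<bar> powr (-(a + b))"
proof -
  have "f t * y \<le> (A * \<bar>t\<bar> powr (-a)) * (D * \<bar>t\<bar> powr (-b))"
    using assms f_nonneg f_le[OF t] AB by (intro mult_mono) auto
  also have "\<dots> = A * D * \<bar>t\<bar> powr (-(a + b))" by (simp add: powr_add[symmetric] mult_ac)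
  finally show ?thesis .
qed

lemma trace_tendsto:
  assumes w: "\<And>n. tform_orthonormal g n (w n)"
  shows "(\<lambda>n. (\<Sum>i<n. tform f n (w n i) (w n i)) / n) \<longlonglongrightarrow> (LINT t|circ_measure. f t / g t)"
proof -
  have eq: "(\<Sum>i<n. tform f n (w n i) (w n i)) / n = (LINT t|circ_measure. f t * (christoffel n (w n) t / n))" for n
  proof -
    have "(\<Sum>i<n. tform f n (w n i) (w n i)) = (LINT t|circ_measure. (\<Sum>i<n. f t * (norm (ctrig n (w n i) t))\<^sup>2))"
      by (subst Bochner_Integration.integral_sum)
         (auto simp: tform_eq_integral[OF f_int f_even] intro!: integrable_norm_trig[OF f_int])
    also have "\<dots> = (LINT t|circ_measure. f t * christoffel n (w n) t)" by (simp add: christoffel_def sum_distrib_left)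
    finally show ?thesis by (simp only: times_divide_eq_right integral_divide_zero)
  qed
  \<comment> \<open>The index is shifted because the dominating bound holds only from n = 1
    on.\<close>
  have "(\<lambda>n. LINT t|circ_measure. f t * (christoffel (Suc n) (w (Suc n)) t / Suc n)) \<longlonglongrightarrow> (LINT t|circ_measure. f t * (1 / g t))"
  proof (rule integral_dominated_convergence)
    show "integrable circ_measure (\<lambda>t. A * christoffel_const * \<bar>t\<bar> powr (-(a + b)))"
      using ab by (intro integrable_mult_right integrable_powr_circ) auto
    show "AE t in circ_measure. (\<lambda>n. f t * (christoffel (Suc n) (w (Suc n)) t / Suc n)) \<longlonglongrightarrow> f t * (1 / g t)"
      by (rule AE_circI, intro tendsto_mult tendsto_const LIMSEQ_Suc christoffel_tendsto w)
    show "AE t in circ_measure. norm (f t * (christoffel (Suc n) (w (Suc n)) t / Suc n)) \<le> A * christoffel_const * \<bar>t\<bar> powr (-(a + b))" for n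
    proof (rule AE_circI)
      fix t assume t: "-pi < t" "t < pi" "t \<noteq> 0"
      have "f t * (christoffel (Suc n) (w (Suc n)) t / Suc n) \<le> A * christoffel_const * \<bar>t\<bar> powr (-(a + b))"
        by (rule f_powr_bound[OF t christoffel_le(2)[OF w _ t]]) (auto simp: christoffel_nonneg christoffel_const_nonneg)
      then show "norm (f t * (christoffel (Suc n) (w (Suc n)) t / Suc n)) \<le> A * christoffel_const * \<bar>t\<bar> powr (-(a + b))"
        by (simp add: f_nonneg christoffel_nonneg)
    qed
  qed measurable
  then have "(\<lambda>n. LINT t|circ_measure. f t * (christoffel n (w n) t / n)) \<longlonglongrightarrow> (LINT t|circ_measure. f t * (1 / g t))"
    by (rule LIMSEQ_imp_Suc)
  then show ?thesis unfolding eq by simp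
qed

definition "form_const = A * christoffel_const / (1 - (a + b)) + A * B"

text \<open>This is the bound on the operator norm of W^T T_n(f) W. The circle is split at |t| =
  1/n. Inside, |P|^2 is at most |c|^2 times the Christoffel function, hence of order n |t|^-b, and
  integrating n |t|^-(a+b) up to 1/n gives n^(a+b). Outside, f \<le> A B n^(a+b) g pointwise, and P
  has squared g-norm |c|^2. The two summands of \<open>form_const\<close> come from these two
  regions.\<close>

lemma tform_comb_le:
  fixes c :: "nat \<Rightarrow> real"
  assumes w: "tform_orthonormal g n w" and n: "n \<ge> 1"
  shows "tform f n (\<lambda>j. \<Sum>i<n. c i * w i j) (\<lambda>j. \<Sum>i<n. c i * w i j) \<le> form_const * n powr (a + b) * (\<Sum>i<n. (c i)\<^sup>2)"
proof -
  let ?P = "trig n (\<lambda>j. \<Sum>i<n. complex_of_real (c i) * of_real (w i j))"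
  let ?q = "\<lambda>s. if \<bar>s\<bar> \<le> 1 / n then \<bar>s\<bar> powr (-(a+b)) else 0"
  define S where "S = (\<Sum>i<n. (c i)\<^sup>2)"
  have "S \<ge> 0" by (simp add: S_def sum_nonneg)
  have q: "integrable circ_measure ?q" "integral\<^sup>L circ_measure ?q \<le> (1 / n) powr (1 - (a + b)) / (1 - (a + b))"
    using ab n powr_near_0[of "a + b" "1 / real n"] by auto
  have gP: "(LINT t|circ_measure. g t * (norm (?P t))\<^sup>2) = S"
    by (subst integral_orthonormal_comb[OF g_int g_even w]) (simp add: S_def)
  have P_le: "(norm (?P t))\<^sup>2 \<le> S * christoffel n w t" for t
    unfolding trig_sum using norm_sum_mult_le[of "\<lambda>i. of_real (c i)" "\<lambda>i. ctrig n (w i) t" "{..<n}"]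
    by (simp add: S_def christoffel_def)
  have "tform f n (\<lambda>j. \<Sum>i<n. c i * w i j) (\<lambda>j. \<Sum>i<n. c i * w i j) = (LINT t|circ_measure. f t * (norm (?P t))\<^sup>2)"
    by (subst tform_eq_integral[OF f_int f_even]) simp
  also have "\<dots> \<le> (LINT t|circ_measure. (A * christoffel_const * S * n) * ?q t + (A * B * n powr (a + b)) * (g t * (norm (?P t))\<^sup>2))"
  proof (rule integral_mono_AE)
    show "integrable circ_measure (\<lambda>t. f t * (norm (?P t))\<^sup>2)" by (rule integrable_norm_trig[OF f_int])
    show "integrable circ_measure (\<lambda>t. (A * christoffel_const * S * n) * ?q t + (A * B * n powr (a + b)) * (g t * (norm (?P t))\<^sup>2))"
      by (intro Bochner_Integration.integrable_add integrable_mult_right q integrable_norm_trig[OF g_int])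
    show "AE t in circ_measure. f t * (norm (?P t))\<^sup>2 \<le> (A * christoffel_const * S * n) * ?q t + (A * B * n powr (a + b)) * (g t * (norm (?P t))\<^sup>2)"
    proof (rule AE_circI)
      fix t assume t: "-pi < t" "t < pi" "t \<noteq> 0"
      note gp = g_pos[OF t]
      show "f t * (norm (?P t))\<^sup>2 \<le> (A * christoffel_const * S * n) * ?q t + (A * B * n powr (a + b)) * (g t * (norm (?P t))\<^sup>2)"
      proof (cases "\<bar>t\<bar> \<le> 1 / n")
        case True
        have "christoffel n w t \<le> n * christoffel_const * \<bar>t\<bar> powr (-b)" using christoffel_le(2)[OF w n t] n by (simp add: field_simps)
        then have "(norm (?P t))\<^sup>2 \<le> S * (n * christoffel_const * \<bar>t\<bar> powr (-b))"
          using P_le[of t] \<open>S \<ge> 0\<close> by (meson mult_left_mono order_trans)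
        then have "f t * (norm (?P t))\<^sup>2 \<le> A * (S * n * christoffel_const) * \<bar>t\<bar> powr (-(a + b))"
          using \<open>S \<ge> 0\<close> by (intro f_powr_bound[OF t]) (auto simp: christoffel_const_nonneg mult_ac)
        moreover have "(A * B * n powr (a + b)) * (g t * (norm (?P t))\<^sup>2) \<ge> 0" using AB gp by simp
        ultimately show ?thesis using True by (simp add: mult_ac)
      next
        case False
        then have t1: "\<bar>t\<bar> > 1 / n" by simp
        have "f t * (1 / g t) \<le> A * B * \<bar>t\<bar> powr (-(a + b))"
          using gp by (intro f_powr_bound[OF t] inv_g_le t AB) auto
        also have "\<bar>t\<bar> powr (-(a + b)) \<le> (1 / n) powr (-(a + b))" using t1 ab n by (intro powr_mono2') auto
        also have "\<dots> = n powr (a + b)"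
          using n powr_minus[of "real n" "- (a + b)"] by (simp add: powr_divide inverse_eq_divide add.commute)
        finally have "f t * (1 / g t) \<le> A * B * n powr (a + b)" using AB by (simp add: mult_left_mono)
        then have "f t \<le> A * B * n powr (a + b) * g t" using gp by (simp add: field_simps)
        then have "f t * (norm (?P t))\<^sup>2 \<le> A * B * n powr (a + b) * g t * (norm (?P t))\<^sup>2" by (intro mult_right_mono) auto
        then show ?thesis using False by (simp add: mult_ac)
      qed
    qed
  qed
  also have "\<dots> = (A * christoffel_const * S * n) * integral\<^sup>L circ_measure ?q + (A * B * n powr (a + b)) * S"
    using q(1) integrable_norm_trig[OF g_int] gP by simp
  also have "\<dots> \<le> (A * christoffel_const * S * n) * ((1 / n) powr (1 - (a + b)) / (1 - (a + b))) + (A * B * n powr (a + b)) * S"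
    using \<open>S \<ge> 0\<close> AB christoffel_const_nonneg by (intro add_right_mono mult_left_mono q) auto
  also have "(1 / n) powr (1 - (a + b)) = n powr (a + b) / n"
    
  proof -
    have "(1 / real n) powr (1 - (a + b)) = real n powr ((a + b) - 1)"
      using n powr_minus[of "real n" "1 - (a + b)"] by (simp add: powr_divide inverse_eq_divide)
    then show ?thesis using n by (simp only: powr_diff) simp
  qed
  also have "A * christoffel_const * S * n * (n powr (a + b) / n / (1 - (a + b))) + A * B * n powr (a + b) * S = form_const * n powr (a + b) * S"
  proof -
    have "A * christoffel_const * S * n * (n powr (a + b) / n / (1 - (a + b))) = A * christoffel_const / (1 - (a + b)) * n powr (a + b) * S"
      using n by simp
    then show ?thesis by (simp only: form_const_def distrib_right)
  qed
  finally show ?thesis by (simp only: S_def)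
qed

end

subsection \<open>Exponential moments of Gaussian quadratic forms\<close>

definition unitv :: "nat \<Rightarrow> nat \<Rightarrow> real" where "unitv k = (\<lambda>j. if j = k then 1 else 0)"

definition symm_bilinear :: "((nat \<Rightarrow> real) \<Rightarrow> (nat \<Rightarrow> real) \<Rightarrow> real) \<Rightarrow> bool" where
  "symm_bilinear Q \<longleftrightarrow> (\<forall>x y. Q x y = Q y x) \<and> (\<forall>x y z. Q (\<lambda>j. x j + y j) z = Q x z + Q y z) \<and>
     (\<forall>r x z. Q (\<lambda>j. r * x j) z = r * Q x z)"

lemma symm_bilinear_quadratic:
  assumes "symm_bilinear Q"
  shows "Q (\<lambda>j. r * x j + s * y j) (\<lambda>j. r * x j + s * y j) = r\<^sup>2 * Q x x + 2 * r * s * Q x y + s\<^sup>2 * Q y y"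
proof -
  have sym: "Q u v = Q v u" and add: "Q (\<lambda>j. u j + v j) z = Q u z + Q v z"
    and sc: "Q (\<lambda>j. t * u j) z = t * Q u z" for u v z t
    using assms by (auto simp: symm_bilinear_def)
  let ?z = "\<lambda>j. r * x j + s * y j"
  have "Q ?z ?z = r * Q x ?z + s * Q y ?z" unfolding add[of "\<lambda>j. r * x j"] sc ..
  also have "Q x ?z = r * Q x x + s * Q y x" unfolding sym[of x ?z] add[of "\<lambda>j. r * x j"] sc ..
  also have "Q y ?z = r * Q x y + s * Q y y" unfolding sym[of y ?z] add[of "\<lambda>j. r * x j"] sc ..
  finally show ?thesis using sym[of y x] by (simp add: power2_eq_square algebra_simps)
qed

lemma symm_bilinear_add_scaled:
  assumes "symm_bilinear Q"
  shows "Q (\<lambda>j. x j + s * y j) (\<lambda>j. x j + s * y j) = Q x x + 2 * s * Q x y + s\<^sup>2 * Q y y"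
  using symm_bilinear_quadratic[OF assms, of 1 x s y] by simp

text \<open>If Q is the covariance form of a Gaussian family Y, reweighting its law by exp
  (\<sigma>/2 (Y_0^2 + ... + Y_(k-1)^2)) and normalising gives a Gaussian law with covariance form
  \<open>tilt \<sigma> Q k\<close>. Each step is a Sherman-Morrison update of rank one.\<close>

primrec tilt :: "real \<Rightarrow> ((nat \<Rightarrow> real) \<Rightarrow> (nat \<Rightarrow> real) \<Rightarrow> real) \<Rightarrow> nat \<Rightarrow> (nat \<Rightarrow> real) \<Rightarrow> (nat \<Rightarrow> real) \<Rightarrow> real" where
  "tilt \<sigma> Q 0 = Q"
| "tilt \<sigma> Q (Suc k) = (\<lambda>x y. tilt \<sigma> Q k x y +
     \<sigma> * tilt \<sigma> Q k x (unitv k) * tilt \<sigma> Q k y (unitv k) / (1 - \<sigma> * tilt \<sigma> Q k (unitv k) (unitv k)))"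

lemma symm_bilinear_tilt: "symm_bilinear Q \<Longrightarrow> symm_bilinear (tilt \<sigma> Q k)"
proof (induction k)
  case (Suc k)
  then have sym: "tilt \<sigma> Q k u v = tilt \<sigma> Q k v u" and add: "tilt \<sigma> Q k (\<lambda>j. u j + v j) z = tilt \<sigma> Q k u z + tilt \<sigma> Q k v z"
    and sc: "tilt \<sigma> Q k (\<lambda>j. t * u j) z = t * tilt \<sigma> Q k u z" for u v z t
    by (auto simp: symm_bilinear_def)
  show ?case unfolding symm_bilinear_def tilt.simps add sc
    using sym by (auto simp: algebra_simps add_divide_distrib)
qed simp

text \<open>\<open>\<sigma>\<close> may have either sign, so that one set of estimates serves both
  tails. The bound 1/3 gives \<open>\<kappa> \<le> 3/2\<close> and keeps \<sigma> \<kappa> Q(e_k,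
  e_k) within 1/2 in modulus, where the logarithm is controlled.\<close>

locale bounded_form =
  fixes n :: nat and Q :: "(nat \<Rightarrow> real) \<Rightarrow> (nat \<Rightarrow> real) \<Rightarrow> real" and b \<sigma> :: real
  assumes Q: "symm_bilinear Q" and Q_nonneg: "\<And>x. 0 \<le> Q x x" and Q_le: "\<And>x. Q x x \<le> b * (\<Sum>i<n. (x i)\<^sup>2)"
    and b_pos: "0 < b" and small: "\<bar>\<sigma>\<bar> * b \<le> 1 / 3"
begin

definition "\<kappa> = 1 / (1 - \<sigma> * b)"

lemma abs_sigma_b_le: "\<bar>\<sigma> * b\<bar> \<le> 1 / 3"
  using small b_pos by (simp add: abs_mult)

lemma kappa: "0 < \<kappa>" "\<kappa> \<le> 3 / 2" "\<kappa> * (1 - \<sigma> * b) = 1"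
  using abs_sigma_b_le unfolding \<kappa>_def by (auto simp: divide_simps abs_if split: if_splits)

lemma unitv_sum: "k < n \<Longrightarrow> (\<Sum>i<n. (unitv k i)\<^sup>2) = 1"
proof -
  assume k: "k < n"
  have "(unitv k i)\<^sup>2 = (if i = k then 1 else 0)" for i by (simp add: unitv_def)
  then show ?thesis using k by simp
qed

lemma Q_unitv: "k < n \<Longrightarrow> Q (unitv k) (unitv k) \<le> b" 
  using Q_le[of "unitv k"] by (simp add: unitv_sum)

lemma abs_sigma_kappa_Q_le: "k < n \<Longrightarrow> \<bar>\<sigma> * \<kappa> * Q (unitv k) (unitv k)\<bar> \<le> 1 / 2"
proof -
  assume k: "k < n"
  have "\<bar>\<sigma> * \<kappa> * Q (unitv k) (unitv k)\<bar> = \<kappa> * (\<bar>\<sigma>\<bar> * Q (unitv k) (unitv k))"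
    using kappa Q_nonneg by (simp add: abs_mult)
  also have "\<dots> \<le> \<kappa> * (\<bar>\<sigma>\<bar> * b)" using kappa Q_unitv[OF k] by (intro mult_left_mono) auto
  also have "\<dots> \<le> (3/2) * (1/3)" using kappa small b_pos by (intro mult_mono) auto
  finally show ?thesis by simp
qed

text \<open>\<open>tilt \<sigma> Q (Suc k)\<close> at \<open>x\<close> is the critical value of \<open>t \<mapsto> tilt \<sigma> Q k (x + t e\<^sub>k) - t\<^sup>2 / \<sigma>\<close>,
  so a bound for all perturbations in the directions \<open>k, \<dots>, n - 1\<close> is passed on from \<open>k\<close> to \<open>Suc k\<close>.\<close>
lemma tilt_le:
  assumes "k \<le> n" "\<And>i. i < k \<Longrightarrow> z i = 0"
  shows "\<sigma> * tilt \<sigma> Q k (\<lambda>j. x j + z j) (\<lambda>j. x j + z j) - (\<Sum>i<n. (z i)\<^sup>2) \<le> \<sigma> * \<kappa> * Q x x"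
  using assms
proof (induction k arbitrary: x z)
  case 0
  \<comment> \<open>This weight u = 1/b - \<sigma> in Young's inequality turns the terms in
    \<open>z\<close> into Q z z / b, which \<open>Q_le\<close> absorbs, and those in
    \<open>x\<close> into exactly \<sigma> \<kappa> Q x x.\<close>
  define u where "u = (1 - \<sigma> * b) / b"
  have u: "u > 0" using abs_sigma_b_le b_pos by (auto simp: u_def)
  have "0 \<le> Q (\<lambda>j. \<sigma> * x j + (- u) * z j) (\<lambda>j. \<sigma> * x j + (- u) * z j)" by (rule Q_nonneg)
  also have "\<dots> = \<sigma>\<^sup>2 * Q x x - 2 * \<sigma> * u * Q x z + u\<^sup>2 * Q z z"
    unfolding symm_bilinear_quadratic[OF Q] by simp
  finally have "2 * \<sigma> * u * Q x z \<le> \<sigma>\<^sup>2 * Q x x + u\<^sup>2 * Q z z" by simp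
  then have "(2 * \<sigma> * u * Q x z) / u \<le> (\<sigma>\<^sup>2 * Q x x + u\<^sup>2 * Q z z) / u" using u by (intro divide_right_mono) auto
  then have 1: "2 * \<sigma> * Q x z \<le> \<sigma>\<^sup>2 / u * Q x x + u * Q z z"
    using u by (simp add: add_divide_distrib power2_eq_square)
  have 2: "\<sigma>\<^sup>2 / u = \<sigma> * \<kappa> - \<sigma>"
    using abs_sigma_b_le b_pos by (simp add: u_def \<kappa>_def field_simps power2_eq_square abs_if split: if_splits)
  have 3: "u * Q z z = Q z z / b - \<sigma> * Q z z" using b_pos by (simp add: u_def field_simps)
  have 4: "Q z z / b \<le> (\<Sum>i<n. (z i)\<^sup>2)" using Q_le[of z] b_pos by (simp add: field_simps)
  have "\<sigma> * Q (\<lambda>j. x j + z j) (\<lambda>j. x j + z j) = \<sigma> * Q x x + 2 * \<sigma> * Q x z + \<sigma> * Q z z"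
    using symm_bilinear_add_scaled[OF Q, of x 1 z] by (simp add: algebra_simps)
  with 1 4 show ?case unfolding 2 3 by (simp add: left_diff_distrib)
next
  case (Suc k)
  let ?T = "tilt \<sigma> Q k" and ?e = "unitv k" and ?x = "\<lambda>j. x j + z j"
  have "k < n" using Suc.prems by simp
  have "\<sigma> * ?T (\<lambda>j. ?e j + 0) (\<lambda>j. ?e j + 0) - (\<Sum>i<n. 0\<^sup>2) \<le> \<sigma> * \<kappa> * Q ?e ?e"
    by (rule Suc.IH) (use Suc.prems in auto)
  then have "\<sigma> * ?T ?e ?e \<le> 1 / 2" using abs_sigma_kappa_Q_le[OF \<open>k < n\<close>] by simp
  then have a: "1 - \<sigma> * ?T ?e ?e \<noteq> 0" by simp
  define p where "p = ?T ?x ?e"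
  define t where "t = \<sigma> * p / (1 - \<sigma> * ?T ?e ?e)"
  define z' where "z' = (\<lambda>j. z j + t * ?e j)"
  have zk: "z k = 0" using Suc.prems by simp
  \<comment> \<open>Here the vanishing of \<open>z\<close> at \<open>k\<close> is used: the new
    direction is orthogonal to \<open>z\<close>, so the squares add without a cross term.\<close>
  have zs: "(\<Sum>i<n. (z' i)\<^sup>2) = (\<Sum>i<n. (z i)\<^sup>2) + t\<^sup>2"
  proof -
    have "(z' i)\<^sup>2 = (z i)\<^sup>2 + (if i = k then t\<^sup>2 else 0)" for i using zk by (auto simp: z'_def unitv_def)
    then show ?thesis using \<open>k < n\<close> by (simp add: sum.distrib)
  qed
  have "\<sigma> * tilt \<sigma> Q (Suc k) ?x ?x = \<sigma> * (?T ?x ?x + p * t)"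
    by (simp add: p_def t_def mult_ac)
  also have "\<dots> = \<sigma> * (?T ?x ?x + 2 * t * p + t\<^sup>2 * ?T ?e ?e) - t\<^sup>2"
  proof -
    have *: "s * (T + p * t) = s * (T + 2 * t * p + t\<^sup>2 * a) - t\<^sup>2" if "t * (1 - s * a) = s * p" for s T a p t :: real

    proof -
      have sp: "s * p = t - t * s * a" using that by (simp add: algebra_simps)
      have "s * (T + p * t) = s * T + (s * p) * t" by (simp add: algebra_simps)
      moreover have "s * (T + 2 * t * p + t\<^sup>2 * a) = s * T + 2 * t * (s * p) + s * t\<^sup>2 * a" by (simp add: algebra_simps)
      ultimately show ?thesis unfolding sp by (simp add: algebra_simps power2_eq_square)
    qed
    show ?thesis by (rule *) (use a in \<open>simp add: t_def\<close>)
  qed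
  also have "?T ?x ?x + 2 * t * p + t\<^sup>2 * ?T ?e ?e = ?T (\<lambda>j. x j + z' j) (\<lambda>j. x j + z' j)"
    unfolding p_def using symm_bilinear_add_scaled[OF symm_bilinear_tilt[OF Q, of \<sigma> k], of ?x t ?e]
    by (simp add: z'_def add.assoc)
  finally have "\<sigma> * tilt \<sigma> Q (Suc k) ?x ?x - (\<Sum>i<n. (z i)\<^sup>2) =
     \<sigma> * ?T (\<lambda>j. x j + z' j) (\<lambda>j. x j + z' j) - (\<Sum>i<n. (z' i)\<^sup>2)" unfolding zs by simp
  also have "\<dots> \<le> \<sigma> * \<kappa> * Q x x"
    by (rule Suc.IH) (use Suc.prems in \<open>auto simp: z'_def unitv_def\<close>)
  finally show ?case .
qed

lemma tilt_unitv_le: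
  assumes "k < n"
  shows "\<sigma> * tilt \<sigma> Q k (unitv k) (unitv k) \<le> \<sigma> * \<kappa> * Q (unitv k) (unitv k)"
  using tilt_le[of k "\<lambda>_. 0" "unitv k"] assms by simp

text \<open>Every pivot 1 - \<sigma> tilt(e_k, e_k) is positive: this is the convergence condition
  for the Gaussian integral over the k-th auxiliary variable.\<close>

lemma tilt_unitv_less: "k < n \<Longrightarrow> \<sigma> * tilt \<sigma> Q k (unitv k) (unitv k) < 1"
  using tilt_unitv_le[of k] abs_sigma_kappa_Q_le[of k] by simp

text \<open>By the matrix determinant lemma this product of pivots is det(1 - \<sigma> Q)^(-1/2) for
  the leading \<open>k\<close> by \<open>k\<close> block of Q.\<close>

definition "tconst k = (\<Prod>i<k. 1 / sqrt (1 - \<sigma> * tilt \<sigma> Q i (unitv i) (unitv i)))"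

lemma tconst_nonneg: "k \<le> n \<Longrightarrow> 0 \<le> tconst k"
  unfolding tconst_def by (intro prod_nonneg) (auto intro!: less_imp_le[OF tilt_unitv_less])

text \<open>A second-order expansion of -1/2 log det(1 - \<sigma> Q): the linear term is the trace,
  and the quadratic one is bounded by the norm times the trace. No eigenvalues are used; each pivot
  is compared with 1 - \<sigma> \<kappa> Q(e_i, e_i).\<close>

lemma tconst_le: "tconst n \<le> exp (\<sigma> / 2 * (\<Sum>i<n. Q (unitv i) (unitv i)) + 3 * \<sigma>\<^sup>2 * b * (\<Sum>i<n. Q (unitv i) (unitv i)))"
proof -
  have "tconst n \<le> (\<Prod>i<n. exp (\<sigma> / 2 * Q (unitv i) (unitv i) + 3 * \<sigma>\<^sup>2 * b * Q (unitv i) (unitv i)))"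
    unfolding tconst_def
  proof (intro prod_mono conjI)
    fix i assume "i \<in> {..<n}"
    then have i: "i < n" by simp
    define q where "q = Q (unitv i) (unitv i)"
    define x where "x = \<sigma> * \<kappa> * q"
    define y where "y = 1 - \<sigma> * tilt \<sigma> Q i (unitv i) (unitv i)"
    have q: "0 \<le> q" "q \<le> b" using Q_nonneg Q_unitv[OF i] by (auto simp: q_def)
    have x: "\<bar>x\<bar> \<le> 1 / 2" unfolding x_def q_def by (rule abs_sigma_kappa_Q_le[OF i])
    have y: "1 - x \<le> y" using tilt_unitv_le[OF i] by (simp add: x_def y_def q_def)
    have y0: "0 < y" using x y by simp
    show "0 \<le> 1 / sqrt (1 - \<sigma> * tilt \<sigma> Q i (unitv i) (unitv i))" using y0 by (simp add: y_def)
    have "\<bar>ln (1 + (-x)) - (-x)\<bar> \<le> 2 * (-x)\<^sup>2" using x by (intro abs_ln_one_plus_x_minus_x_bound) auto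
    then have ln: "- ln (1 - x) \<le> x + 2 * x\<^sup>2" by simp
    have x1: "x \<le> \<sigma> * q + 3 / 2 * \<sigma>\<^sup>2 * b * q"
    proof -
      have "\<sigma> * \<kappa> = \<sigma> + \<kappa> * (\<sigma>\<^sup>2 * b)" 
      proof -
        have "\<kappa> = 1 + \<kappa> * (\<sigma> * b)" using kappa(3) by (simp add: algebra_simps)
        from arg_cong[OF this, of "(*) \<sigma>"] show ?thesis by (simp add: power2_eq_square distrib_left mult_ac)
      qed
      moreover have "\<kappa> * (\<sigma>\<^sup>2 * b) \<le> 3 / 2 * (\<sigma>\<^sup>2 * b)" using kappa b_pos by (intro mult_right_mono) auto
      ultimately have "\<sigma> * \<kappa> \<le> \<sigma> + 3 / 2 * (\<sigma>\<^sup>2 * b)" by simp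
      then have "\<sigma> * \<kappa> * q \<le> (\<sigma> + 3 / 2 * (\<sigma>\<^sup>2 * b)) * q" using q by (intro mult_right_mono) auto
      then show ?thesis by (simp add: x_def algebra_simps)
    qed
    have "\<kappa>\<^sup>2 \<le> (3/2)\<^sup>2" using kappa by (intro power_mono) auto
    then have "\<kappa>\<^sup>2 * (q * q) \<le> (3/2)\<^sup>2 * (b * q)" using q kappa b_pos by (intro mult_mono) auto
    then have "\<sigma>\<^sup>2 * (\<kappa>\<^sup>2 * (q * q)) \<le> \<sigma>\<^sup>2 * ((3/2)\<^sup>2 * (b * q))" by (intro mult_left_mono) auto
    then have x2: "x\<^sup>2 \<le> 9 / 4 * \<sigma>\<^sup>2 * b * q" by (simp add: x_def power_mult_distrib power2_eq_square mult_ac)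
    have "1 / sqrt y \<le> 1 / sqrt (1 - x)" using x y by (intro divide_left_mono) (auto intro!: mult_pos_pos)
    also have "\<dots> = exp (- ln (1 - x) / 2)"
    proof -
      have "1 - x > 0" using x by simp
      then have "sqrt (1 - x) = exp (ln (1 - x) / 2)" by (simp add: powr_half_sqrt[symmetric] powr_def)
      then show ?thesis by (simp add: exp_minus inverse_eq_divide)
    qed
    \<comment> \<open>The exponent is at most x/2 + x^2. The bounds on \<open>x\<close> and on its
      square contribute 3/4 and 9/4 times \<sigma>^2 b q, which explains the constant 3.\<close>
    also have "\<dots> \<le> exp (\<sigma> / 2 * q + 3 * \<sigma>\<^sup>2 * b * q)" using ln x1 x2 by simp
    finally show "1 / sqrt (1 - \<sigma> * tilt \<sigma> Q i (unitv i) (unitv i)) \<le>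
      exp (\<sigma> / 2 * Q (unitv i) (unitv i) + 3 * \<sigma>\<^sup>2 * b * Q (unitv i) (unitv i))"
      by (simp add: y_def q_def)
  qed
  also have "\<dots> = exp (\<sigma> / 2 * (\<Sum>i<n. Q (unitv i) (unitv i)) + 3 * \<sigma>\<^sup>2 * b * (\<Sum>i<n. Q (unitv i) (unitv i)))"
    by (simp add: exp_sum[symmetric] sum.distrib sum_distrib_left)
  finally show ?thesis .
qed

end

section \<open>One-dimensional Gaussian integrals, by completing the square\<close>

lemma nn_integral_std_normal_exp_quadratic:
  fixes a p :: real
  assumes "a < 1"
  shows "(\<integral>\<^sup>+x. ennreal (std_normal_density x * exp (p * x + a * x\<^sup>2 / 2)) \<partial>lborel) =
    ennreal (exp (p\<^sup>2 / (2 * (1 - a))) / sqrt (1 - a))"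
proof -
  define v where "v = 1 - a"
  have v: "v > 0" using assms by (simp add: v_def)
  define s where "s = 1 / sqrt v"
  have s: "s > 0" "s\<^sup>2 = 1 / v" using v by (auto simp: s_def power_divide)
  define K where "K = exp (p\<^sup>2 / (2 * v)) / sqrt v"
  have "std_normal_density x * exp (p * x + a * x\<^sup>2 / 2) = K * normal_density (p / v) s x" for x
  proof -
    have "- (x\<^sup>2 / 2) + (p * x + a * x\<^sup>2 / 2) = p\<^sup>2 / (2 * v) + - ((x - p / v)\<^sup>2) / (2 * s\<^sup>2)"
      using v unfolding s(2) by (simp add: power2_eq_square divide_simps) (simp add: v_def algebra_simps)
    then have "exp (- (x\<^sup>2 / 2)) * exp (p * x + a * x\<^sup>2 / 2) = exp (p\<^sup>2 / (2 * v)) * exp (- ((x - p / v)\<^sup>2) / (2 * s\<^sup>2))"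
      by (simp only: exp_add[symmetric])
    moreover have "sqrt (2 * pi * s\<^sup>2) * sqrt v = sqrt (2 * pi)"
      using v unfolding s(2) by (simp add: real_sqrt_mult[symmetric])
    ultimately show ?thesis
      unfolding std_normal_density_def normal_density_def K_def using v
      by (simp add: field_simps)
  qed
  then have "(\<integral>\<^sup>+x. ennreal (std_normal_density x * exp (p * x + a * x\<^sup>2 / 2)) \<partial>lborel) =
    (\<integral>\<^sup>+x. ennreal K * ennreal (normal_density (p / v) s x) \<partial>lborel)"
    using v by (intro nn_integral_cong) (simp add: ennreal_mult[symmetric] K_def)
  also have "\<dots> = ennreal K * (\<integral>\<^sup>+x. ennreal (normal_density (p / v) s x) \<partial>lborel)" by (rule nn_integral_cmult) auto
  also have "(\<integral>\<^sup>+x. ennreal (normal_density (p / v) s x) \<partial>lborel) = 1"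
    using s by (subst nn_integral_eq_integral) auto
  finally show ?thesis by (simp add: K_def v_def)
qed

lemma nn_integral_std_normal_distribution:
  assumes [measurable]: "h \<in> borel_measurable borel"
  shows "(\<integral>\<^sup>+x. h x \<partial>std_normal_distribution) = (\<integral>\<^sup>+x. ennreal (std_normal_density x) * h x \<partial>lborel)"
  by (rule nn_integral_density) auto

lemma nn_integral_std_normal_distribution_exp:
  fixes a p :: real
  assumes "a < 1"
  shows "(\<integral>\<^sup>+x. ennreal (exp (p * x + a * x\<^sup>2 / 2)) \<partial>std_normal_distribution) =
    ennreal (exp (p\<^sup>2 / (2 * (1 - a))) / sqrt (1 - a))"
  using nn_integral_std_normal_exp_quadratic[OF assms, of p]
  by (subst nn_integral_std_normal_distribution) (auto simp: ennreal_mult[symmetric])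

lemma integral_std_normal_distribution_exp:
  fixes a p :: real
  assumes "a < 1"
  shows "(LINT x|std_normal_distribution. exp (p * x + a * x\<^sup>2 / 2)) = exp (p\<^sup>2 / (2 * (1 - a))) / sqrt (1 - a)"
  using nn_integral_std_normal_distribution_exp[OF assms, of p] assms
  by (subst integral_eq_nn_integral) auto

lemma integral_std_normal_iexp:
  "(LINT x|std_normal_distribution. iexp (t * x)) = of_real (exp (- t\<^sup>2 / 2))"
  using fun_cong[OF char_std_normal_distribution, of t] by (simp add: char_def)

text \<open>Only transforms of linear combinations are assumed. The covariance form may be
  degenerate and no joint density is needed. \<open>mgf\<close> serves positive
  \<open>\<sigma>\<close>, and \<open>cf\<close> negative \<open>\<sigma>\<close>.\<close>

locale gaussian_family = prob_space M + bounded_form n Q b \<sigma>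
  for M :: "'a measure" and n Q b \<sigma> +
  fixes Y :: "nat \<Rightarrow> 'a \<Rightarrow> real"
  assumes Y_meas [measurable]: "\<And>i. Y i \<in> borel_measurable M"
    and mgf: "\<And>c. (\<integral>\<^sup>+\<omega>. ennreal (exp (\<Sum>i<n. c i * Y i \<omega>)) \<partial>M) = ennreal (exp (Q c c / 2))"
    and cf: "\<And>c. (CLINT \<omega>|M. iexp (\<Sum>i<n. c i * Y i \<omega>)) = of_real (exp (- Q c c / 2))"
begin

lemma sum_unitv: "k < n \<Longrightarrow> (\<Sum>i<n. (c i + r * unitv k i) * Y i \<omega>) = (\<Sum>i<n. c i * Y i \<omega>) + r * Y k \<omega>"
proof -
  assume k: "k < n"
  have "(c i + r * unitv k i) * Y i \<omega> = c i * Y i \<omega> + (if i = k then r * Y k \<omega> else 0)" for i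
    by (simp add: unitv_def distrib_right)
  then show ?thesis using k by (simp add: sum.distrib)
qed

lemma tconst_Suc: "tconst (Suc k) = tconst k / sqrt (1 - \<sigma> * tilt \<sigma> Q k (unitv k) (unitv k))"
  by (simp add: tconst_def)

text \<open>The identity exp (\<sigma> y^2 / 2) = E exp (sqrt \<sigma> x y), with x standard normal,
  replaces the next square by a linear term, and Tonelli exchanges the integrals. The linear part
  \<open>c\<close> is kept general so that the induction hypothesis absorbs that new term.\<close>

lemma mgf_tilt:
  assumes "\<sigma> > 0" "k \<le> n"
  shows "(\<integral>\<^sup>+\<omega>. ennreal (exp (\<sigma> / 2 * (\<Sum>i<k. (Y i \<omega>)\<^sup>2) + (\<Sum>i<n. c i * Y i \<omega>))) \<partial>M) =
    ennreal (tconst k * exp (tilt \<sigma> Q k c c / 2))"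
  using assms(2)
proof (induction k arbitrary: c)
  case 0 then show ?case using mgf[of c] by (simp add: tconst_def)
next
  case (Suc k)
  then have k: "k < n" by simp
  let ?N = std_normal_distribution and ?e = "unitv k"
  interpret N: prob_space ?N using prob_space_normal_density by simp
  interpret P: pair_sigma_finite M ?N ..
  define S where "S = (\<lambda>\<omega>. \<sigma> / 2 * (\<Sum>i<k. (Y i \<omega>)\<^sup>2) + (\<Sum>i<n. c i * Y i \<omega>))"
  have [measurable]: "S \<in> borel_measurable M" by (simp add: S_def)
  define a p where "a = tilt \<sigma> Q k ?e ?e" and "p = tilt \<sigma> Q k c ?e"
  have a: "\<sigma> * a < 1" unfolding a_def by (rule tilt_unitv_less[OF k])
  have "(\<integral>\<^sup>+\<omega>. ennreal (exp (\<sigma> / 2 * (\<Sum>i<Suc k. (Y i \<omega>)\<^sup>2) + (\<Sum>i<n. c i * Y i \<omega>))) \<partial>M) =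
    (\<integral>\<^sup>+\<omega>. ennreal (exp (S \<omega>)) * ennreal (exp (\<sigma> * (Y k \<omega>)\<^sup>2 / 2)) \<partial>M)"
    by (intro nn_integral_cong) (simp add: S_def ennreal_mult[symmetric] exp_add[symmetric] algebra_simps)
  also have "\<dots> = (\<integral>\<^sup>+\<omega>. (\<integral>\<^sup>+x. ennreal (exp (S \<omega> + sqrt \<sigma> * x * Y k \<omega>)) \<partial>?N) \<partial>M)"
  proof (intro nn_integral_cong)
    fix \<omega>
    have "(\<integral>\<^sup>+x. ennreal (exp (S \<omega> + sqrt \<sigma> * x * Y k \<omega>)) \<partial>?N) =
      (\<integral>\<^sup>+x. ennreal (exp (S \<omega>)) * ennreal (exp ((sqrt \<sigma> * Y k \<omega>) * x + 0 * x\<^sup>2 / 2)) \<partial>?N)"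
      by (intro nn_integral_cong) (simp add: ennreal_mult[symmetric] exp_add[symmetric] mult_ac)
    also have "\<dots> = ennreal (exp (S \<omega>)) * (\<integral>\<^sup>+x. ennreal (exp ((sqrt \<sigma> * Y k \<omega>) * x + 0 * x\<^sup>2 / 2)) \<partial>?N)"
      by (rule nn_integral_cmult) auto
    also have "\<dots> = ennreal (exp (S \<omega>)) * ennreal (exp (\<sigma> * (Y k \<omega>)\<^sup>2 / 2))"
      using \<open>\<sigma> > 0\<close> by (subst nn_integral_std_normal_distribution_exp) (auto simp: power_mult_distrib)
    finally show "ennreal (exp (S \<omega>)) * ennreal (exp (\<sigma> * (Y k \<omega>)\<^sup>2 / 2)) = (\<integral>\<^sup>+x. ennreal (exp (S \<omega> + sqrt \<sigma> * x * Y k \<omega>)) \<partial>?N)" by simp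
  qed
  also have "\<dots> = (\<integral>\<^sup>+x. (\<integral>\<^sup>+\<omega>. ennreal (exp (S \<omega> + sqrt \<sigma> * x * Y k \<omega>)) \<partial>M) \<partial>?N)"
    by (rule P.Fubini'[symmetric]) measurable
  also have "\<dots> = (\<integral>\<^sup>+x. ennreal (tconst k * exp (tilt \<sigma> Q k c c / 2)) * ennreal (exp ((sqrt \<sigma> * p) * x + (\<sigma> * a) * x\<^sup>2 / 2)) \<partial>?N)"
  proof (intro nn_integral_cong)
    fix x
    have "(\<integral>\<^sup>+\<omega>. ennreal (exp (S \<omega> + sqrt \<sigma> * x * Y k \<omega>)) \<partial>M) =
       (\<integral>\<^sup>+\<omega>. ennreal (exp (\<sigma> / 2 * (\<Sum>i<k. (Y i \<omega>)\<^sup>2) + (\<Sum>i<n. (c i + (sqrt \<sigma> * x) * ?e i) * Y i \<omega>))) \<partial>M)"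
      unfolding sum_unitv[OF k] by (simp add: S_def add.assoc)
    also have "\<dots> = ennreal (tconst k * exp (tilt \<sigma> Q k (\<lambda>i. c i + (sqrt \<sigma> * x) * ?e i) (\<lambda>i. c i + (sqrt \<sigma> * x) * ?e i) / 2))"
      using Suc.prems by (intro Suc.IH) auto
    also have "tilt \<sigma> Q k (\<lambda>i. c i + (sqrt \<sigma> * x) * ?e i) (\<lambda>i. c i + (sqrt \<sigma> * x) * ?e i) / 2 =
       tilt \<sigma> Q k c c / 2 + ((sqrt \<sigma> * p) * x + (\<sigma> * a) * x\<^sup>2 / 2)"
      unfolding symm_bilinear_add_scaled[OF symm_bilinear_tilt[OF Q]] using \<open>\<sigma> > 0\<close>
      by (simp add: a_def p_def power_mult_distrib field_simps)
    finally show "(\<integral>\<^sup>+\<omega>. ennreal (exp (S \<omega> + sqrt \<sigma> * x * Y k \<omega>)) \<partial>M) =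
      ennreal (tconst k * exp (tilt \<sigma> Q k c c / 2)) * ennreal (exp ((sqrt \<sigma> * p) * x + (\<sigma> * a) * x\<^sup>2 / 2))"
      using tconst_nonneg[of k] k by (simp add: exp_add ennreal_mult[symmetric] mult_ac)
  qed
  also have "\<dots> = ennreal (tconst k * exp (tilt \<sigma> Q k c c / 2)) * ennreal (exp ((sqrt \<sigma> * p)\<^sup>2 / (2 * (1 - \<sigma> * a))) / sqrt (1 - \<sigma> * a))"
    by (subst nn_integral_cmult) (auto simp: nn_integral_std_normal_distribution_exp[OF a])
  also have "\<dots> = ennreal (tconst (Suc k) * exp (tilt \<sigma> Q (Suc k) c c / 2))"
  proof -
    have "tilt \<sigma> Q (Suc k) c c / 2 = tilt \<sigma> Q k c c / 2 + (sqrt \<sigma> * p)\<^sup>2 / (2 * (1 - \<sigma> * a))"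

    proof -
      have "(sqrt \<sigma> * p)\<^sup>2 = \<sigma> * p * p" using \<open>\<sigma> > 0\<close> by (simp add: power_mult_distrib) (simp add: power2_eq_square)
      then have "(sqrt \<sigma> * p)\<^sup>2 / (2 * (1 - \<sigma> * a)) = (\<sigma> * p * p / (1 - \<sigma> * a)) / 2"
        by (simp only: divide_divide_eq_left mult.commute)
      then show ?thesis by (simp only: tilt.simps a_def p_def add_divide_distrib)
    qed
    then have "exp (tilt \<sigma> Q (Suc k) c c / 2) = exp (tilt \<sigma> Q k c c / 2) * exp ((sqrt \<sigma> * p)\<^sup>2 / (2 * (1 - \<sigma> * a)))"
      by (simp only: exp_add)
    then have "tconst (Suc k) * exp (tilt \<sigma> Q (Suc k) c c / 2) =
      (tconst k * exp (tilt \<sigma> Q k c c / 2)) * (exp ((sqrt \<sigma> * p)\<^sup>2 / (2 * (1 - \<sigma> * a))) / sqrt (1 - \<sigma> * a))"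
      unfolding tconst_Suc by (simp only: a_def times_divide_eq_left times_divide_eq_right mult.assoc)
    then show ?thesis
      using tconst_nonneg[of k] k a by (simp only: ennreal_mult mult_nonneg_nonneg exp_ge_zero divide_nonneg_nonneg
        real_sqrt_ge_zero diff_ge_0_iff_ge less_imp_le)
  qed
  finally show ?case .
qed

text \<open>For negative \<open>\<sigma>\<close> the square root of \<sigma> is imaginary, so the
  auxiliary variable enters through a characteristic function. All integrands have modulus at most
  1, which justifies Fubini.\<close>

lemma cf_tilt:
  assumes "\<sigma> < 0" "k \<le> n"
  shows "(CLINT \<omega>|M. of_real (exp (\<sigma> / 2 * (\<Sum>i<k. (Y i \<omega>)\<^sup>2))) * iexp (\<Sum>i<n. c i * Y i \<omega>)) =
    of_real (tconst k * exp (- tilt \<sigma> Q k c c / 2))"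
  using assms(2)
proof (induction k arbitrary: c)
  case 0 then show ?case using cf[of c] by (simp add: tconst_def)
next
  case (Suc k)
  then have k: "k < n" by simp
  let ?N = std_normal_distribution and ?e = "unitv k"
  interpret N: prob_space ?N using prob_space_normal_density by simp
  interpret P: pair_prob_space M ?N ..
  define S where "S = (\<lambda>\<omega>. complex_of_real (exp (\<sigma> / 2 * (\<Sum>i<k. (Y i \<omega>)\<^sup>2))) * iexp (\<Sum>i<n. c i * Y i \<omega>))"
  have [measurable]: "S \<in> borel_measurable M" by (simp add: S_def)
  have S1: "norm (S \<omega>) \<le> 1" for \<omega>
    using \<open>\<sigma> < 0\<close> by (simp add: S_def norm_mult mult_nonpos_nonneg sum_nonneg)
  define r where "r = sqrt (- \<sigma>)"
  have r2: "r\<^sup>2 = - \<sigma>" using \<open>\<sigma> < 0\<close> by (simp add: r_def)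
  define a p where "a = tilt \<sigma> Q k ?e ?e" and "p = tilt \<sigma> Q k c ?e"
  have a: "\<sigma> * a < 1" unfolding a_def by (rule tilt_unitv_less[OF k])
  have "(CLINT \<omega>|M. of_real (exp (\<sigma> / 2 * (\<Sum>i<Suc k. (Y i \<omega>)\<^sup>2))) * iexp (\<Sum>i<n. c i * Y i \<omega>)) =
    (CLINT \<omega>|M. S \<omega> * of_real (exp (- (r * Y k \<omega>)\<^sup>2 / 2)))"
    by (intro Bochner_Integration.integral_cong) (simp_all add: S_def exp_add[symmetric] r2 power_mult_distrib distrib_left exp_of_real[symmetric] add_ac)
  also have "\<dots> = (CLINT \<omega>|M. (CLINT x|?N. S \<omega> * iexp (r * x * Y k \<omega>)))"
    by (intro Bochner_Integration.integral_cong refl, subst integral_std_normal_iexp[symmetric]) (simp add: mult_ac)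
  also have "\<dots> = (CLINT x|?N. (CLINT \<omega>|M. S \<omega> * iexp (r * x * Y k \<omega>)))"
  proof (rule P.Fubini_integral[symmetric], rule P.integrable_const_bound[where B=1])
    show "AE x in M \<Otimes>\<^sub>M ?N. norm (case x of (\<omega>, x) \<Rightarrow> S \<omega> * iexp (r * x * Y k \<omega>)) \<le> 1"
      using S1 by (auto simp: norm_mult)
  qed measurable
  \<comment> \<open>After the inner integration the exponent in x is real again: -r^2 = \<sigma>
    restores the quadratic term of the positive case, so the same one-dimensional integral
    applies.\<close>
  also have "\<dots> = (CLINT x|?N. of_real ((tconst k * exp (- tilt \<sigma> Q k c c / 2)) * exp ((- r * p) * x + (\<sigma> * a) * x\<^sup>2 / 2)))"
  proof (intro Bochner_Integration.integral_cong refl)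
    fix x
    have "(CLINT \<omega>|M. S \<omega> * iexp (r * x * Y k \<omega>)) =
       (CLINT \<omega>|M. of_real (exp (\<sigma> / 2 * (\<Sum>i<k. (Y i \<omega>)\<^sup>2))) * iexp (\<Sum>i<n. (c i + (r * x) * ?e i) * Y i \<omega>))"
      unfolding sum_unitv[OF k] by (simp add: S_def mult.assoc exp_add distrib_left)
    also have "\<dots> = of_real (tconst k * exp (- tilt \<sigma> Q k (\<lambda>i. c i + (r * x) * ?e i) (\<lambda>i. c i + (r * x) * ?e i) / 2))"
      using Suc.prems by (intro Suc.IH) auto
    also have "- tilt \<sigma> Q k (\<lambda>i. c i + (r * x) * ?e i) (\<lambda>i. c i + (r * x) * ?e i) / 2 =
       - tilt \<sigma> Q k c c / 2 + ((- r * p) * x + (\<sigma> * a) * x\<^sup>2 / 2)"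
      unfolding symm_bilinear_add_scaled[OF symm_bilinear_tilt[OF Q]]
      by (simp add: a_def p_def power_mult_distrib r2 field_simps)
    finally show "(CLINT \<omega>|M. S \<omega> * iexp (r * x * Y k \<omega>)) =
      of_real ((tconst k * exp (- tilt \<sigma> Q k c c / 2)) * exp ((- r * p) * x + (\<sigma> * a) * x\<^sup>2 / 2))"
      by (simp only: exp_add mult.assoc)
  qed
  also have "\<dots> = of_real ((tconst k * exp (- tilt \<sigma> Q k c c / 2)) * (exp ((- r * p)\<^sup>2 / (2 * (1 - \<sigma> * a))) / sqrt (1 - \<sigma> * a)))"
    unfolding integral_complex_of_real integral_mult_right_zero integral_std_normal_distribution_exp[OF a] ..
  also have "\<dots> = of_real (tconst (Suc k) * exp (- tilt \<sigma> Q (Suc k) c c / 2))"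
  proof -
    have "- tilt \<sigma> Q (Suc k) c c / 2 = - tilt \<sigma> Q k c c / 2 + (- r * p)\<^sup>2 / (2 * (1 - \<sigma> * a))"

    proof -
      have "(- r * p)\<^sup>2 = - (\<sigma> * p * p)" using r2 by (simp add: power_mult_distrib) (simp add: power2_eq_square)
      then have "(- r * p)\<^sup>2 / (2 * (1 - \<sigma> * a)) = - (\<sigma> * p * p / (1 - \<sigma> * a)) / 2"
        by (simp only: minus_divide_left divide_divide_eq_left mult.commute)
      then show ?thesis by (simp only: tilt.simps a_def p_def add_divide_distrib minus_add_distrib minus_divide_left)
    qed
    then have "exp (- tilt \<sigma> Q (Suc k) c c / 2) = exp (- tilt \<sigma> Q k c c / 2) * exp ((- r * p)\<^sup>2 / (2 * (1 - \<sigma> * a)))"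
      by (simp only: exp_add)
    then show ?thesis unfolding tconst_Suc by (simp only: a_def times_divide_eq_left times_divide_eq_right mult.assoc)
  qed
  finally show ?case .
qed

lemma exp_moment:
  "(\<integral>\<^sup>+\<omega>. ennreal (exp (\<sigma> / 2 * (\<Sum>i<n. (Y i \<omega>)\<^sup>2))) \<partial>M) \<le>
    ennreal (exp (\<sigma> / 2 * (\<Sum>i<n. Q (unitv i) (unitv i)) + 3 * \<sigma>\<^sup>2 * b * (\<Sum>i<n. Q (unitv i) (unitv i))))"
proof -
  have "tilt \<sigma> Q n (\<lambda>_. 0) (\<lambda>_. 0) = 0"
    using symm_bilinear_quadratic[OF symm_bilinear_tilt[OF Q], of \<sigma> n 0 "\<lambda>_. 0" 0 "\<lambda>_. 0"] by simp
  then have t0: "exp (r * tilt \<sigma> Q n (\<lambda>_. 0) (\<lambda>_. 0) / 2) = 1" for r by simp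
  have "(\<integral>\<^sup>+\<omega>. ennreal (exp (\<sigma> / 2 * (\<Sum>i<n. (Y i \<omega>)\<^sup>2))) \<partial>M) \<le> ennreal (tconst n)"
  proof (cases "\<sigma> > 0")
    case True
    then show ?thesis using mgf_tilt[OF True order_refl, of "\<lambda>_. 0"] t0[of 1] by simp
  next
    case False
    show ?thesis
    proof (cases "\<sigma> = 0")
      case True
      then have "tconst n = 1" unfolding tconst_def by simp
      then show ?thesis using True by (simp add: emeasure_space_1)
    next
      case F: False
      with False have neg: "\<sigma> < 0" by simp
      have "complex_of_real (LINT \<omega>|M. exp (\<sigma> / 2 * (\<Sum>i<n. (Y i \<omega>)\<^sup>2))) = of_real (tconst n)"
        using cf_tilt[OF neg order_refl, of "\<lambda>_. 0"] t0[of "-1"] by simp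
      then have "(LINT \<omega>|M. exp (\<sigma> / 2 * (\<Sum>i<n. (Y i \<omega>)\<^sup>2))) = tconst n" by (simp only: of_real_eq_iff)
      moreover have "integrable M (\<lambda>\<omega>. exp (\<sigma> / 2 * (\<Sum>i<n. (Y i \<omega>)\<^sup>2)))"
        using neg by (intro integrable_const_bound[where B=1]) (auto simp: mult_nonpos_nonneg sum_nonneg)
      ultimately show ?thesis by (subst nn_integral_eq_integral) auto
    qed
  qed
  also have "\<dots> \<le> ennreal (exp (\<sigma> / 2 * (\<Sum>i<n. Q (unitv i) (unitv i)) + 3 * \<sigma>\<^sup>2 * b * (\<Sum>i<n. Q (unitv i) (unitv i))))"
    by (intro ennreal_leI tconst_le)
  finally show ?thesis .
qed

text \<open>Markov's inequality for the exponential moment. Multiplying the event by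
  \<open>\<sigma>\<close> puts both tails into one statement: positive \<open>\<sigma>\<close> gives
  the upper, negative \<open>\<sigma>\<close> the lower.\<close>

lemma tail_bound:
  defines "\<tau> \<equiv> \<Sum>i<n. Q (unitv i) (unitv i)"
  shows "prob {\<omega> \<in> space M. \<sigma> * (\<Sum>i<n. (Y i \<omega>)\<^sup>2) \<ge> \<sigma> * \<tau> + \<bar>\<sigma>\<bar> * d} \<le> exp (3 * \<sigma>\<^sup>2 * b * \<tau> - \<bar>\<sigma>\<bar> * d / 2)"
proof -
  let ?Z = "\<lambda>\<omega>. exp (\<sigma> / 2 * (\<Sum>i<n. (Y i \<omega>)\<^sup>2))"
  define v where "v = exp (\<sigma> / 2 * \<tau> + \<bar>\<sigma>\<bar> * d / 2)"
  have eq: "1 \<le> ennreal (1 / v) * ennreal (?Z \<omega>) \<longleftrightarrow> \<sigma> * \<tau> + \<bar>\<sigma>\<bar> * d \<le> \<sigma> * (\<Sum>i<n. (Y i \<omega>)\<^sup>2)" for \<omega>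
  proof -
    have "1 \<le> ennreal (1 / v) * ennreal (?Z \<omega>) \<longleftrightarrow> v \<le> ?Z \<omega>"
      by (subst ennreal_mult[symmetric]) (auto simp: v_def field_simps)
    also have "\<dots> \<longleftrightarrow> \<sigma> * \<tau> + \<bar>\<sigma>\<bar> * d \<le> \<sigma> * (\<Sum>i<n. (Y i \<omega>)\<^sup>2)"

    proof -
      have "\<sigma> / 2 * \<tau> + \<bar>\<sigma>\<bar> * d / 2 = (\<sigma> * \<tau> + \<bar>\<sigma>\<bar> * d) / 2" "\<sigma> / 2 * x = (\<sigma> * x) / 2" for x
        by (simp_all add: add_divide_distrib)
      then show ?thesis unfolding v_def by (simp only: exp_le_cancel_iff divide_le_cancel) simp
    qed
    finally show ?thesis .
  qed
  have "emeasure M {\<omega> \<in> space M. \<sigma> * (\<Sum>i<n. (Y i \<omega>)\<^sup>2) \<ge> \<sigma> * \<tau> + \<bar>\<sigma>\<bar> * d} =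
     emeasure M {\<omega> \<in> space M. 1 \<le> ennreal (1 / v) * ennreal (?Z \<omega>)}"
    unfolding eq ..
  also have "\<dots> \<le> ennreal (1 / v) * (\<integral>\<^sup>+\<omega>. ennreal (?Z \<omega>) * indicator (space M) \<omega> \<partial>M)"
    by (rule nn_integral_Markov_inequality) auto
  also have "(\<integral>\<^sup>+\<omega>. ennreal (?Z \<omega>) * indicator (space M) \<omega> \<partial>M) = (\<integral>\<^sup>+\<omega>. ennreal (?Z \<omega>) \<partial>M)"
    by (intro nn_integral_cong) auto
  also have "ennreal (1 / v) * \<dots> \<le> ennreal (1 / v) * ennreal (exp (\<sigma> / 2 * \<tau> + 3 * \<sigma>\<^sup>2 * b * \<tau>))"
    unfolding \<tau>_def by (intro mult_left_mono exp_moment) auto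
  also have "\<dots> = ennreal (exp (3 * \<sigma>\<^sup>2 * b * \<tau> - \<bar>\<sigma>\<bar> * d / 2))"

  proof -
    have "1 / v * exp (\<sigma> / 2 * \<tau> + 3 * \<sigma>\<^sup>2 * b * \<tau>) = exp ((\<sigma> / 2 * \<tau> + 3 * \<sigma>\<^sup>2 * b * \<tau>) - (\<sigma> / 2 * \<tau> + \<bar>\<sigma>\<bar> * d / 2))"
      unfolding v_def exp_diff by simp
    also have "\<dots> = exp (3 * \<sigma>\<^sup>2 * b * \<tau> - \<bar>\<sigma>\<bar> * d / 2)" by simp
    finally show ?thesis by (subst ennreal_mult[symmetric]) (auto simp: v_def)
  qed
  finally show ?thesis unfolding emeasure_eq_measure by (subst (asm) ennreal_le_iff) auto
qed

end

subsection \<open>Almost sure convergence for a fixed symbol\<close>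

lemma (in prob_space) distributed_std_normal_scale:
  assumes "distributed M lborel X (normal_density 0 s)" "s > 0"
  shows "(\<integral>\<^sup>+\<omega>. ennreal (exp (X \<omega>)) \<partial>M) = ennreal (exp (s\<^sup>2 / 2))"
    and "(CLINT \<omega>|M. iexp (X \<omega>)) = of_real (exp (- s\<^sup>2 / 2))"
    and "integrable M (\<lambda>\<omega>. (X \<omega>)\<^sup>2)" and "expectation (\<lambda>\<omega>. (X \<omega>)\<^sup>2) = s\<^sup>2"
proof -
  define Z where "Z = (\<lambda>\<omega>. X \<omega> / s)"
  have Z: "distributed M lborel Z std_normal_density"
    using assms normal_standard_normal_convert[of s X 0] by (simp add: Z_def)
  have [measurable]: "Z \<in> borel_measurable M" using Z by (simp add: distributed_def)
  have XZ: "X \<omega> = s * Z \<omega>" for \<omega> using assms by (simp add: Z_def)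
  have distr: "distr M lborel Z = std_normal_distribution"
    using Z by (simp add: distributed_def)
  have "(\<integral>\<^sup>+\<omega>. ennreal (exp (X \<omega>)) \<partial>M) = (\<integral>\<^sup>+x. ennreal (exp (s * x + 0 * x\<^sup>2 / 2)) \<partial>distr M lborel Z)"
    unfolding XZ by (subst nn_integral_distr) auto
  also have "\<dots> = ennreal (exp (s\<^sup>2 / 2))"
    unfolding distr by (subst nn_integral_std_normal_distribution_exp) auto
  finally show "(\<integral>\<^sup>+\<omega>. ennreal (exp (X \<omega>)) \<partial>M) = ennreal (exp (s\<^sup>2 / 2))" .
  have "(CLINT \<omega>|M. iexp (X \<omega>)) = (CLINT x|distr M lborel Z. iexp (s * x))"
    unfolding XZ by (subst integral_distr) auto
  also have "\<dots> = of_real (exp (- s\<^sup>2 / 2))" unfolding distr by (rule integral_std_normal_iexp)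
  finally show "(CLINT \<omega>|M. iexp (X \<omega>)) = of_real (exp (- s\<^sup>2 / 2))" .
  have "integrable lborel (\<lambda>x. std_normal_density x * x\<^sup>2)" by (rule integrable_std_normal_moment)
  then have i: "integrable M (\<lambda>\<omega>. (Z \<omega>)\<^sup>2)"
    using distributed_integrable[OF Z, of "\<lambda>x. x\<^sup>2"] by simp
  then show "integrable M (\<lambda>\<omega>. (X \<omega>)\<^sup>2)" unfolding XZ power_mult_distrib by (rule integrable_mult_right)
  have "(LINT x|lborel. std_normal_density x * x\<^sup>2) = 1"
    using integral_std_normal_moment_even[of 1] by (simp add: fact_numeral)
  then have "expectation (\<lambda>\<omega>. (Z \<omega>)\<^sup>2) = 1"
    using distributed_integral[OF Z, of "\<lambda>x. x\<^sup>2"] by simp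
  then show "expectation (\<lambda>\<omega>. (X \<omega>)\<^sup>2) = s\<^sup>2" unfolding XZ power_mult_distrib by simp
qed

text \<open>The standard deviation supplied by the definition is eliminated in favour of the second
  moment. A degenerate combination has no density and is treated as almost surely zero.\<close>

lemma (in prob_space) centred_gaussian_lin:
  fixes X :: "'a \<Rightarrow> nat \<Rightarrow> real"
  assumes X: "centred_gaussian_vector M n X"
  defines "L \<equiv> \<lambda>c \<omega>. \<Sum>i<n. c i * X \<omega> i"
  shows "integrable M (\<lambda>\<omega>. (L c \<omega>)\<^sup>2)"
    and "(\<integral>\<^sup>+\<omega>. ennreal (exp (L c \<omega>)) \<partial>M) = ennreal (exp (expectation (\<lambda>\<omega>. (L c \<omega>)\<^sup>2) / 2))"
    and "(CLINT \<omega>|M. iexp (L c \<omega>)) = of_real (exp (- expectation (\<lambda>\<omega>. (L c \<omega>)\<^sup>2) / 2))"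
proof -
  have [measurable]: "L c \<in> borel_measurable M"
    using X unfolding L_def centred_gaussian_vector_def by (intro borel_measurable_sum borel_measurable_times) auto
  have "\<exists>\<sigma>\<ge>0. (\<sigma> = 0 \<longrightarrow> (AE \<omega> in M. L c \<omega> = 0)) \<and>
      (\<sigma> > 0 \<longrightarrow> distributed M lborel (L c) (normal_density 0 \<sigma>))"
    using X unfolding centred_gaussian_vector_def L_def by (elim conjE) (drule spec[of _ c], assumption)
  then obtain s where s: "s \<ge> 0" "s = 0 \<Longrightarrow> AE \<omega> in M. L c \<omega> = 0"
    "s > 0 \<Longrightarrow> distributed M lborel (L c) (normal_density 0 s)"
    by auto
  have "integrable M (\<lambda>\<omega>. (L c \<omega>)\<^sup>2) \<and>
    (\<integral>\<^sup>+\<omega>. ennreal (exp (L c \<omega>)) \<partial>M) = ennreal (exp (expectation (\<lambda>\<omega>. (L c \<omega>)\<^sup>2) / 2)) \<and>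
    (CLINT \<omega>|M. iexp (L c \<omega>)) = of_real (exp (- expectation (\<lambda>\<omega>. (L c \<omega>)\<^sup>2) / 2))"
  proof (cases "s = 0")
    case True
    note ae = s(2)[OF True]
    have "integrable M (\<lambda>\<omega>. (L c \<omega>)\<^sup>2) \<longleftrightarrow> integrable M (\<lambda>\<omega>. 0 :: real)"
      using ae by (intro integrable_cong_AE) auto
    moreover have "expectation (\<lambda>\<omega>. (L c \<omega>)\<^sup>2) = expectation (\<lambda>\<omega>. 0)"
      using ae by (intro integral_cong_AE) auto
    moreover have "(\<integral>\<^sup>+\<omega>. ennreal (exp (L c \<omega>)) \<partial>M) = (\<integral>\<^sup>+\<omega>. 1 \<partial>M)"
      using ae by (intro nn_integral_cong_AE) auto
    moreover have "(CLINT \<omega>|M. iexp (L c \<omega>)) = (CLINT \<omega>|M. 1)"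
      using ae by (intro integral_cong_AE) auto
    ultimately show ?thesis by (simp add: emeasure_space_1 prob_space)
  next
    case False
    with s(1) have "s > 0" by simp
    from distributed_std_normal_scale[OF s(3)[OF this] this] show ?thesis by simp
  qed
  then show "integrable M (\<lambda>\<omega>. (L c \<omega>)\<^sup>2)"
    and "(\<integral>\<^sup>+\<omega>. ennreal (exp (L c \<omega>)) \<partial>M) = ennreal (exp (expectation (\<lambda>\<omega>. (L c \<omega>)\<^sup>2) / 2))"
    and "(CLINT \<omega>|M. iexp (L c \<omega>)) = of_real (exp (- expectation (\<lambda>\<omega>. (L c \<omega>)\<^sup>2) / 2))"
    by auto
qed

lemma (in prob_space) normal_vector_lin:
  fixes X :: "'a \<Rightarrow> nat \<Rightarrow> real"
  assumes X: "normal_vector M n (toeplitz n f') X"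
    and f: "integrable circ_measure f" "\<And>t. f (-t) = f t" "\<And>t. -pi < t \<Longrightarrow> t < pi \<Longrightarrow> f' t = f t"
  shows "(\<integral>\<^sup>+\<omega>. ennreal (exp (\<Sum>i<n. c i * X \<omega> i)) \<partial>M) = ennreal (exp (tform f n c c / 2))"
    and "(CLINT \<omega>|M. iexp (\<Sum>i<n. c i * X \<omega> i)) = of_real (exp (- tform f n c c / 2))"
proof -
  have G: "centred_gaussian_vector M n X" using X by (simp add: normal_vector_def)
  have cov: "expectation (\<lambda>\<omega>. X \<omega> i * X \<omega> j) = cos_coeff f (int i - int j)" if "i < n" "j < n" for i j
  proof -
    have "complex_of_real (expectation (\<lambda>\<omega>. X \<omega> i * X \<omega> j)) = of_real (cos_coeff f (int i - int j))"
      using X that by (simp add: normal_vector_def toeplitz_def fourier_coeff_eq_cos_coeff[OF f])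
    then show ?thesis by (simp only: of_real_eq_iff)
  qed
  have meas: "(\<lambda>\<omega>. X \<omega> i) \<in> borel_measurable M" if "i < n" for i
    using G that by (simp add: centred_gaussian_vector_def)
  have sq: "integrable M (\<lambda>\<omega>. (X \<omega> i)\<^sup>2)" if "i < n" for i
  proof -
    have "(\<Sum>j<n. unitv i j * X \<omega> j) = X \<omega> i" for \<omega>
      using that by (simp add: unitv_def if_distrib if_distribR cong: if_cong)
    then show ?thesis using centred_gaussian_lin(1)[OF G, of "unitv i"] by simp
  qed
  \<comment> \<open>The covariances are given as Bochner integrals, which say nothing unless the
    products are integrable; this must be known before the square of a linear combination is
    expanded.\<close>
  have prod: "integrable M (\<lambda>\<omega>. X \<omega> i * X \<omega> j)" if "i < n" "j < n" for i j
  proof (rule Bochner_Integration.integrable_bound)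
    show "integrable M (\<lambda>\<omega>. (X \<omega> i)\<^sup>2 + (X \<omega> j)\<^sup>2)" using sq that by auto
    show "(\<lambda>\<omega>. X \<omega> i * X \<omega> j) \<in> borel_measurable M" using meas that by auto
    have "\<bar>x * y\<bar> \<le> x\<^sup>2 + y\<^sup>2" for x y :: real
      using sum_squares_bound[of "\<bar>x\<bar>" "\<bar>y\<bar>"] mult_nonneg_nonneg[OF abs_ge_zero abs_ge_zero, of x y]
      unfolding abs_mult power2_abs mult.assoc by linarith
    then show "AE \<omega> in M. norm (X \<omega> i * X \<omega> j) \<le> norm ((X \<omega> i)\<^sup>2 + (X \<omega> j)\<^sup>2)" by simp
  qed
  have "expectation (\<lambda>\<omega>. (\<Sum>i<n. c i * X \<omega> i)\<^sup>2) = expectation (\<lambda>\<omega>. \<Sum>i<n. \<Sum>j<n. (c i * c j) * (X \<omega> i * X \<omega> j))"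
    unfolding power2_eq_square sum_product by (simp add: mult_ac)
  also have "\<dots> = (\<Sum>i<n. \<Sum>j<n. (c i * c j) * expectation (\<lambda>\<omega>. X \<omega> i * X \<omega> j))"
  proof -
    have "expectation (\<lambda>\<omega>. \<Sum>i<n. \<Sum>j<n. (c i * c j) * (X \<omega> i * X \<omega> j)) =
      (\<Sum>i<n. expectation (\<lambda>\<omega>. \<Sum>j<n. (c i * c j) * (X \<omega> i * X \<omega> j)))"
      by (intro Bochner_Integration.integral_sum Bochner_Integration.integrable_sum integrable_mult_right prod) auto
    also have "\<dots> = (\<Sum>i<n. \<Sum>j<n. expectation (\<lambda>\<omega>. (c i * c j) * (X \<omega> i * X \<omega> j)))"
      by (rule sum.cong[OF refl], intro Bochner_Integration.integral_sum integrable_mult_right prod) auto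
    finally show ?thesis by simp
  qed
  also have "\<dots> = tform f n c c" unfolding tform_def by (intro sum.cong refl) (simp add: cov)
  finally have v: "expectation (\<lambda>\<omega>. (\<Sum>i<n. c i * X \<omega> i)\<^sup>2) = tform f n c c" .
  show "(\<integral>\<^sup>+\<omega>. ennreal (exp (\<Sum>i<n. c i * X \<omega> i)) \<partial>M) = ennreal (exp (tform f n c c / 2))"
    using centred_gaussian_lin(2)[OF G, of c] unfolding v .
  show "(CLINT \<omega>|M. iexp (\<Sum>i<n. c i * X \<omega> i)) = of_real (exp (- tform f n c c / 2))"
    using centred_gaussian_lin(3)[OF G, of c] unfolding v .
qed

lemma summable_exp_powr:
  fixes k d :: real
  assumes "k > 0" "d > 0"
  shows "summable (\<lambda>n. exp (- k * real n powr d))"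
proof (rule summable_comparison_test_ev)
  have "(\<lambda>n. real n ^ 2 * exp (- k * real n powr d)) \<longlonglongrightarrow> 0" using assms by real_asymp
  then have "\<forall>\<^sub>F n in sequentially. real n ^ 2 * exp (- k * real n powr d) < 1" by (rule order_tendstoD) simp
  then show "\<forall>\<^sub>F n in sequentially. norm (exp (- k * real n powr d)) \<le> inverse (real n ^ 2)"
    using eventually_gt_at_top[of 0] by eventually_elim (simp add: field_simps)
  show "summable (\<lambda>n. inverse (real n ^ 2))" by (rule inverse_power_summable) simp
qed

section \<open>Concentration of the quadratic form and Borel-Cantelli\<close>

context symbol_pair begin

lemma symm_bilinear_tform_comb:
  "symm_bilinear (\<lambda>c d. tform f n (\<lambda>j. \<Sum>i<n. c i * w i j) (\<lambda>j. \<Sum>i<n. d i * w i j))"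
proof -
  have "(\<lambda>j. \<Sum>i<n. (x i + y i) * w i j) = (\<lambda>j. (\<Sum>i<n. x i * w i j) + (\<Sum>i<n. y i * w i j))" for x y
    by (simp add: distrib_right sum.distrib)
  moreover have "(\<lambda>j. \<Sum>i<n. (r * x i) * w i j) = (\<lambda>j. r * (\<Sum>i<n. x i * w i j))" for r x
    by (simp add: sum_distrib_left mult_ac)
  ultimately show ?thesis
    unfolding symm_bilinear_def by (auto simp: tform_add_left tform_scale_left intro: tform_commute)
qed

text \<open>The coordinates of W^T X form a Gaussian family whose covariance form is that of W^T
  T_n(f) W, with norm bounded by \<open>tform_comb_le\<close>. Adding 1 to \<open>form_const\<close>
  keeps the bound strictly positive, as \<open>bounded_form\<close> demands.\<close>

lemma quadratic_tail:
  assumes M: "prob_space M" and X: "normal_vector M n (toeplitz n f') X"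
    and f': "\<And>t. -pi < t \<Longrightarrow> t < pi \<Longrightarrow> f' t = f t"
    and w: "tform_orthonormal g n w" and n: "n \<ge> 1"
    and s: "\<bar>s\<bar> * ((form_const + 1) * n powr (a + b)) \<le> 1 / 3"
  defines "S \<equiv> \<lambda>\<omega>. \<Sum>i<n. (\<Sum>j<n. w i j * X \<omega> j)\<^sup>2" and "\<tau> \<equiv> \<Sum>i<n. tform f n (w i) (w i)"
  shows "measure M {\<omega> \<in> space M. s * S \<omega> \<ge> s * \<tau> + \<bar>s\<bar> * d} \<le>
    exp (3 * s\<^sup>2 * ((form_const + 1) * n powr (a + b)) * \<tau> - \<bar>s\<bar> * d / 2)"
proof -
  interpret prob_space M by fact
  let ?Q = "\<lambda>c d. tform f n (\<lambda>j. \<Sum>i<n. c i * w i j) (\<lambda>j. \<Sum>i<n. d i * w i j)"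
  define Y where "Y = (\<lambda>i \<omega>. \<Sum>j<n. w i j * X \<omega> j)"
  have form_const: "form_const \<ge> 0" using AB ab christoffel_const_nonneg by (simp add: form_const_def)
  have Ysum: "(\<Sum>i<n. c i * Y i \<omega>) = (\<Sum>j<n. (\<Sum>i<n. c i * w i j) * X \<omega> j)" for c \<omega>
    unfolding Y_def sum_distrib_left sum_distrib_right by (subst sum.swap) (simp add: mult_ac)
  interpret gaussian_family M n ?Q "(form_const + 1) * n powr (a + b)" s Y
  proof
    show "symm_bilinear ?Q" by (rule symm_bilinear_tform_comb)
    show "0 \<le> ?Q x x" for x unfolding tform_eq_integral[OF f_int f_even]
      by (rule integral_nonneg_AE) (simp add: f_nonneg)
    show "?Q x x \<le> (form_const + 1) * n powr (a + b) * (\<Sum>i<n. (x i)\<^sup>2)" for x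
    proof (rule order_trans[OF tform_comb_le[OF w n]])
      show "form_const * n powr (a + b) * (\<Sum>i<n. (x i)\<^sup>2) \<le> (form_const + 1) * n powr (a + b) * (\<Sum>i<n. (x i)\<^sup>2)"
        by (intro mult_right_mono) (auto simp: sum_nonneg)
    qed
    show "0 < (form_const + 1) * n powr (a + b)" using form_const n by simp
    show "\<bar>s\<bar> * ((form_const + 1) * n powr (a + b)) \<le> 1 / 3" by (rule s)
    show "Y i \<in> borel_measurable M" for i
      using X unfolding Y_def normal_vector_def centred_gaussian_vector_def
      by (intro borel_measurable_sum borel_measurable_times) auto
    show "(\<integral>\<^sup>+\<omega>. ennreal (exp (\<Sum>i<n. c i * Y i \<omega>)) \<partial>M) = ennreal (exp (?Q c c / 2))" for c
      unfolding Ysum by (rule normal_vector_lin[OF X f_int f_even f'])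
    show "(CLINT \<omega>|M. iexp (\<Sum>i<n. c i * Y i \<omega>)) = of_real (exp (- ?Q c c / 2))" for c
      unfolding Ysum by (rule normal_vector_lin[OF X f_int f_even f'])
  qed
  have "?Q (unitv i) (unitv i) = tform f n (w i) (w i)" if "i < n" for i
  proof -
    have "(\<Sum>k<n. unitv i k * w k j) = w i j" for j
      using that by (simp add: unitv_def if_distrib if_distribR cong: if_cong)
    then show ?thesis by simp
  qed
  then have "(\<Sum>i<n. ?Q (unitv i) (unitv i)) = \<tau>" unfolding \<tau>_def by (intro sum.cong) auto
  then show ?thesis using tail_bound[of d] by (simp add: S_def Y_def)
qed

theorem quadratic_form_AE_tendsto:
  assumes M: "prob_space M" and X: "\<And>n. n \<ge> 1 \<Longrightarrow> normal_vector M n (toeplitz n f') (\<xi> n)"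
    and f': "\<And>t. -pi < t \<Longrightarrow> t < pi \<Longrightarrow> f' t = f t"
    and w: "\<And>n. tform_orthonormal g n (w n)"
  shows "AE \<omega> in M. (\<lambda>n. (\<Sum>i<n. (\<Sum>j<n. w n i j * \<xi> n \<omega> j)\<^sup>2) / n) \<longlonglongrightarrow> (LINT t|circ_measure. f t / g t)"
proof -
  interpret prob_space M by fact
  define S where "S = (\<lambda>n \<omega>. \<Sum>i<n. (\<Sum>j<n. w n i j * \<xi> n \<omega> j)\<^sup>2)"
  define \<tau> where "\<tau> = (\<lambda>n. \<Sum>i<n. tform f n (w n i) (w n i))"
  have lim: "(\<lambda>n. \<tau> n / n) \<longlonglongrightarrow> (LINT t|circ_measure. f t / g t)"
    unfolding \<tau>_def by (rule trace_tendsto[OF w])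
  then have "Bseq (\<lambda>n. \<tau> n / n)" by (intro convergent_imp_Bseq convergentI)
  then obtain C where C: "C > 0" "\<And>n. \<bar>\<tau> n / n\<bar> \<le> C" by (auto simp: Bseq_def)
  have \<tau>_le: "\<tau> n \<le> C * n" if "n \<ge> 1" for n using C(2)[of n] that by (simp add: field_simps)
  define D where "D = form_const + 1"
  have D: "D > 0" using AB ab christoffel_const_nonneg by (simp add: D_def form_const_def add_nonneg_pos)
  have S_meas: "S n \<in> borel_measurable M" for n
  proof (cases "n \<ge> 1")
    case True
    then show ?thesis
      using X[of n] unfolding S_def normal_vector_def centred_gaussian_vector_def
      by (intro borel_measurable_sum borel_measurable_power borel_measurable_times) auto
  qed (simp add: S_def)
  have dev: "AE \<omega> in M. \<forall>\<^sub>F n in sequentially. \<bar>S n \<omega> - \<tau> n\<bar> < e * n" if e: "e > 0" for e :: real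
  proof -
    \<comment> \<open>The first bound makes the Chernoff parameter admissible. The second makes the
      quadratic term, of size at most 3 h D C s n, no more than half of the linear gain e s n /
      2.\<close>
    define h where "h = min (1 / (3 * D)) (e / (12 * C * D))"
    have h: "h > 0" "h * D \<le> 1 / 3" "3 * h * D * C \<le> e / 4"
      using C(1) D e by (auto simp: h_def min_def field_simps)
    define A where "A = (\<lambda>n. {\<omega> \<in> space M. \<bar>S n \<omega> - \<tau> n\<bar> \<ge> e * n})"
    have [measurable]: "A n \<in> sets M" for n unfolding A_def using S_meas[of n] by measurable
    have bound: "prob (A n) \<le> 2 * exp (- (h * e / 4) * real n powr (1 - (a + b)))" if n: "n \<ge> 1" for n
    proof -
      \<comment> \<open>The parameter is the reciprocal of the norm bound up to a constant, so
        \<sigma> b stays bounded while s n grows like n^(1 - (a + b)).\<close>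
      define s where "s = h * real n powr (- (a + b))"
      have s: "s > 0" using h n by (simp add: s_def)
      have sn: "s * (D * n powr (a + b)) = h * D" 
      proof -
        have "s * (D * n powr (a + b)) = h * D * (real n powr (- (a + b)) * real n powr (a + b))"
          by (simp only: s_def mult_ac)
        also have "real n powr (- (a + b)) * real n powr (a + b) = 1"
          using n by (simp only: powr_add[symmetric]) simp
        finally show ?thesis by simp
      qed
      have one: "measure M {\<omega> \<in> space M. r * S n \<omega> \<ge> r * \<tau> n + \<bar>r\<bar> * (e * n)} \<le> exp (- (h * e / 4) * real n powr (1 - (a + b)))"
        if r: "\<bar>r\<bar> = s" for r
      proof -
        have "\<bar>r\<bar> * ((form_const + 1) * n powr (a + b)) \<le> 1 / 3"
          using sn h(2) unfolding r[symmetric] D_def by linarith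
        then have "measure M {\<omega> \<in> space M. r * S n \<omega> \<ge> r * \<tau> n + \<bar>r\<bar> * (e * n)} \<le> exp (3 * r\<^sup>2 * (D * n powr (a + b)) * \<tau> n - \<bar>r\<bar> * (e * n) / 2)"
          unfolding S_def \<tau>_def D_def using n
          by (intro quadratic_tail[OF M X f' w]) auto
        also have "3 * r\<^sup>2 * (D * n powr (a + b)) * \<tau> n = 3 * s * (h * D) * \<tau> n"

        proof -
          have "r\<^sup>2 = s\<^sup>2" using r by (metis power2_abs)
          then show ?thesis unfolding sn[symmetric] by (simp add: power2_eq_square)
        qed
        also have "\<dots> - \<bar>r\<bar> * (e * n) / 2 \<le> - (h * e / 4) * real n powr (1 - (a + b))"
        proof -
          have "3 * s * (h * D) * \<tau> n \<le> 3 * s * (h * D) * (C * n)"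
            using s h D by (intro mult_left_mono \<tau>_le n) auto
          also have "\<dots> = (3 * h * D * C) * (s * n)" by (simp add: mult_ac)
          also have "\<dots> \<le> (e / 4) * (s * n)" using s by (intro mult_right_mono h) auto
          finally have "3 * s * (h * D) * \<tau> n \<le> (e / 4) * (s * n)" .
          moreover have "\<bar>r\<bar> * (e * n) / 2 = 2 * ((e / 4) * (s * n))" using r by simp
          ultimately have "3 * s * (h * D) * \<tau> n - \<bar>r\<bar> * (e * n) / 2 \<le> - (e / 4) * (s * n)" by linarith
          also have "s * n = h * real n powr (1 - (a + b))"
            using powr_mult_base[of "real n" "- (a + b)"] by (simp add: s_def mult_ac diff_diff_eq[symmetric] add_diff_eq)
          finally show ?thesis by (simp add: mult_ac)
        qed
        finally show ?thesis by simp
      qed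
      define E where "E r = {\<omega> \<in> space M. r * S n \<omega> \<ge> r * \<tau> n + \<bar>r\<bar> * (e * n)}" for r
      have E: "E r \<in> sets M" for r unfolding E_def using S_meas[of n] by measurable
      have "A n \<subseteq> E s \<union> E (- s)"
      proof
        fix \<omega> assume "\<omega> \<in> A n"
        then have \<omega>: "\<omega> \<in> space M" and "S n \<omega> \<ge> \<tau> n + e * n \<or> - S n \<omega> \<ge> - \<tau> n + e * n" by (auto simp: A_def abs_if split: if_splits)
        then have "s * S n \<omega> \<ge> s * (\<tau> n + e * n) \<or> s * (- S n \<omega>) \<ge> s * (- \<tau> n + e * n)"
          using s by (meson mult_left_mono less_imp_le)
        then show "\<omega> \<in> E s \<union> E (- s)"
          using \<omega> s by (auto simp: E_def algebra_simps)
      qed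
      then have "prob (A n) \<le> prob (E s \<union> E (- s))"
        by (intro finite_measure_mono sets.Un E)
      also have "\<dots> \<le> prob (E s) + prob (E (- s))"
        by (intro measure_Un_le E)
      also have "\<dots> \<le> 2 * exp (- (h * e / 4) * real n powr (1 - (a + b)))"
        using one[of s] one[of "- s"] s by (simp add: E_def)
      finally show ?thesis .
    qed
    have "summable (\<lambda>n. prob (A n))"
    proof (rule summable_comparison_test_ev)
      show "\<forall>\<^sub>F n in sequentially. norm (prob (A n)) \<le> 2 * exp (- (h * e / 4) * real n powr (1 - (a + b)))"
        using eventually_ge_at_top[of 1] by eventually_elim (use bound in auto)
      show "summable (\<lambda>n. 2 * exp (- (h * e / 4) * real n powr (1 - (a + b))))"
        using h(1) e ab by (intro summable_mult summable_exp_powr) auto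
    qed
    then have "AE \<omega> in M. \<forall>\<^sub>F n in sequentially. \<omega> \<in> space M - A n"
      by (intro borel_cantelli_AE1) (auto simp: emeasure_eq_measure)
    then show ?thesis
    proof eventually_elim
      case (elim \<omega>)
      then show ?case by eventually_elim (auto simp: A_def)
    qed
  qed
  \<comment> \<open>Countably many tolerances, so that one null set serves all of them.\<close>
  have "AE \<omega> in M. \<forall>m. \<forall>\<^sub>F n in sequentially. \<bar>S n \<omega> - \<tau> n\<bar> < 1 / real (Suc m) * n"
    unfolding AE_all_countable by (intro allI dev) simp
  then show ?thesis
  proof eventually_elim
    case (elim \<omega>)
    have "(\<lambda>n. S n \<omega> / n - \<tau> n / n) \<longlonglongrightarrow> 0"
    proof (rule tendstoI)
      fix e :: real assume "e > 0"
      then obtain m where m: "1 / real (Suc m) < e" using nat_approx_posE by metis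
      show "\<forall>\<^sub>F n in sequentially. dist (S n \<omega> / n - \<tau> n / n) 0 < e"
        using elim[rule_format, of m] eventually_ge_at_top[of 1]
      proof eventually_elim
        case (elim n)
        have "\<bar>S n \<omega> / n - \<tau> n / n\<bar> = \<bar>S n \<omega> - \<tau> n\<bar> / n" using elim by (simp add: diff_divide_distrib[symmetric])
        also have "\<dots> < 1 / real (Suc m)" using elim by (simp add: divide_simps)
        finally show ?case using m by (simp add: dist_real_def)
      qed
    qed
    from tendsto_add[OF this lim] show ?case by (simp add: S_def)
  qed
qed

end

subsection \<open>The spectral density of fractional Gaussian noise\<close>

text \<open>The aliasing terms. They stay regular through the origin, so the whole singularity sits
  in the omitted term k = 0.\<close>

definition fgn_tail :: "real \<Rightarrow> real \<Rightarrow> real" where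
  "fgn_tail u x = (\<Sum>\<^sub>\<infinity>k\<in>-{0::int}. \<bar>x - 2 * pi * real_of_int k\<bar> powr (-(2 * u + 1)))"

text \<open>A summable majorant for all x in [-pi, pi] and all parameters from \<open>a\<close> on:
  |x - 2 pi k| is at least pi |k|, and as this is at least 1, the smallest parameter gives the
  largest term.\<close>

definition tail_bound_term :: "real \<Rightarrow> int \<Rightarrow> real" where
  "tail_bound_term a k = (pi * \<bar>real_of_int k\<bar>) powr (-(2 * a + 1))"

lemma tail_bound_term_summable:
  assumes "a > 0"
  shows "tail_bound_term a summable_on -{0}"
proof -
  have "summable (\<lambda>n. real n powr (-(2 * a + 1)))"
    using assms by (subst summable_real_powr_iff) auto
  then have "(\<lambda>n::nat. real n powr (-(2 * a + 1))) summable_on UNIV"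
    by (intro norm_summable_imp_summable_on) simp
  then have nat: "(\<lambda>n::nat. pi powr (-(2 * a + 1)) * real n powr (-(2 * a + 1))) summable_on UNIV"
    by (rule summable_on_cmult_right)
  have "tail_bound_term a summable_on range int"
    by (subst summable_on_reindex) (use nat in \<open>auto simp: tail_bound_term_def o_def powr_mult inj_on_def\<close>)
  moreover have "tail_bound_term a summable_on range (\<lambda>n. - int n)"
    by (subst summable_on_reindex) (use nat in \<open>auto simp: tail_bound_term_def o_def powr_mult inj_on_def\<close>)
  ultimately have "tail_bound_term a summable_on (range int \<union> range (\<lambda>n. - int n))" by (rule summable_on_union)
  moreover have "k \<in> range int \<union> range (\<lambda>n. - int n)" for k
    by (cases k rule: int_cases2) auto
  then have "-{0} \<subseteq> range int \<union> range (\<lambda>n. - int n)" by blast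
  ultimately show ?thesis by (rule summable_on_subset)
qed

lemma tail_dist_ge:
  assumes "\<bar>x\<bar> \<le> pi" "k \<noteq> 0"
  shows "pi * \<bar>real_of_int k\<bar> \<le> \<bar>x - 2 * pi * real_of_int k\<bar>" "1 \<le> pi * \<bar>real_of_int k\<bar>"
proof -
  have k: "1 \<le> \<bar>real_of_int k\<bar>" using assms(2) by linarith
  then have pk: "pi \<le> pi * \<bar>real_of_int k\<bar>" using pi_gt_zero by simp
  then show "1 \<le> pi * \<bar>real_of_int k\<bar>" using pi_gt3 by linarith
  have "\<bar>2 * pi * real_of_int k\<bar> = 2 * (pi * \<bar>real_of_int k\<bar>)" by (simp add: abs_mult)
  then show "pi * \<bar>real_of_int k\<bar> \<le> \<bar>x - 2 * pi * real_of_int k\<bar>"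
    using assms(1) pk by linarith
qed

lemma tail_term_le:
  assumes "0 < a" "a \<le> u" "\<bar>x\<bar> \<le> pi" "k \<noteq> 0"
  shows "\<bar>x - 2 * pi * real_of_int k\<bar> powr (-(2 * u + 1)) \<le> tail_bound_term a k"
proof -
  note d = tail_dist_ge[OF assms(3,4)]
  have "\<bar>x - 2 * pi * real_of_int k\<bar> powr (-(2 * u + 1)) \<le> (pi * \<bar>real_of_int k\<bar>) powr (-(2 * u + 1))"
    using d assms by (intro powr_mono2') auto
  also have "\<dots> \<le> tail_bound_term a k" unfolding tail_bound_term_def
    using d assms by (intro powr_mono) auto
  finally show ?thesis .
qed

lemma tail_summable:
  assumes "0 < u" "\<bar>x\<bar> \<le> pi"
  shows "(\<lambda>k. \<bar>x - 2 * pi * real_of_int k\<bar> powr (-(2 * u + 1))) summable_on -{0}"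
  using tail_term_le[OF assms(1) order_refl assms(2)]
  by (intro summable_on_comparison_test[OF tail_bound_term_summable[OF assms(1)]]) auto

lemma fgn_tail_nonneg: "0 \<le> fgn_tail u x"
  unfolding fgn_tail_def by (intro infsum_nonneg) simp

lemma fgn_tail_le:
  assumes "0 < a" "a \<le> u" "\<bar>x\<bar> \<le> pi"
  shows "fgn_tail u x \<le> infsum (tail_bound_term a) (-{0})"
  unfolding fgn_tail_def
  using assms tail_term_le[OF assms] by (intro infsum_mono tail_summable tail_bound_term_summable) auto

text \<open>Weierstrass M-test on the closed rectangle. Joint continuity there later gives uniform
  continuity in the parameter, uniformly in x.\<close>

lemma continuous_on_fgn_tail:
  assumes "0 < a"
  shows "continuous_on ({a..b} \<times> {-pi..pi}) (\<lambda>(u, x). fgn_tail u x)"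
proof (rule uniform_limit_theorem)
  let ?f = "\<lambda>k (u, x). \<bar>x - 2 * pi * real_of_int k\<bar> powr (-(2 * u + 1))"
  have eq: "(\<lambda>p. \<Sum>\<^sub>\<infinity>k\<in>-{0}. ?f k p) = (\<lambda>(u, x). fgn_tail u x)"
    by (auto simp: fgn_tail_def)
  show "uniform_limit ({a..b} \<times> {-pi..pi}) (\<lambda>X p. \<Sum>k\<in>X. ?f k p) (\<lambda>(u, x). fgn_tail u x) (finite_subsets_at_top (-{0}))"
    unfolding eq[symmetric]
  proof (rule Weierstrass_m_test_general[where M="tail_bound_term a"])
    show "norm (?f k p) \<le> tail_bound_term a k" if "k \<in> -{0}" "p \<in> {a..b} \<times> {-pi..pi}" for k p
      using tail_term_le[of a "fst p" "snd p" k] that assms by (cases p) (auto simp: abs_le_iff)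
  qed (rule tail_bound_term_summable[OF assms])
  show "\<forall>\<^sub>F X in finite_subsets_at_top (-{0::int}). continuous_on ({a..b} \<times> {-pi..pi}) (\<lambda>p. \<Sum>k\<in>X. ?f k p)"
  proof (rule eventually_finite_subsets_at_top_weakI)
    fix X :: "int set" assume X: "finite X" "X \<subseteq> -{0}"
    have "continuous_on ({a..b} \<times> {-pi..pi}) (?f k)" if "k \<in> X" for k
    proof -
      have "k \<noteq> 0" using that X by auto
      have nz: "\<bar>x - 2 * pi * real_of_int k\<bar> \<noteq> 0" if "x \<in> {-pi..pi}" for x
      proof -
        have "\<bar>x\<bar> \<le> pi" using that by (auto simp: abs_le_iff)
        from tail_dist_ge[OF this \<open>k \<noteq> 0\<close>] show ?thesis by linarith
      qed
      have "continuous_on ({a..b} \<times> {-pi..pi}) (\<lambda>p. \<bar>snd p - 2 * pi * real_of_int k\<bar> powr (-(2 * fst p + 1)))"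
        using nz by (intro continuous_intros) auto
      then show ?thesis by (simp add: case_prod_beta)
    qed
    then show "continuous_on ({a..b} \<times> {-pi..pi}) (\<lambda>p. \<Sum>k\<in>X. ?f k p)" by (rule continuous_on_sum)
  qed
qed simp

section \<open>Positivity, power bounds and continuity of the spectral shape\<close>

lemma fgn_shape_eq:
  assumes "0 < u" "\<bar>x\<bar> \<le> pi"
  shows "fgn_shape u x = (norm (1 - cis x))\<^sup>2 * (\<bar>x\<bar> powr (-(2 * u + 1)) + fgn_tail u x)"
proof -
  let ?f = "\<lambda>k. \<bar>x - 2 * pi * real_of_int k\<bar> powr (-(2 * u + 1))"
  have "infsum ?f (insert 0 (-{0})) = ?f 0 + infsum ?f (-{0})"
    by (rule infsum_insert[OF tail_summable[OF assms]]) simp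
  moreover have "insert 0 (-{0::int}) = UNIV" by auto
  moreover have "norm (exp (\<i> * complex_of_real x) - 1) = norm (1 - cis x)"
    by (simp add: cis_conv_exp norm_minus_commute)
  ultimately show ?thesis by (simp add: fgn_shape_def fgn_tail_def)
qed

lemma fgn_shape_nonneg: "0 \<le> fgn_shape u x"
  unfolding fgn_shape_def by (intro mult_nonneg_nonneg infsum_nonneg) auto

lemma fgn_shape_even: "fgn_shape u (-x) = fgn_shape u x"
proof -
  have "(\<Sum>\<^sub>\<infinity>k::int. \<bar>- x - 2 * pi * real_of_int k\<bar> powr (-(2 * u + 1))) =
    (\<Sum>\<^sub>\<infinity>k::int. \<bar>- x - 2 * pi * real_of_int (- k)\<bar> powr (-(2 * u + 1)))"
    by (rule infsum_reindex_bij_betw[symmetric, where g=uminus]) (auto intro!: bij_betwI[where g=uminus])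
  also have "\<dots> = (\<Sum>\<^sub>\<infinity>k::int. \<bar>x - 2 * pi * real_of_int k\<bar> powr (-(2 * u + 1)))"
  proof -
    have "\<bar>- x - 2 * pi * real_of_int (- k)\<bar> = \<bar>x - 2 * pi * real_of_int k\<bar>" for k by (simp add: abs_minus_commute)
    then show ?thesis by simp
  qed
  finally have s: "(\<Sum>\<^sub>\<infinity>k::int. \<bar>- x - 2 * pi * real_of_int k\<bar> powr (-(2 * u + 1))) = (\<Sum>\<^sub>\<infinity>k::int. \<bar>x - 2 * pi * real_of_int k\<bar> powr (-(2 * u + 1)))" .
  have "norm (exp (\<i> * complex_of_real y) - 1) = 2 * \<bar>sin (y / 2)\<bar>" for y
    using norm_one_minus_cis[of y] by (simp add: cis_conv_exp norm_minus_commute)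
  then have "norm (exp (\<i> * complex_of_real (- x)) - 1) = norm (exp (\<i> * complex_of_real x) - 1)"
    by (metis abs_minus_cancel minus_divide_left sin_minus)
  with s show ?thesis unfolding fgn_shape_def by simp
qed

text \<open>Trades any power occurring below for the most singular one in its range, at a cost
  independent of the parameter: x^(p+e) is at most pi^4 on (0, pi].\<close>

lemma powr_le_pi:
  assumes "0 < x" "x \<le> pi" "0 \<le> p + e" "p + e \<le> 4"
  shows "x powr p \<le> pi ^ 4 * x powr (-e)"
proof -
  have "x powr (p + e) \<le> pi powr (p + e)" using assms by (intro powr_mono2) auto
  also have "\<dots> \<le> pi powr 4" using assms pi_gt3 by (intro powr_mono) auto
  finally have "x powr (p + e) \<le> pi ^ 4" using powr_realpow[of pi 4] by simp
  then have "x powr (p + e) * x powr (-e) \<le> pi ^ 4 * x powr (-e)" by (intro mult_right_mono) auto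
  then show ?thesis by (simp add: powr_add[symmetric])
qed

lemma norm_one_minus_cis_le: "norm (1 - cis x) \<le> \<bar>x\<bar>"
  using abs_sin_x_le_abs_x[of "x / 2"] by (simp add: norm_one_minus_cis)

lemma sq_powr: "x \<noteq> 0 \<Longrightarrow> x\<^sup>2 * \<bar>x\<bar> powr (-(2 * u + 1)) = \<bar>x\<bar> powr (1 - 2 * u)" for x u :: real
proof -
  assume x: "x \<noteq> 0"
  have "x\<^sup>2 = \<bar>x\<bar> powr 2" using powr_realpow[of "\<bar>x\<bar>" 2] x by simp
  then have "x\<^sup>2 * \<bar>x\<bar> powr (-(2 * u + 1)) = \<bar>x\<bar> powr (2 + (-(2 * u + 1)))" by (simp only: powr_add)
  then show ?thesis by simp
qed

text \<open>The factor |1 - cis x|^2 \<le> x^2 tames the central term to |x|^(1-2u). Cutting the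
  exponent off at 0 covers u \<le> 1/2, where nothing blows up, and \<open>b\<close> provides one
  exponent for all u up to \<open>b\<close>.\<close>

lemma fgn_shape_upper:
  assumes "0 < a" "a \<le> u" "u \<le> b" "b < 1" "\<bar>x\<bar> \<le> pi" "x \<noteq> 0"
  shows "fgn_shape u x \<le> pi ^ 4 * (1 + infsum (tail_bound_term a) (-{0})) * \<bar>x\<bar> powr (- max 0 (2 * b - 1))"
proof -
  define T where "T = infsum (tail_bound_term a) (-{0})"
  have T: "fgn_tail u x \<le> T" "0 \<le> T"
    using fgn_tail_le[OF assms(1,2,5)] fgn_tail_nonneg[of u x] by (auto simp: T_def)
  have "fgn_shape u x \<le> \<bar>x\<bar>\<^sup>2 * (\<bar>x\<bar> powr (-(2 * u + 1)) + T)"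
    unfolding fgn_shape_eq[OF less_le_trans[OF assms(1,2)] assms(5)]
    using T fgn_tail_nonneg[of u x] by (intro mult_mono power_mono norm_one_minus_cis_le add_mono) auto
  also have "\<dots> = \<bar>x\<bar> powr (1 - 2 * u) + T * \<bar>x\<bar> powr 2"
    using sq_powr[OF assms(6), of u] powr_realpow[of "\<bar>x\<bar>" 2] assms(6) by (simp add: distrib_left)
  also have "\<dots> \<le> pi ^ 4 * \<bar>x\<bar> powr (- max 0 (2 * b - 1)) + T * (pi ^ 4 * \<bar>x\<bar> powr (- max 0 (2 * b - 1)))"
    using assms T by (intro add_mono mult_left_mono powr_le_pi) (auto simp: max_def)
  finally show ?thesis by (simp add: T_def algebra_simps)
qed

text \<open>The central term alone suffices; 1/16 is the square of the constant in
  \<open>norm_one_minus_cis_ge\<close>.\<close>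

lemma fgn_shape_lower:
  assumes "0 < u" "\<bar>x\<bar> \<le> pi" "x \<noteq> 0"
  shows "\<bar>x\<bar> powr (1 - 2 * u) / 16 \<le> fgn_shape u x"
proof -
  have "\<bar>x\<bar> / 4 \<le> norm (1 - cis x)" using assms(2) by (intro norm_one_minus_cis_ge) linarith
  then have "(\<bar>x\<bar> / 4)\<^sup>2 \<le> (norm (1 - cis x))\<^sup>2" by (intro power_mono) auto
  then have "(\<bar>x\<bar> / 4)\<^sup>2 * (\<bar>x\<bar> powr (-(2 * u + 1)) + 0) \<le> fgn_shape u x"
    unfolding fgn_shape_eq[OF assms(1,2)] using fgn_tail_nonneg[of u x] by (intro mult_mono add_mono) auto
  then show ?thesis using sq_powr[OF assms(3), of u] by (simp add: power_divide)
qed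

lemma fgn_shape_pos: "0 < u \<Longrightarrow> \<bar>x\<bar> \<le> pi \<Longrightarrow> x \<noteq> 0 \<Longrightarrow> 0 < fgn_shape u x"
  using fgn_shape_lower[of u x] by (smt (verit) divide_pos_pos powr_gt_zero zero_less_abs_iff)

lemma inverse_fgn_shape_upper:
  assumes "0 < a" "a \<le> u" "u < 1" "\<bar>x\<bar> \<le> pi" "x \<noteq> 0"
  shows "1 / fgn_shape u x \<le> 16 * pi ^ 4 * \<bar>x\<bar> powr (- max 0 (1 - 2 * a))"
proof -
  have u: "0 < u" using assms by simp
  have "1 / fgn_shape u x \<le> 1 / (\<bar>x\<bar> powr (1 - 2 * u) / 16)"
    using fgn_shape_lower[OF u assms(4,5)] fgn_shape_pos[OF u assms(4,5)] assms(5) by (intro divide_left_mono) auto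
  also have "\<dots> = 16 * \<bar>x\<bar> powr (2 * u - 1)"
    using powr_minus[of "\<bar>x\<bar>" "1 - 2 * u"] by (simp add: inverse_eq_divide)
  also have "\<dots> \<le> 16 * (pi ^ 4 * \<bar>x\<bar> powr (- max 0 (1 - 2 * a)))"
    using assms by (intro mult_left_mono powr_le_pi) (auto simp: max_def)
  finally show ?thesis by simp
qed

lemma continuous_on_fgn_shape:
  assumes "0 < a"
  shows "continuous_on ({a..b} \<times> ({-pi..pi} - {0})) (\<lambda>(u, x). fgn_shape u x)"
proof -
  let ?S = "{a..b} \<times> ({-pi..pi} - {0::real})"
  have "continuous_on ?S (\<lambda>(u, x). fgn_tail u x)"
    by (rule continuous_on_subset[OF continuous_on_fgn_tail[OF assms, of b]]) auto
  then have T: "continuous_on ?S (\<lambda>p. fgn_tail (fst p) (snd p))" by (simp add: case_prod_beta)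
  have P: "continuous_on ?S (\<lambda>p. \<bar>snd p\<bar> powr (-(2 * fst p + 1)))"
    by (intro continuous_intros) auto
  have N: "continuous_on ?S (\<lambda>p. (norm (1 - cis (snd p)))\<^sup>2)"
    unfolding cis_conv_exp by (intro continuous_intros)
  have "continuous_on ?S (\<lambda>p. (norm (1 - cis (snd p)))\<^sup>2 *
     (\<bar>snd p\<bar> powr (-(2 * fst p + 1)) + fgn_tail (fst p) (snd p)))"
    by (rule continuous_on_mult[OF N continuous_on_add[OF P T]])
  then show ?thesis
  proof (rule continuous_on_eq)
    fix p assume p: "p \<in> ?S"
    then have "\<bar>snd p\<bar> \<le> pi" "0 < fst p" using assms by (auto simp: abs_le_iff)
    then show "(norm (1 - cis (snd p)))\<^sup>2 * (\<bar>snd p\<bar> powr (-(2 * fst p + 1)) + fgn_tail (fst p) (snd p)) =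
        (case p of (u, x) \<Rightarrow> fgn_shape u x)"
      by (simp only: fgn_shape_eq case_prod_beta)
  qed
qed

lemma continuous_fgn_shape_section:
  assumes "0 < a"
  shows "x \<in> {-pi..pi} - {0} \<Longrightarrow> continuous_on {a..b} (\<lambda>u. fgn_shape u x)"
    and "u \<in> {a..b} \<Longrightarrow> continuous_on ({-pi..pi} - {0}) (\<lambda>x. fgn_shape u x)"
proof -
  assume x: "x \<in> {-pi..pi} - {0}"
  have "continuous_on {a..b} (\<lambda>u. (\<lambda>(u, x). fgn_shape u x) (u, x))"
    by (rule continuous_on_compose2[OF continuous_on_fgn_shape[OF assms, of b]]) (use x in \<open>auto intro!: continuous_intros\<close>)
  then show "continuous_on {a..b} (\<lambda>u. fgn_shape u x)" by simp
next
  assume u: "u \<in> {a..b}"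
  have "continuous_on ({-pi..pi} - {0}) (\<lambda>x. (\<lambda>(u, x). fgn_shape u x) (u, x))"
    by (rule continuous_on_compose2[OF continuous_on_fgn_shape[OF assms, of b]]) (use u in \<open>auto intro!: continuous_intros\<close>)
  then show "continuous_on ({-pi..pi} - {0}) (\<lambda>x. fgn_shape u x)" by simp
qed

text \<open>Restricting to an open set on which the shape is continuous makes it Borel on the line.
  Removing the origin changes no value, because the factor in front of the series vanishes
  there.\<close>

definition fgn_shape_cut :: "real \<Rightarrow> real \<Rightarrow> real" where
  "fgn_shape_cut u t = indicator ({-pi<..<pi} - {0}) t * fgn_shape u t"

lemma fgn_shape_0: "fgn_shape u 0 = 0"
  by (simp add: fgn_shape_def)

lemma fgn_shape_cut_eq: "-pi < t \<Longrightarrow> t < pi \<Longrightarrow> fgn_shape_cut u t = fgn_shape u t"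
  by (cases "t = 0") (auto simp: fgn_shape_cut_def fgn_shape_0)

lemma fgn_shape_cut_measurable: 
  assumes "0 < u"
  shows "fgn_shape_cut u \<in> borel_measurable borel"
proof -
  have "continuous_on ({-pi<..<pi} - {0}) (fgn_shape u)"
    by (rule continuous_on_subset[OF continuous_fgn_shape_section(2)[OF assms, of u u]]) auto
  then have "(\<lambda>t. indicator ({-pi<..<pi} - {0}) t *\<^sub>R fgn_shape u t) \<in> borel_measurable borel"
    by (intro borel_measurable_continuous_on_indicator) auto
  then show ?thesis by (simp add: fgn_shape_cut_def[abs_def])
qed

lemma fgn_shape_cut_isCont:
  assumes "0 < u" "-pi < t" "t < pi" "t \<noteq> 0"
  shows "isCont (fgn_shape_cut u) t"
proof -
  have op: "open ({-pi<..<pi} - {0::real})" by (intro open_Diff) auto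
  have "continuous_on ({-pi<..<pi} - {0}) (fgn_shape u)"
    by (rule continuous_on_subset[OF continuous_fgn_shape_section(2)[OF assms(1), of u u]]) auto
  then have "continuous_on ({-pi<..<pi} - {0}) (fgn_shape_cut u)"
    by (rule continuous_on_eq) (simp add: fgn_shape_cut_def)
  then show ?thesis using assms op by (simp add: continuous_on_eq_continuous_at)
qed

lemma fgn_shape_cut_even: "fgn_shape_cut u (-t) = fgn_shape_cut u t"
  by (auto simp: fgn_shape_cut_def fgn_shape_even indicator_def)

lemma fgn_shape_cut_nonneg: "0 \<le> fgn_shape_cut u t"
  by (simp add: fgn_shape_cut_def fgn_shape_nonneg)

lemma fgn_shape_cut_pos: "0 < u \<Longrightarrow> -pi < t \<Longrightarrow> t < pi \<Longrightarrow> t \<noteq> 0 \<Longrightarrow> 0 < fgn_shape_cut u t"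
  using fgn_shape_pos[of u t] by (simp add: fgn_shape_cut_eq abs_le_iff)

lemma continuous_on_circ_integral:
  fixes h :: "real \<Rightarrow> real \<Rightarrow> real"
  assumes cont: "\<And>t. -pi < t \<Longrightarrow> t < pi \<Longrightarrow> t \<noteq> 0 \<Longrightarrow> continuous_on U (\<lambda>u. h u t)"
    and meas: "\<And>u. u \<in> U \<Longrightarrow> h u \<in> borel_measurable borel"
    and bnd: "\<And>u t. u \<in> U \<Longrightarrow> -pi < t \<Longrightarrow> t < pi \<Longrightarrow> t \<noteq> 0 \<Longrightarrow> \<bar>h u t\<bar> \<le> C * \<bar>t\<bar> powr (-c)"
    and c: "0 \<le> c" "c < 1"
  shows "continuous_on U (\<lambda>u. LINT t|circ_measure. h u t)"
  unfolding continuous_on_sequentially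
proof (intro allI ballI impI)
  fix x v assume v: "v \<in> U" and x: "(\<forall>n. x n \<in> U) \<and> x \<longlonglongrightarrow> v"
  show "((\<lambda>u. LINT t|circ_measure. h u t) \<circ> x) \<longlonglongrightarrow> (LINT t|circ_measure. h v t)"
    unfolding o_def
  proof (rule integral_dominated_convergence)
    show "integrable circ_measure (\<lambda>t. C * \<bar>t\<bar> powr (-c))" by (intro integrable_mult_right integrable_powr_circ c)
    show "AE t in circ_measure. (\<lambda>n. h (x n) t) \<longlonglongrightarrow> h v t"
      by (rule AE_circI) (use cont v x in \<open>auto simp: continuous_on_sequentially o_def\<close>)
    show "AE t in circ_measure. norm (h (x n) t) \<le> C * \<bar>t\<bar> powr (-c)" for n
      by (rule AE_circI) (use bnd x in auto)
  qed (use meas v x in auto)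
qed

definition fgn_var :: "real \<Rightarrow> real" where
  "fgn_var u = (LINT t|circ_measure. fgn_shape_cut u t)"

lemma fgn_shape_cut_powr_bounds:
  assumes "0 < a" "b < 1"
  obtains C where "C \<ge> 0"
    "\<And>u t. a \<le> u \<Longrightarrow> u \<le> b \<Longrightarrow> -pi < t \<Longrightarrow> t < pi \<Longrightarrow> t \<noteq> 0 \<Longrightarrow> fgn_shape_cut u t \<le> C * \<bar>t\<bar> powr (- max 0 (2 * b - 1))"
    "\<And>u t. a \<le> u \<Longrightarrow> u \<le> b \<Longrightarrow> -pi < t \<Longrightarrow> t < pi \<Longrightarrow> t \<noteq> 0 \<Longrightarrow> 1 / fgn_shape_cut u t \<le> C * \<bar>t\<bar> powr (- max 0 (1 - 2 * a))"
proof -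
  define C1 where "C1 = pi ^ 4 * (1 + infsum (tail_bound_term a) (-{0}))"
  have "infsum (tail_bound_term a) (-{0}) \<ge> 0" by (intro infsum_nonneg) (simp add: tail_bound_term_def)
  then have C1: "C1 \<ge> 0" by (simp add: C1_def)
  show ?thesis
  proof (rule that[of "max C1 (16 * pi ^ 4)"])
    fix u t assume u: "a \<le> u" "u \<le> b" and t: "-pi < t" "t < pi" "t \<noteq> 0"
    have t': "\<bar>t\<bar> \<le> pi" using t by auto
    have "fgn_shape_cut u t \<le> C1 * \<bar>t\<bar> powr (- max 0 (2 * b - 1))"
      unfolding fgn_shape_cut_eq[OF t(1,2)] C1_def using assms u t' t by (intro fgn_shape_upper) auto
    also have "\<dots> \<le> max C1 (16 * pi ^ 4) * \<bar>t\<bar> powr (- max 0 (2 * b - 1))" by (intro mult_right_mono) auto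
    finally show "fgn_shape_cut u t \<le> max C1 (16 * pi ^ 4) * \<bar>t\<bar> powr (- max 0 (2 * b - 1))" .
    have "1 / fgn_shape_cut u t \<le> (16 * pi ^ 4) * \<bar>t\<bar> powr (- max 0 (1 - 2 * a))"
      unfolding fgn_shape_cut_eq[OF t(1,2)] using assms u t' t by (intro inverse_fgn_shape_upper) auto
    also have "\<dots> \<le> max C1 (16 * pi ^ 4) * \<bar>t\<bar> powr (- max 0 (1 - 2 * a))" by (intro mult_right_mono) auto
    finally show "1 / fgn_shape_cut u t \<le> max C1 (16 * pi ^ 4) * \<bar>t\<bar> powr (- max 0 (1 - 2 * a))" .
  qed (use C1 in auto)
qed

lemma fgn_shape_cut_integrable:
  assumes "0 < u" "u < 1"
  shows "integrable circ_measure (fgn_shape_cut u)"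
proof -
  obtain C where C: "C \<ge> 0" "\<And>v t. u \<le> v \<Longrightarrow> v \<le> u \<Longrightarrow> -pi < t \<Longrightarrow> t < pi \<Longrightarrow> t \<noteq> 0 \<Longrightarrow> fgn_shape_cut v t \<le> C * \<bar>t\<bar> powr (- max 0 (2 * u - 1))"
    by (rule fgn_shape_cut_powr_bounds[OF assms]) blast
  show ?thesis
    using assms by (intro integrable_circ_powr_bound[OF fgn_shape_cut_measurable, of u "max 0 (2 * u - 1)" C])
      (auto simp: fgn_shape_cut_nonneg intro!: C)
qed

text \<open>The variance is the Toeplitz form of size 1 at the vector 1, so its positivity is an
  instance of \<open>tform_pos\<close>.\<close>

lemma fgn_var_pos:
  assumes "0 < u" "u < 1"
  shows "0 < fgn_var u"
proof -
  have "cos_coeff (fgn_shape_cut u) 0 = fgn_var u" by (simp add: cos_coeff_def fgn_var_def)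
  then have "tform (fgn_shape_cut u) 1 (\<lambda>_. 1) (\<lambda>_. 1) = fgn_var u" by (simp add: tform_def)
  then show ?thesis
    using tform_pos[OF fgn_shape_cut_integrable[OF assms] fgn_shape_cut_even fgn_shape_cut_pos[OF assms(1)], of 0 1 "\<lambda>_. 1"] by simp
qed

lemma fgn_const_eq:
  assumes "0 < u"
  shows "fgn_const u = 1 / fgn_var u"
proof -
  have "(LBINT t=-pi..pi. fgn_shape u t) = (2 * pi) *\<^sub>R integral\<^sup>L circ_measure (fgn_shape_cut u)"
    by (rule circ_integral[OF fgn_shape_cut_measurable[OF assms]]) (simp add: fgn_shape_cut_eq)
  then show ?thesis by (simp add: fgn_const_def fgn_var_def)
qed

lemma continuous_on_fgn_shape_cut:
  assumes "0 < a" "-pi < t" "t < pi" "t \<noteq> 0"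
  shows "continuous_on {a..b} (\<lambda>u. fgn_shape_cut u t)"
  using continuous_fgn_shape_section(1)[OF assms(1), of t b] assms by (simp add: fgn_shape_cut_eq)

lemma continuous_on_fgn_var:
  assumes "0 < a" "b < 1"
  shows "continuous_on {a..b} fgn_var"
proof -
  obtain C where C: "C \<ge> 0" "\<And>u t. a \<le> u \<Longrightarrow> u \<le> b \<Longrightarrow> -pi < t \<Longrightarrow> t < pi \<Longrightarrow> t \<noteq> 0 \<Longrightarrow> fgn_shape_cut u t \<le> C * \<bar>t\<bar> powr (- max 0 (2 * b - 1))"
    by (rule fgn_shape_cut_powr_bounds[OF assms]) blast
  show ?thesis unfolding fgn_var_def
    by (rule continuous_on_circ_integral[where C=C and c="max 0 (2 * b - 1)"])
      (use assms in \<open>auto intro!: continuous_on_fgn_shape_cut fgn_shape_cut_measurable C simp: fgn_shape_cut_nonneg\<close>)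
qed

text \<open>The spectral density cut off outside \<open>(-\<pi>, \<pi>)\<close>, which makes it Borel measurable on the line.\<close>
definition fgn_sd_cut :: "real \<Rightarrow> real \<Rightarrow> real" where
  "fgn_sd_cut u t = fgn_shape_cut u t / fgn_var u"

lemma fgn_sd_cut_eq: "0 < u \<Longrightarrow> -pi < t \<Longrightarrow> t < pi \<Longrightarrow> fgn_sd u t = fgn_sd_cut u t"
  by (simp add: fgn_sd_def fgn_sd_cut_def fgn_const_eq fgn_shape_cut_eq)

lemma F_lim_eq:
  assumes "0 < u" "0 < H"
  shows "F_lim u H = (LINT t|circ_measure. fgn_sd_cut H t / fgn_sd_cut u t)"
proof -
  have [measurable]: "fgn_shape_cut u \<in> borel_measurable borel" "fgn_shape_cut H \<in> borel_measurable borel"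
    using assms by (auto intro: fgn_shape_cut_measurable)
  have "(LBINT t=-pi..pi. fgn_sd H t / fgn_sd u t) = (2 * pi) *\<^sub>R (LINT t|circ_measure. fgn_sd_cut H t / fgn_sd_cut u t)"
    by (rule circ_integral) (auto simp: fgn_sd_cut_def[abs_def] fgn_sd_cut_eq assms simp del: div_by_1)
  then show ?thesis by (simp add: F_lim_def)
qed

text \<open>\<open>A\<close> and \<open>B\<close> are common to all parameters in the interval,
  which continuity of the limit in u requires. Since 1/g carries the factor
  \<open>fgn_var u\<close>, its maximum over the interval enters \<open>B\<close>.\<close>

lemma symbol_pair_fgn_sd_cut:
  assumes "0 < H" "H < 1" "0 < a" "H - 1/2 < a" "a \<le> u" "u \<le> b" "b < 1"
  obtains A B where "\<And>u. a \<le> u \<Longrightarrow> u \<le> b \<Longrightarrow> symbol_pair (fgn_sd_cut H) (fgn_sd_cut u) (max 0 (2 * H - 1)) (max 0 (1 - 2 * a)) A B"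
proof -
  obtain C where C: "C \<ge> 0" "\<And>u t. H \<le> u \<Longrightarrow> u \<le> H \<Longrightarrow> -pi < t \<Longrightarrow> t < pi \<Longrightarrow> t \<noteq> 0 \<Longrightarrow> fgn_shape_cut u t \<le> C * \<bar>t\<bar> powr (- max 0 (2 * H - 1))"
    by (rule fgn_shape_cut_powr_bounds[OF assms(1,2)]) blast
  obtain D where D: "D \<ge> 0" "\<And>u t. a \<le> u \<Longrightarrow> u \<le> b \<Longrightarrow> -pi < t \<Longrightarrow> t < pi \<Longrightarrow> t \<noteq> 0 \<Longrightarrow> 1 / fgn_shape_cut u t \<le> D * \<bar>t\<bar> powr (- max 0 (1 - 2 * a))"
    by (rule fgn_shape_cut_powr_bounds[OF assms(3,7)]) blast
  have "bounded (fgn_var ` {a..b})"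
    using assms by (intro compact_imp_bounded compact_continuous_image continuous_on_fgn_var) auto
  then obtain V where "\<forall>y\<in>fgn_var ` {a..b}. norm y \<le> V" unfolding bounded_iff by blast
  then have V: "\<And>u. a \<le> u \<Longrightarrow> u \<le> b \<Longrightarrow> \<bar>fgn_var u\<bar> \<le> V" by auto
  have VH: "fgn_var H > 0" using fgn_var_pos assms by auto
  show ?thesis
  proof (rule that[of "C / fgn_var H" "V * D"])
    fix u assume u: "a \<le> u" "u \<le> b"
    then have u': "0 < u" "u < 1" using assms by auto
    have Vu: "fgn_var u > 0" "fgn_var u \<le> V" using fgn_var_pos[OF u'] V[OF u] by auto
    show "symbol_pair (fgn_sd_cut H) (fgn_sd_cut u) (max 0 (2 * H - 1)) (max 0 (1 - 2 * a)) (C / fgn_var H) (V * D)"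
    proof
      have [measurable]: "fgn_shape_cut H \<in> borel_measurable borel" using assms by (auto intro: fgn_shape_cut_measurable)
      show "fgn_sd_cut H \<in> borel_measurable borel" unfolding fgn_sd_cut_def[abs_def] by measurable
      show "integrable circ_measure (fgn_sd_cut u)" unfolding fgn_sd_cut_def[abs_def] by (intro integrable_divide fgn_shape_cut_integrable u')
      show "0 \<le> fgn_sd_cut H t" for t using VH by (simp add: fgn_sd_cut_def fgn_shape_cut_nonneg)
      show "fgn_sd_cut H (- t) = fgn_sd_cut H t" "fgn_sd_cut u (- t) = fgn_sd_cut u t" for t by (simp_all add: fgn_sd_cut_def fgn_shape_cut_even)
      fix t assume t: "-pi < t" "t < pi" "t \<noteq> 0"
      show "0 < fgn_sd_cut u t" using Vu fgn_shape_cut_pos[OF u'(1) t] by (simp add: fgn_sd_cut_def)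
      show "isCont (fgn_sd_cut u) t" unfolding fgn_sd_cut_def[abs_def] using Vu by (intro continuous_intros fgn_shape_cut_isCont u' t) auto
      show "fgn_sd_cut H t \<le> C / fgn_var H * \<bar>t\<bar> powr - max 0 (2 * H - 1)"
        using C(2)[OF order_refl order_refl t] VH by (simp add: fgn_sd_cut_def divide_right_mono)
      have "1 / fgn_sd_cut u t = fgn_var u * (1 / fgn_shape_cut u t)" by (simp add: fgn_sd_cut_def)
      also have "\<dots> \<le> V * (D * \<bar>t\<bar> powr - max 0 (1 - 2 * a))"
        using D(2)[OF u t] Vu fgn_shape_cut_pos[OF u'(1) t] by (intro mult_mono) auto
      finally show "1 / fgn_sd_cut u t \<le> V * D * \<bar>t\<bar> powr - max 0 (1 - 2 * a)" by simp
    next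
      \<comment> \<open>If both maxima are positive, the sum is 2 (H - a), which is below 1 exactly
        when a > H - 1/2; in the other cases H < 1 or a > 0 suffices.\<close>
      show "max 0 (2 * H - 1) + max 0 (1 - 2 * a) < 1" using assms by (auto simp: max_def)
      show "0 \<le> C / fgn_var H" using C VH by simp
      show "0 \<le> V * D" using D Vu by simp
    qed auto
  qed
qed

lemma continuous_on_F_lim:
  assumes "0 < H" "H < 1" "0 < a" "H - 1/2 < a" "a \<le> b" "b < 1"
  shows "continuous_on {a..b} (\<lambda>u. F_lim u H)"
proof -
  obtain A B where sp: "\<And>u. a \<le> u \<Longrightarrow> u \<le> b \<Longrightarrow> symbol_pair (fgn_sd_cut H) (fgn_sd_cut u) (max 0 (2 * H - 1)) (max 0 (1 - 2 * a)) A B"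
    using symbol_pair_fgn_sd_cut[OF assms(1-4) _ assms(5,6)] assms(5) by blast
  have "continuous_on {a..b} (\<lambda>u. LINT t|circ_measure. fgn_sd_cut H t / fgn_sd_cut u t)"
  proof (rule continuous_on_circ_integral)
    fix t assume t: "-pi < t" "t < pi" "t \<noteq> 0"
    have "fgn_shape_cut u t \<noteq> 0" "fgn_var u \<noteq> 0" if "u \<in> {a..b}" for u
      using fgn_shape_cut_pos[OF _ t, of u] fgn_var_pos[of u] that assms by auto
    then show "continuous_on {a..b} (\<lambda>u. fgn_sd_cut H t / fgn_sd_cut u t)"
      unfolding fgn_sd_cut_def using assms by (intro continuous_intros continuous_on_fgn_shape_cut t continuous_on_fgn_var) auto
  next
    fix u assume u: "u \<in> {a..b}"
    interpret symbol_pair "fgn_sd_cut H" "fgn_sd_cut u" "max 0 (2 * H - 1)" "max 0 (1 - 2 * a)" A B using sp u by auto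
    show "(\<lambda>t. fgn_sd_cut H t / fgn_sd_cut u t) \<in> borel_measurable borel" by measurable
  next
    fix u t assume u: "u \<in> {a..b}" and t: "-pi < t" "t < pi" "t \<noteq> 0"
    interpret symbol_pair "fgn_sd_cut H" "fgn_sd_cut u" "max 0 (2 * H - 1)" "max 0 (1 - 2 * a)" A B using sp u by auto
    have "fgn_sd_cut H t * (1 / fgn_sd_cut u t) \<le> A * B * \<bar>t\<bar> powr (- (max 0 (2 * H - 1) + max 0 (1 - 2 * a)))"
      using g_pos[OF t] AB by (intro f_powr_bound[OF t] inv_g_le t) auto
    then show "\<bar>fgn_sd_cut H t / fgn_sd_cut u t\<bar> \<le> A * B * \<bar>t\<bar> powr (- (max 0 (2 * H - 1) + max 0 (1 - 2 * a)))"
      using g_pos[OF t] f_nonneg[of t] by simp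
  qed (use assms in \<open>auto simp: max_def\<close>)
  then show ?thesis by (rule continuous_on_eq) (use assms in \<open>auto simp: F_lim_eq\<close>)
qed

text \<open>Raising the parameter from u to v makes the central term more singular at 0, and
  |t|^(2(v-u)) \<le> pi^(2(v-u)) limits how much the larger values of |t| can oppose this. No bound
  in the other direction can hold near 0.\<close>

lemma fgn_shape_cut_almost_mono:
  assumes "0 < a" "b < 1" "e > 0"
  shows "\<exists>d>0. \<forall>u v t. a \<le> u \<longrightarrow> u \<le> v \<longrightarrow> v \<le> b \<longrightarrow> v - u < d \<longrightarrow> fgn_shape_cut u t \<le> (1 + e) * fgn_shape_cut v t"
proof -
  define h where "h = e / 2"
  have h: "h > 0" using assms by (simp add: h_def)
  have "uniformly_continuous_on ({a..b} \<times> {-pi..pi}) (\<lambda>(u, x). fgn_tail u x)"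
    by (intro compact_uniformly_continuous continuous_on_fgn_tail compact_Times assms) auto
  moreover have "h / pi ^ 3 > 0" using h by simp
  ultimately obtain d1 where d1: "d1 > 0" "\<And>p q. p \<in> {a..b} \<times> {-pi..pi} \<Longrightarrow> q \<in> {a..b} \<times> {-pi..pi} \<Longrightarrow> dist q p < d1 \<Longrightarrow>
      dist ((\<lambda>(u, x). fgn_tail u x) q) ((\<lambda>(u, x). fgn_tail u x) p) < h / pi ^ 3"
    unfolding uniformly_continuous_on_def by blast
  \<comment> \<open>The solution of pi^(2 d2) = 1 + h.\<close>
  define d2 where "d2 = ln (1 + h) / (2 * ln pi)"
  have lnpi: "ln pi > 0" using pi_gt3 by (intro ln_gt_zero) linarith
  have d2: "d2 > 0" using h lnpi by (simp add: d2_def)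
  show ?thesis
  proof (intro exI[of _ "min d1 d2"] conjI allI impI)
    show "min d1 d2 > 0" using d1 d2 by simp
    fix u v t assume uv: "a \<le> u" "u \<le> v" "v \<le> b" "v - u < min d1 d2"
    show "fgn_shape_cut u t \<le> (1 + e) * fgn_shape_cut v t"
    proof (cases "t \<in> {-pi<..<pi} - {0}")
      case True
      then have t: "-pi < t" "t < pi" "t \<noteq> 0" "\<bar>t\<bar> \<le> pi" "0 < \<bar>t\<bar>" by auto
      have pos: "0 < u" "0 < v" using uv assms by auto
      have "\<bar>fgn_tail u t - fgn_tail v t\<bar> < h / pi ^ 3"
        using d1(2)[of "(v, t)" "(u, t)"] uv t by (auto simp: dist_Pair_Pair dist_real_def)
      then have T: "fgn_tail u t \<le> fgn_tail v t + h / pi ^ 3" by linarith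
      \<comment> \<open>The central term is at least pi^-3 throughout, so it absorbs the additive
        error h / pi^3 of the tail as a relative error h; this is the second of the two halves of
        \<open>e\<close>.\<close>
      have "pi powr (-3) \<le> pi powr (-(2 * v + 1))" using uv assms pi_gt3 by (intro powr_mono) auto
      also have "\<dots> \<le> \<bar>t\<bar> powr (-(2 * v + 1))" using t pos by (intro powr_mono2') auto
      finally have "1 / pi ^ 3 \<le> \<bar>t\<bar> powr (-(2 * v + 1))"
        using powr_minus[of pi 3] powr_realpow[of pi 3] by (simp add: inverse_eq_divide)
      then have "h * (1 / pi ^ 3) \<le> h * \<bar>t\<bar> powr (-(2 * v + 1))" using h by (intro mult_left_mono) auto
      with T have T2: "fgn_tail u t \<le> fgn_tail v t + h * \<bar>t\<bar> powr (-(2 * v + 1))" by simp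
      have "\<bar>t\<bar> powr (2 * (v - u)) \<le> pi powr (2 * (v - u))" using t uv by (intro powr_mono2) auto
      also have "\<dots> \<le> pi powr (2 * d2)" using uv pi_gt3 by (intro powr_mono) auto
      also have "\<dots> = 1 + h" using lnpi h by (simp add: powr_def d2_def)
      finally have "\<bar>t\<bar> powr (2 * (v - u)) * \<bar>t\<bar> powr (-(2 * v + 1)) \<le> (1 + h) * \<bar>t\<bar> powr (-(2 * v + 1))"
        by (intro mult_right_mono) auto
      then have P: "\<bar>t\<bar> powr (-(2 * u + 1)) \<le> (1 + h) * \<bar>t\<bar> powr (-(2 * v + 1))"
        by (simp add: powr_add[symmetric] algebra_simps)
      have "\<bar>t\<bar> powr (-(2 * u + 1)) + fgn_tail u t \<le> (1 + e) * (\<bar>t\<bar> powr (-(2 * v + 1)) + fgn_tail v t)"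
      proof -
        have "\<bar>t\<bar> powr (-(2 * u + 1)) + fgn_tail u t \<le> (1 + 2 * h) * \<bar>t\<bar> powr (-(2 * v + 1)) + 1 * fgn_tail v t"
          using P T2 by (simp add: algebra_simps)
        also have "\<dots> \<le> (1 + e) * \<bar>t\<bar> powr (-(2 * v + 1)) + (1 + e) * fgn_tail v t"
          using fgn_tail_nonneg[of v t] assms by (intro add_mono mult_right_mono) (auto simp: h_def)
        finally show ?thesis by (simp add: distrib_left)
      qed
      then have "(norm (1 - cis t))\<^sup>2 * (\<bar>t\<bar> powr (-(2 * u + 1)) + fgn_tail u t) \<le>
         (norm (1 - cis t))\<^sup>2 * ((1 + e) * (\<bar>t\<bar> powr (-(2 * v + 1)) + fgn_tail v t))"
        by (intro mult_left_mono) auto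
      then show ?thesis
        unfolding fgn_shape_cut_eq[OF t(1,2)] fgn_shape_eq[OF pos(1) t(4)] fgn_shape_eq[OF pos(2) t(4)] by (simp add: mult_ac)
    qed (simp add: fgn_shape_cut_def)
  qed
qed

lemma fgn_sd_cut_almost_mono:
  assumes "0 < a" "a \<le> b" "b < 1" "e > 0"
  shows "\<exists>d>0. \<forall>u v t. a \<le> u \<longrightarrow> u \<le> v \<longrightarrow> v \<le> b \<longrightarrow> v - u < d \<longrightarrow> fgn_sd_cut u t \<le> (1 + e) * fgn_sd_cut v t"
proof -
  \<comment> \<open>For h \<le> 1 one has (1 + h)^2 \<le> 1 + 3 h: one factor pays for the shape,
    the other for the normalising constant.\<close>
  define h where "h = min 1 (e / 3)"
  have h: "h > 0" "h \<le> 1" "3 * h \<le> e" using assms by (auto simp: h_def)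
  have "h * h \<le> h * 1" using h by (intro mult_left_mono) auto
  moreover have "(1 + h) * (1 + h) = 1 + 2 * h + h * h" by (simp add: algebra_simps)
  ultimately have "(1 + h) * (1 + h) \<le> 1 + e" using h by linarith
  obtain d1 where d1: "d1 > 0" "\<And>u v t. a \<le> u \<Longrightarrow> u \<le> v \<Longrightarrow> v \<le> b \<Longrightarrow> v - u < d1 \<Longrightarrow> fgn_shape_cut u t \<le> (1 + h) * fgn_shape_cut v t"
    using fgn_shape_cut_almost_mono[OF assms(1,3) h(1)] by blast
  have cv: "continuous_on {a..b} fgn_var" by (rule continuous_on_fgn_var[OF assms(1,3)])
  obtain m where m: "m \<in> {a..b}" "\<And>u. u \<in> {a..b} \<Longrightarrow> fgn_var m \<le> fgn_var u"
    using continuous_attains_inf[OF _ _ cv] assms by auto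
  have mpos: "fgn_var m > 0" using m assms by (intro fgn_var_pos) auto
  have "uniformly_continuous_on {a..b} fgn_var" by (intro compact_uniformly_continuous cv) auto
  moreover have "h * fgn_var m > 0" using h mpos by simp
  ultimately obtain d2 where d2: "d2 > 0" "\<And>u v. u \<in> {a..b} \<Longrightarrow> v \<in> {a..b} \<Longrightarrow> dist v u < d2 \<Longrightarrow> dist (fgn_var v) (fgn_var u) < h * fgn_var m"
    unfolding uniformly_continuous_on_def by blast
  show ?thesis
  proof (intro exI[of _ "min d1 d2"] conjI allI impI)
    show "min d1 d2 > 0" using d1 d2 by simp
    fix u v t assume uv: "a \<le> u" "u \<le> v" "v \<le> b" "v - u < min d1 d2"
    have pos: "fgn_var u > 0" "fgn_var v > 0" using uv assms by (auto intro!: fgn_var_pos)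
    have "\<bar>fgn_var v - fgn_var u\<bar> < h * fgn_var m" using d2(2)[of u v] uv by (auto simp: dist_real_def)
    also have "\<dots> \<le> h * fgn_var u" using m(2)[of u] uv h by (intro mult_left_mono) auto
    finally have V: "fgn_var v \<le> (1 + h) * fgn_var u" by (simp add: algebra_simps)
    have "fgn_sd_cut u t \<le> ((1 + h) * fgn_shape_cut v t) / fgn_var u"
      unfolding fgn_sd_cut_def using d1(2)[of u v t] uv pos by (intro divide_right_mono) auto
    also have "\<dots> = (1 + h) * fgn_shape_cut v t * (1 / fgn_var u)" by simp
    also have "1 / fgn_var u \<le> (1 + h) / fgn_var v" using V pos by (simp add: field_simps)
    then have "(1 + h) * fgn_shape_cut v t * (1 / fgn_var u) \<le> (1 + h) * fgn_shape_cut v t * ((1 + h) / fgn_var v)"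
      using h fgn_shape_cut_nonneg[of v t] by (intro mult_left_mono) auto
    also have "\<dots> = ((1 + h) * (1 + h)) * fgn_sd_cut v t" by (simp add: fgn_sd_cut_def)
    also have "\<dots> \<le> (1 + e) * fgn_sd_cut v t"
      using \<open>(1 + h) * (1 + h) \<le> 1 + e\<close> pos fgn_shape_cut_nonneg[of v t] by (intro mult_right_mono) (auto simp: fgn_sd_cut_def)
    finally show "fgn_sd_cut u t \<le> (1 + e) * fgn_sd_cut v t" .
  qed
qed

subsection \<open>Locally uniform convergence\<close>

lemma orthonormal_expansion_real:
  assumes w: "tform_orthonormal g n w" and "j < n"
  shows "y j = (\<Sum>i<n. tform g n (w i) y * w i j)"
proof -
  have "(\<Sum>i<n. tform g n (w i) y * w i j) = (\<Sum>i<n. \<Sum>k<n. w i j * (\<Sum>l<n. w i l * cos_coeff g (int l - int k)) * y k)"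
  proof (intro sum.cong refl)
    fix i
    have "tform g n (w i) y = (\<Sum>k<n. (\<Sum>l<n. w i l * cos_coeff g (int l - int k)) * y k)"
      unfolding tform_def sum_distrib_right by (subst sum.swap) (simp add: mult_ac)
    then show "tform g n (w i) y * w i j = (\<Sum>k<n. w i j * (\<Sum>l<n. w i l * cos_coeff g (int l - int k)) * y k)"
      by (simp add: sum_distrib_left sum_distrib_right mult_ac)
  qed
  also have "\<dots> = (\<Sum>k<n. (\<Sum>i<n. w i j * (\<Sum>l<n. w i l * cos_coeff g (int l - int k))) * y k)"
    by (subst sum.swap) (simp add: sum_distrib_right)
  also have "\<dots> = (\<Sum>k<n. if k = j then y k else 0)"
    by (intro sum.cong refl) (auto simp: orthonormal_dual[OF w \<open>j < n\<close>])
  finally show ?thesis using \<open>j < n\<close> by simp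
qed

lemma tform_cong: "(\<And>j. j < n \<Longrightarrow> x j = x' j) \<Longrightarrow> (\<And>j. j < n \<Longrightarrow> y j = y' j) \<Longrightarrow> tform g n x y = tform g n x' y'"
  by (simp add: tform_def)

lemma tform_parseval:
  assumes w: "tform_orthonormal g n w"
  shows "tform g n y y = (\<Sum>i<n. (tform g n (w i) y)\<^sup>2)"
proof -
  have "tform g n y y = tform g n (\<lambda>j. \<Sum>i<n. tform g n (w i) y * w i j) y"
    by (rule tform_cong) (auto intro: orthonormal_expansion_real[OF w])
  then show ?thesis by (simp add: tform_sum_left power2_eq_square)
qed

text \<open>Inversion reverses the order of positive definite matrices. With T and T' the Toeplitz
  matrices of \<open>g\<close> and \<open>g'\<close>, put y = T'^-1 x, so that <x, y> = q is the
  form to be bounded. In the coordinates given by \<open>w\<close>, <x, y> is the product of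
  \<open>a\<close> and \<open>b\<close>, where |b|^2 = <y, T y> \<le> c q. Expanding |c a - b|^2
  \<ge> 0 then gives the claim without matrix square roots.\<close>

lemma inverse_form_antimono:
  assumes w: "tform_orthonormal g n w" and w': "tform_orthonormal g' n w'"
    and le: "\<And>y. tform g n y y \<le> c * tform g' n y y" and c: "c > 0"
  shows "(\<Sum>i<n. (\<Sum>j<n. w' i j * x j)\<^sup>2) \<le> c * (\<Sum>i<n. (\<Sum>j<n. w i j * x j)\<^sup>2)"
proof -
  define a where "a i = (\<Sum>j<n. w i j * x j)" for i
  define a' where "a' i = (\<Sum>j<n. w' i j * x j)" for i
  define y where "y j = (\<Sum>i<n. a' i * w' i j)" for j
  define b where "b i = tform g n (w i) y" for i
  define q where "q = (\<Sum>i<n. (a' i)\<^sup>2)"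
  have xy: "(\<Sum>j<n. x j * y j) = q"
  proof -
    have "(\<Sum>j<n. x j * y j) = (\<Sum>i<n. a' i * (\<Sum>j<n. w' i j * x j))"
      unfolding y_def sum_distrib_left by (subst sum.swap) (simp add: mult_ac)
    then show ?thesis by (simp add: a'_def[symmetric] q_def power2_eq_square)
  qed
  have "tform g' n y (w' i) = a' i" if "i < n" for i
  proof -
    have "tform g' n y (w' i) = (\<Sum>l<n. a' l * tform g' n (w' l) (w' i))" unfolding y_def by (rule tform_sum_left)
    also have "\<dots> = (\<Sum>l<n. if l = i then a' l else 0)"
      using w' that by (intro sum.cong refl) (auto simp: tform_orthonormal_def)
    finally show ?thesis using that by simp
  qed
  then have "tform g' n (w' i) y = a' i" if "i < n" for i using that tform_commute[of g' n "w' i" y] by simp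
  then have "tform g' n y y = q" unfolding tform_parseval[OF w'] q_def by (intro sum.cong) auto
  then have bb: "(\<Sum>i<n. (b i)\<^sup>2) \<le> c * q" using le[of y] tform_parseval[OF w, of y] by (simp add: b_def)
  have ab: "(\<Sum>i<n. a i * b i) = q"
  proof -
    have "(\<Sum>i<n. a i * b i) = (\<Sum>j<n. x j * (\<Sum>i<n. b i * w i j))"
      unfolding a_def sum_distrib_left sum_distrib_right by (subst sum.swap) (simp add: mult_ac)
    also have "\<dots> = (\<Sum>j<n. x j * y j)"
      unfolding b_def by (intro sum.cong refl) (simp add: orthonormal_expansion_real[OF w, symmetric])
    finally show ?thesis using xy by simp
  qed
  have "0 \<le> (\<Sum>i<n. (c * a i - b i)\<^sup>2)" by (intro sum_nonneg) auto
  also have "\<dots> = c\<^sup>2 * (\<Sum>i<n. (a i)\<^sup>2) - 2 * c * (\<Sum>i<n. a i * b i) + (\<Sum>i<n. (b i)\<^sup>2)"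
    by (simp add: power2_diff power_mult_distrib sum.distrib sum_subtractf sum_distrib_left mult_ac)
  also have "\<dots> \<le> c\<^sup>2 * (\<Sum>i<n. (a i)\<^sup>2) - c * q" using bb ab by simp
  finally have "c * q \<le> c * (c * (\<Sum>i<n. (a i)\<^sup>2))" by (simp add: power2_eq_square)
  then have "q \<le> c * (\<Sum>i<n. (a i)\<^sup>2)" using c by simp
  then show ?thesis by (simp add: q_def a_def a'_def)
qed

lemma tform_mono:
  assumes "integrable circ_measure g" "\<And>t. g (-t) = g t" "integrable circ_measure g'" "\<And>t. g' (-t) = g' t"
    and le: "\<And>t. g t \<le> c * g' t"
  shows "tform g n y y \<le> c * tform g' n y y"
proof -
  have "(LINT t|circ_measure. g t * (norm (ctrig n y t))\<^sup>2) \<le> (LINT t|circ_measure. c * (g' t * (norm (ctrig n y t))\<^sup>2))"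
  proof (rule integral_mono)
    fix t show "g t * (norm (ctrig n y t))\<^sup>2 \<le> c * (g' t * (norm (ctrig n y t))\<^sup>2)"
      using mult_right_mono[OF le, of "(norm (ctrig n y t))\<^sup>2" t] by (simp add: mult.assoc)
  qed (use assms in \<open>auto intro: integrable_norm_trig\<close>)
  then show ?thesis unfolding tform_eq_integral[OF assms(1,2)] tform_eq_integral[OF assms(3,4)] by simp
qed

text \<open>A Dini-type argument on a finite grid: at a point between two neighbours, the left one
  bounds the function from above and the right one from below. It matters that \<open>d\<close> in
  the monotonicity hypothesis does not depend on \<open>n\<close>.\<close>

lemma uniform_limit_almost_antimono:
  fixes \<phi> :: "nat \<Rightarrow> real \<Rightarrow> real"
  assumes rat: "a \<in> \<rat>" "b \<in> \<rat>" and "a < b"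
    and cont: "continuous_on {a..b} F" and nonneg: "\<And>n u. a \<le> u \<Longrightarrow> u \<le> b \<Longrightarrow> 0 \<le> \<phi> n u"
    and mono: "\<And>e. e > 0 \<Longrightarrow> \<exists>d>0. \<forall>n u v. a \<le> u \<longrightarrow> u \<le> v \<longrightarrow> v \<le> b \<longrightarrow> v - u < d \<longrightarrow> \<phi> n v \<le> (1 + e) * \<phi> n u"
    and lim: "\<And>q. q \<in> \<rat> \<Longrightarrow> a \<le> q \<Longrightarrow> q \<le> b \<Longrightarrow> (\<lambda>n. \<phi> n q) \<longlonglongrightarrow> F q"
  shows "uniform_limit {a..b} \<phi> F sequentially"
proof (rule uniform_limitI)
  fix e0 :: real assume "e0 > 0"
  define e where "e = min 1 e0"
  have e: "e > 0" "e \<le> 1" "e \<le> e0" using \<open>e0 > 0\<close> by (auto simp: e_def)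
  have "bounded (F ` {a..b})" by (intro compact_imp_bounded compact_continuous_image cont) auto
  then obtain B where "B > 0" "\<forall>y\<in>F ` {a..b}. norm y \<le> B" unfolding bounded_pos by blast
  then have B: "B > 0" "\<And>u. a \<le> u \<Longrightarrow> u \<le> b \<Longrightarrow> \<bar>F u\<bar> \<le> B" by auto
  \<comment> \<open>The relative slack \<open>r\<close> costs at most e/16 on values up to B + 1 and
    e/8 on values up to 2 (B + 1), the two sizes that occur below.\<close>
  define r where "r = e / (16 * (B + 1))"
  have r: "r > 0" "r * (B + 1) = e / 16" "r \<le> 1"
    using e B by (auto simp: r_def divide_simps)
  obtain d1 where d1: "d1 > 0" "\<And>n u v. a \<le> u \<Longrightarrow> u \<le> v \<Longrightarrow> v \<le> b \<Longrightarrow> v - u < d1 \<Longrightarrow> \<phi> n v \<le> (1 + r) * \<phi> n u"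
    using mono[OF r(1)] by blast
  have "uniformly_continuous_on {a..b} F" by (intro compact_uniformly_continuous cont) auto
  moreover have "e / 4 > 0" using e by simp
  ultimately obtain d2 where d2: "d2 > 0" "\<And>u v. u \<in> {a..b} \<Longrightarrow> v \<in> {a..b} \<Longrightarrow> dist v u < d2 \<Longrightarrow> dist (F v) (F u) < e / 4"
    unfolding uniformly_continuous_on_def by blast
  define d where "d = min d1 d2"
  have "d > 0" using d1 d2 by (simp add: d_def)
  then obtain N :: nat where N: "(b - a) / d < real N" using reals_Archimedean2 by blast
  have Npos: "N > 0" using N \<open>a < b\<close> \<open>d > 0\<close> by (cases N) (auto simp: divide_less_0_iff not_less less_imp_le dest: less_asym)
  define s where "s = (b - a) / real N"
  have s: "s > 0" "s < d" "s * N = b - a" using N Npos \<open>a < b\<close> \<open>d > 0\<close> by (auto simp: s_def field_simps)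
  \<comment> \<open>The endpoints are rational, so an equidistant grid consists of rational points,
    where convergence is available.\<close>
  define p where "p k = a + real k * s" for k
  have p_rat: "p k \<in> \<rat>" for k using rat by (auto simp: p_def s_def intro!: Rats_add Rats_mult Rats_divide Rats_diff)
  have p_le: "a \<le> p k" "k \<le> N \<Longrightarrow> p k \<le> b" for k
  proof -
    show "a \<le> p k" using s by (simp add: p_def)
    assume "k \<le> N"
    then have "real k * s \<le> real N * s" using s by (intro mult_right_mono) auto
    then show "p k \<le> b" using s by (simp add: p_def mult.commute)
  qed
  have "\<forall>\<^sub>F n in sequentially. \<forall>k\<in>{..N}. dist (\<phi> n (p k)) (F (p k)) < e / 8"
    using e by (intro eventually_ball_finite ballI tendstoD lim p_rat p_le) auto
  then show "\<forall>\<^sub>F n in sequentially. \<forall>u\<in>{a..b}. dist (\<phi> n u) (F u) < e0"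
  proof eventually_elim
    case (elim n)
    show ?case
    proof
      fix u assume u: "u \<in> {a..b}"
      obtain k where k: "k < N" "p k \<le> u" "u \<le> p (Suc k)"
      proof (cases "u = b")
        case True
        show ?thesis
        proof (rule that[of "N - 1"])
          have "Suc (N - 1) = N" using Npos by simp
          then show "u \<le> p (Suc (N - 1))" using s True by (simp add: p_def mult.commute)
          show "p (N - 1) \<le> u" using p_le(2)[of "N - 1"] True by simp
        qed (use Npos in simp)
      next
        case False
        define k where "k = nat \<lfloor>(u - a) / s\<rfloor>"
        have "(u - a) / s \<ge> 0" using u s by simp
        then have k1: "real k \<le> (u - a) / s" "(u - a) / s < real k + 1" unfolding k_def by linarith+
        then have k2: "real k * s \<le> u - a" "u - a < (real k + 1) * s" using s by (auto simp: field_simps)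
        have "real k * s < real N * s" using k2 False u s by (auto simp: mult.commute)
        then have "k < N" using s by simp
        then show ?thesis using k2 by (intro that[of k]) (auto simp: p_def algebra_simps)
      qed
      have pk: "a \<le> p k" "p k \<le> b" "a \<le> p (Suc k)" "p (Suc k) \<le> b" using p_le k by auto
      have gap: "u - p k < d" "p (Suc k) - u < d" using k s by (auto simp: p_def algebra_simps)
      have ub: "a \<le> u" "u \<le> b" using u by auto
      have 1: "\<phi> n u \<le> (1 + r) * \<phi> n (p k)" using d1(2)[of "p k" u n] pk k ub gap by (auto simp: d_def)
      have 2: "\<phi> n (p (Suc k)) \<le> (1 + r) * \<phi> n u" using d1(2)[of u "p (Suc k)" n] pk k ub gap by (auto simp: d_def)
      have 3: "\<bar>\<phi> n (p k) - F (p k)\<bar> < e / 8" "\<bar>\<phi> n (p (Suc k)) - F (p (Suc k))\<bar> < e / 8"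
        using elim k by (auto simp: dist_real_def)
      have 4: "\<bar>F (p k) - F u\<bar> < e / 4" "\<bar>F (p (Suc k)) - F u\<bar> < e / 4"
        using d2(2)[of u "p k"] d2(2)[of u "p (Suc k)"] pk ub gap k by (auto simp: dist_real_def d_def)
      have 5: "\<phi> n (p k) \<le> B + 1" using 3(1) B(2)[OF pk(1,2)] e by linarith
      have 6: "r * \<phi> n (p k) \<le> e / 16" unfolding r(2)[symmetric] using r 5 by (intro mult_left_mono) auto
      have 7: "\<phi> n u \<le> \<phi> n (p k) + e / 16" using 1 6 by (simp add: distrib_right)
      then have "\<phi> n u \<le> 2 * (B + 1)" using 5 e(2) B(1) by simp
      then have "r * \<phi> n u \<le> r * (2 * (B + 1))" using r by (intro mult_left_mono) auto
      also have "\<dots> = 2 * (r * (B + 1))" by (simp add: algebra_simps)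
      finally have 8: "r * \<phi> n u \<le> e / 8" unfolding r(2) by simp
      have 9: "\<phi> n (p (Suc k)) \<le> \<phi> n u + e / 8" using 2 8 by (simp add: distrib_right)
      \<comment> \<open>The errors add up to 1/8 + 1/4 + 1/16 of \<open>e\<close> from above and 1/8
        + 1/4 + 1/8 from below.\<close>
      have "\<bar>\<phi> n u - F u\<bar> < e" using 3 4 7 9 e by linarith
      then show "dist (\<phi> n u) (F u) < e0" using e by (simp add: dist_real_def)
    qed
  qed
qed

theorem theorem3:
  fixes M :: "'a measure" and Hh :: real and \<xi> :: "nat \<Rightarrow> 'a \<Rightarrow> nat \<Rightarrow> real"
  assumes "prob_space M"
    and "0 < Hh" "Hh < 1"
    and "\<And>n. n \<ge> 1 \<Longrightarrow> normal_vector M n (toeplitz n (fgn_sd Hh)) (\<xi> n)"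
  shows "AE \<omega> in M. \<forall>K. compact K \<and> K \<subseteq> {u. Hh - 1/2 < u \<and> 0 < u \<and> u < 1} \<longrightarrow>
           uniform_limit K (\<lambda>n u. rho_n n (\<xi> n \<omega>) u) (\<lambda>u. complex_of_real (F_lim u Hh)) sequentially"
proof -
  have sint: "integrable circ_measure (fgn_sd_cut u)" if "0 < u" "u < 1" for u
    unfolding fgn_sd_cut_def[abs_def] using that by (intro integrable_divide fgn_shape_cut_integrable)
  have sev: "fgn_sd_cut u (- t) = fgn_sd_cut u t" for u t by (simp add: fgn_sd_cut_def fgn_shape_cut_even)
  have spos: "0 < fgn_sd_cut u t" if "0 < u" "u < 1" "-pi < t" "t < pi" "t \<noteq> 0" for u t
    using that fgn_shape_cut_pos fgn_var_pos by (simp add: fgn_sd_cut_def)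
  have "\<exists>w. tform_orthonormal (fgn_sd_cut u) n w" if "0 < u" "u < 1" for u n
    using that by (intro tform_orthonormal_ex tform_pos sint sev spos) auto
  then obtain w where w: "tform_orthonormal (fgn_sd_cut u) n (w u n)" if "0 < u" "u < 1" for u n by metis
  define \<phi> where "\<phi> \<omega> n u = (\<Sum>i<n. (\<Sum>j<n. w u n i j * \<xi> n \<omega> j)\<^sup>2) / real n" for \<omega> n u
  have rho: "rho_n n (\<xi> n \<omega>) u = of_real (\<phi> \<omega> n u)" if "0 < u" "u < 1" for n \<omega> u
    unfolding \<phi>_def by (rule rho_n_orthonormal[OF sint sev fgn_sd_cut_eq w]) (use that in auto)
  define I where "I = {u. Hh - 1/2 < u \<and> 0 < u \<and> u < 1}"
  have pointwise: "AE \<omega> in M. (\<lambda>n. \<phi> \<omega> n u) \<longlonglongrightarrow> F_lim u Hh" if "u \<in> I" for u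
  proof -
    have u: "0 < u" "u < 1" "Hh - 1/2 < u" using that by (auto simp: I_def)
    \<comment> \<open>At a single parameter the interval degenerates to the point u, so the exponent
      condition is exactly u > Hh - 1/2.\<close>
    obtain A B where "symbol_pair (fgn_sd_cut Hh) (fgn_sd_cut u) (max 0 (2 * Hh - 1)) (max 0 (1 - 2 * u)) A B"
      using symbol_pair_fgn_sd_cut[OF assms(2,3) u(1,3) order_refl order_refl u(2)] by blast
    from symbol_pair.quadratic_form_AE_tendsto[OF this assms(1,4) fgn_sd_cut_eq[OF assms(2)] w[OF u(1,2)]]
    show ?thesis unfolding \<phi>_def F_lim_eq[OF u(1) assms(2)] by simp
  qed
  \<comment> \<open>The exceptional set is fixed here, from rational parameters only and before any
    compact set is chosen; everything after this is deterministic.\<close>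
  have "AE \<omega> in M. \<forall>u\<in>\<rat> \<inter> I. (\<lambda>n. \<phi> \<omega> n u) \<longlonglongrightarrow> F_lim u Hh"
    using pointwise by (subst AE_ball_countable) (auto intro: countable_subset[OF _ countable_rat])
  then show ?thesis
  proof eventually_elim
    case (elim \<omega>)
    show ?case
    proof (intro allI impI, elim conjE)
      fix K :: "real set" assume K: "compact K" "K \<subseteq> {u. Hh - 1/2 < u \<and> 0 < u \<and> u < 1}"
      show "uniform_limit K (\<lambda>n u. rho_n n (\<xi> n \<omega>) u) (\<lambda>u. complex_of_real (F_lim u Hh)) sequentially"
      proof (cases "K = {}")
        case False
        obtain k0 where k0: "k0 \<in> K" "\<And>u. u \<in> K \<Longrightarrow> k0 \<le> u" using compact_attains_inf[OF K(1) False] by blast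
        obtain k1 where k1: "k1 \<in> K" "\<And>u. u \<in> K \<Longrightarrow> u \<le> k1" using compact_attains_sup[OF K(1) False] by blast
        have "max 0 (Hh - 1/2) < k0" "k1 < 1" using k0 k1 K by auto
        \<comment> \<open>The compact set has a least and a greatest element, which leaves room
          inside the open parameter interval for an enclosing interval with rational
          endpoints.\<close>
        obtain a where a: "a \<in> \<rat>" "max 0 (Hh - 1/2) < a" "a < k0" using Rats_dense_in_real[OF \<open>max 0 (Hh - 1/2) < k0\<close>] by blast
        obtain b where b: "b \<in> \<rat>" "k1 < b" "b < 1" using Rats_dense_in_real[OF \<open>k1 < 1\<close>] by blast
        have ab: "a < b" using a b k0 k1 by fastforce
        have sub: "K \<subseteq> {a..b}" using a b k0 k1 by fastforce
        have a': "0 < a" "Hh - 1/2 < a" using a by auto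
        have "uniform_limit {a..b} (\<phi> \<omega>) (\<lambda>u. F_lim u Hh) sequentially"
        proof (rule uniform_limit_almost_antimono[OF a(1) b(1) ab])
          show "continuous_on {a..b} (\<lambda>u. F_lim u Hh)"
            using a' ab b by (intro continuous_on_F_lim assms) auto
          show "0 \<le> \<phi> \<omega> n u" for n u by (simp add: \<phi>_def sum_nonneg)
          show "(\<lambda>n. \<phi> \<omega> n q) \<longlonglongrightarrow> F_lim q Hh" if "q \<in> \<rat>" "a \<le> q" "q \<le> b" for q
            using elim that a' b by (auto simp: I_def)
          fix e :: real assume "e > 0"
          then obtain d where d: "d > 0" "\<And>u v t. a \<le> u \<Longrightarrow> u \<le> v \<Longrightarrow> v \<le> b \<Longrightarrow> v - u < d \<Longrightarrow> fgn_sd_cut u t \<le> (1 + e) * fgn_sd_cut v t"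
            using fgn_sd_cut_almost_mono[OF a'(1) less_imp_le[OF ab] b(3)] by blast
          have "\<phi> \<omega> n v \<le> (1 + e) * \<phi> \<omega> n u" if uv: "a \<le> u" "u \<le> v" "v \<le> b" "v - u < d" for n u v
          proof -
            have r: "0 < u" "u < 1" "0 < v" "v < 1" using uv a' b by auto
            have le: "tform (fgn_sd_cut u) n y y \<le> (1 + e) * tform (fgn_sd_cut v) n y y" for y
              by (rule tform_mono) (use r uv d in \<open>auto intro: sint sev\<close>)
            have "(\<Sum>i<n. (\<Sum>j<n. w v n i j * \<xi> n \<omega> j)\<^sup>2) \<le> (1 + e) * (\<Sum>i<n. (\<Sum>j<n. w u n i j * \<xi> n \<omega> j)\<^sup>2)"
              by (rule inverse_form_antimono[OF w[OF r(1,2)] w[OF r(3,4)] le]) (use \<open>e > 0\<close> in simp)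
            then show ?thesis unfolding \<phi>_def times_divide_eq_right by (rule divide_right_mono) simp
          qed
          then show "\<exists>d>0. \<forall>n u v. a \<le> u \<longrightarrow> u \<le> v \<longrightarrow> v \<le> b \<longrightarrow> v - u < d \<longrightarrow> \<phi> \<omega> n v \<le> (1 + e) * \<phi> \<omega> n u"
            using d(1) by blast
        qed
        then have "uniform_limit K (\<phi> \<omega>) (\<lambda>u. F_lim u Hh) sequentially" by (rule uniform_limit_on_subset[OF _ sub])
        then show ?thesis
        proof (rule metric_uniform_limit_imp_uniform_limit)
          show "\<forall>\<^sub>F n in sequentially. \<forall>u\<in>K. dist (rho_n n (\<xi> n \<omega>) u) (complex_of_real (F_lim u Hh)) \<le> dist (\<phi> \<omega> n u) (F_lim u Hh)"
            using K(2) by (intro always_eventually allI ballI) (subst rho, auto simp: dist_of_real)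
        qed
      qed simp
    qed
  qed
qed

end
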